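(* The frequency response map $\mathcal{S}$ of the transmission/reflection problem, $\mathcal{S}(z)=\mathring{u}_z+w_g\in H^1(D)$, is meromorphic in $\mathbb{C}$, having a pole of order one in each $\lambda\in\Lambda$, where $\Lambda$ is the set of eigenvalues of the Laplacian (with respect to the weighted $L^2(D)$-norm $\|v\|_{L^2(D),\varepsilon_r}=\|\varepsilon_r v\|_{L^2(D)}$) with homogeneous Dirichlet boundary conditions, i.e. the set of $\lambda$ for which there is $0\ne\varphi\in H^1_0(D)$ with $-\Delta\varphi=\lambda\varepsilon_r^2\varphi$ in $D$.
   Context: $D=(-1,1)^2$, $n_1>n_2>0$ are refractive indices, and $\varepsilon_r(x_1,x_2)=n_1$ if $x_2<0$, $\varepsilon_r(x_1,x_2)=n_2$ if $x_2>0$. Functions are complex-valued. Let $\kappa=11$, and let $\theta=29^\circ$ or $\theta=69^\circ$; put $\mathbf{d}=(d_1,d_2)=(\cos\theta,\sin\theta)$, $\mathbf{K}=(K_1,K_2)=(\kappa n_1d_1,\ \kappa\sqrt{n_2^2-(n_1d_1)^2})$ (when the radicand is negative the square root with positive imaginary part is taken, so that the wave decays for $x_2>0$), $R=-\frac{K_2-\kappa n_1d_2}{K_2+\kappa n_1d_2}$, $T=1+R$, and $$u_{ex}(x_1,x_2)=\begin{cases}T\exp\{i\mathbf{K}\cdot\mathbf{x}\}& x_2>0,\\ \exp\{i\kappa n_1\mathbf{d}\cdot\mathbf{x}\}+R\exp\{i\kappa n_1\mathbf{d}\cdot(x_1,-x_2)\}& x_2<0.\end{cases}$$ The Dirichlet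 datum is $g_D=u_{ex}|_{\partial D}$ (fixed, independent of $z$), and $w_g\in H^1(D)$ is its harmonic extension: $\Delta w_g=0$ in $D$, $w_g|_{\partial D}=g_D$. The problem is $-\Delta u-z\varepsilon_r^2u=0$ in $D$, $u=g_D$ on $\partial D$. Its weak form is: find $\mathring{u}_z\in H^1_0(D)$ such that $$\int_D\nabla\mathring{u}_z\cdot\overline{\nabla v}\,d\mathbf{x}-z\int_D\varepsilon_r^2\,\mathring{u}_z\,\overline{v}\,d\mathbf{x}=z\int_D\varepsilon_r^2\,w_g\,\overline{v}\,d\mathbf{x}\qquad\forall v\in H^1_0(D),$$ which is uniquely solvable for $z\in\mathbb{C}\setminus\Lambda$. The frequency response map is $\mathcal{S}(z)=\mathring{u}_z+w_g$.
   Formalization: The pole at λ∈Λ is proved to have order at most one, and exactly one iff w_g is not ε_r²-orthogonal to the eigenspace of λ; as stated the claim fails, e.g. if κ²=121 is an eigenvalue, since u_ex solves the problem at z=κ² and the pole there cancels. *)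

theory Defs
  imports "HOL-Analysis.Analysis"
begin

type_synonym point = "real \<times> real"
type_synonym field = "point \<Rightarrow> complex"

section \<open>Sobolev spaces on the square\<close>

definition D :: "point set" where
  "D = {-1<..<1} \<times> {-1<..<1}"

abbreviation leb_D :: "point measure" where
  "leb_D \<equiv> restrict_space lborel D"

text \<open>
  Elements of the function spaces below are functions on the plane; only their values on \<^term>\<open>D\<close>
  matter, and two of them represent the same element iff they are equal almost everywhere
  in \<^term>\<open>D\<close>.
\<close>

definition ae_eq :: "field \<Rightarrow> field \<Rightarrow> bool" where
  "ae_eq u v \<longleftrightarrow> (AE x in leb_D. u x = v x)"

definition L2 :: "field set" where
  "L2 = {u \<in> borel_measurable leb_D. integrable leb_D (\<lambda>x. (cmod (u x))\<^sup>2)}"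

definition pdiff :: "point \<Rightarrow> field \<Rightarrow> field" where
  "pdiff e f = (\<lambda>x. frechet_derivative f (at x) e)"

text \<open>
  Infinite differentiability: every iterated partial derivative exists and is itself
  (Frechet) differentiable.
\<close>

definition smooth :: "field \<Rightarrow> bool" where
  "smooth f \<longleftrightarrow> (\<forall>es. set es \<subseteq> Basis \<longrightarrow> (\<forall>x. foldr pdiff es f differentiable (at x)))"

definition test_functions :: "field set" where
  "test_functions = {\<phi>. smooth \<phi> \<and> compact (closure {x. \<phi> x \<noteq> 0}) \<and> closure {x. \<phi> x \<noteq> 0} \<subseteq> D}"

definition has_weak_pdiff :: "point \<Rightarrow> field \<Rightarrow> field \<Rightarrow> bool" where
  "has_weak_pdiff e u g \<longleftrightarrow> g \<in> L2 \<and>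
     (\<forall>\<phi>\<in>test_functions. (\<integral>x. u x * pdiff e \<phi> x \<partial>leb_D) = - (\<integral>x. g x * \<phi> x \<partial>leb_D))"

definition weak_pdiff :: "point \<Rightarrow> field \<Rightarrow> field" where
  "weak_pdiff e u = (SOME g. has_weak_pdiff e u g)"

definition H1 :: "field set" where
  "H1 = {u \<in> L2. \<forall>e\<in>Basis. \<exists>g. has_weak_pdiff e u g}"

definition h1_norm :: "field \<Rightarrow> real" where
  "h1_norm u = sqrt ((\<integral>x. (cmod (u x))\<^sup>2 \<partial>leb_D)
     + (\<Sum>e\<in>Basis. \<integral>x. (cmod (weak_pdiff e u x))\<^sup>2 \<partial>leb_D))"

definition H10 :: "field set" where
  "H10 = {u \<in> H1. \<exists>\<phi>. (\<forall>n. \<phi> n \<in> test_functions) \<and>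
     (\<lambda>n. h1_norm (\<lambda>x. \<phi> n x - u x)) \<longlonglongrightarrow> 0}"

text \<open>
  Square of the \<open>L\<^sup>2\<close> distance on the boundary, as the sum of the integrals over the four sides.
\<close>

definition bdry_dist2 :: "field \<Rightarrow> field \<Rightarrow> ennreal" where
  "bdry_dist2 f g = (\<integral>\<^sup>+ t\<in>{-1..1}.
      ennreal ((cmod (f (-1, t) - g (-1, t)))\<^sup>2 + (cmod (f (1, t) - g (1, t)))\<^sup>2
             + (cmod (f (t, -1) - g (t, -1)))\<^sup>2 + (cmod (f (t, 1) - g (t, 1)))\<^sup>2) \<partial>lborel)"

text \<open>
  The trace operator is the continuous extension from \<^term>\<open>H1\<close> to \<open>L\<^sup>2\<close> of the boundary of the
  restriction map on functions that are smooth up to the boundary; below, \<^term>\<open>g\<close> is only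
  evaluated on the boundary.
\<close>

definition has_trace :: "field \<Rightarrow> field \<Rightarrow> bool" where
  "has_trace u g \<longleftrightarrow> u \<in> H1 \<and> (\<exists>\<phi>. (\<forall>n. smooth (\<phi> n)) \<and>
     (\<lambda>n. h1_norm (\<lambda>x. \<phi> n x - u x)) \<longlonglongrightarrow> 0 \<and> (\<lambda>n. bdry_dist2 (\<phi> n) g) \<longlonglongrightarrow> 0)"

section \<open>Holomorphic and meromorphic maps with values in \<open>H1\<close>\<close>

definition h1_holomorphic_on :: "(complex \<Rightarrow> field) \<Rightarrow> complex set \<Rightarrow> bool" where
  "h1_holomorphic_on F A \<longleftrightarrow> (\<forall>z\<in>A. F z \<in> H1) \<and>
     (\<forall>z\<in>A. \<exists>F'\<in>H1.
        ((\<lambda>w. h1_norm (\<lambda>x. (F w x - F z x) / (w - z) - F' x)) \<longlongrightarrow> 0) (at z within A))"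

text \<open>
  Near \<^term>\<open>p\<close> the map is \<open>(z - p)\<^bsup>-n\<^esup> G z\<close> with \<^term>\<open>G\<close> holomorphic at \<^term>\<open>p\<close>, i.e. the
  principal part of the Laurent expansion has order at most \<^term>\<open>n\<close> (removable for \<open>n = 0\<close>).
\<close>

definition h1_pole_order_le :: "(complex \<Rightarrow> field) \<Rightarrow> complex \<Rightarrow> nat \<Rightarrow> bool" where
  "h1_pole_order_le F p n \<longleftrightarrow> (\<exists>r>0. \<exists>G. h1_holomorphic_on G (ball p r) \<and>
     (\<forall>z\<in>ball p r - {p}. ae_eq (F z) (\<lambda>x. G z x / (z - p) ^ n)))"

definition h1_pole_of_order :: "(complex \<Rightarrow> field) \<Rightarrow> complex \<Rightarrow> nat \<Rightarrow> bool" where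
  "h1_pole_of_order F p n \<longleftrightarrow> n > 0 \<and> (\<exists>r>0. \<exists>G. h1_holomorphic_on G (ball p r) \<and>
     \<not> ae_eq (G p) (\<lambda>x. 0) \<and>
     (\<forall>z\<in>ball p r - {p}. ae_eq (F z) (\<lambda>x. G z x / (z - p) ^ n)))"

text \<open>
  Meromorphic in the whole plane, with all singularities in the closed discrete set \<^term>\<open>P\<close>;
  the values on \<^term>\<open>P\<close> are irrelevant.
\<close>

definition h1_meromorphic :: "(complex \<Rightarrow> field) \<Rightarrow> complex set \<Rightarrow> bool" where
  "h1_meromorphic F P \<longleftrightarrow> (\<forall>z. \<not> z islimpt P) \<and> h1_holomorphic_on F (- P) \<and>
     (\<forall>p\<in>P. \<exists>n. h1_pole_order_le F p n)"

section \<open>The transmission/reflection problem\<close>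

definition eps_r :: "real \<Rightarrow> real \<Rightarrow> point \<Rightarrow> real" where
  "eps_r n1 n2 x = (if snd x < 0 then n1 else n2)"

definition grad_form :: "field \<Rightarrow> field \<Rightarrow> complex" where
  "grad_form u v = (\<integral>x. (\<Sum>e\<in>Basis. weak_pdiff e u x * cnj (weak_pdiff e v x)) \<partial>leb_D)"

definition eps_form :: "real \<Rightarrow> real \<Rightarrow> field \<Rightarrow> field \<Rightarrow> complex" where
  "eps_form n1 n2 u v = (\<integral>x. complex_of_real ((eps_r n1 n2 x)\<^sup>2) * u x * cnj (v x) \<partial>leb_D)"

definition eigenfunction :: "real \<Rightarrow> real \<Rightarrow> complex \<Rightarrow> field \<Rightarrow> bool" where
  "eigenfunction n1 n2 lam \<phi> \<longleftrightarrow> \<phi> \<in> H10 \<and> \<not> ae_eq \<phi> (\<lambda>x. 0) \<and>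
     (\<forall>v\<in>H10. grad_form \<phi> v = lam * eps_form n1 n2 \<phi> v)"

definition eigenvalues :: "real \<Rightarrow> real \<Rightarrow> complex set" where
  "eigenvalues n1 n2 = {lam. \<exists>\<phi>. eigenfunction n1 n2 lam \<phi>}"

text \<open>
  The first component of the wave vector is \<open>\<kappa> n1 d1\<close>, the second one is \<open>K2\<close>. The principal
  square root \<^const>\<open>csqrt\<close> of a negative real number has positive imaginary part.
\<close>

definition K2 :: "real \<Rightarrow> real \<Rightarrow> real \<Rightarrow> real \<Rightarrow> complex" where
  "K2 n1 n2 \<kappa> \<theta> = complex_of_real \<kappa> * csqrt (complex_of_real (n2\<^sup>2 - (n1 * cos \<theta>)\<^sup>2))"

definition refl_coeff :: "real \<Rightarrow> real \<Rightarrow> real \<Rightarrow> real \<Rightarrow> complex" where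
  "refl_coeff n1 n2 \<kappa> \<theta> = - ((K2 n1 n2 \<kappa> \<theta> - complex_of_real (\<kappa> * n1 * sin \<theta>))
                            / (K2 n1 n2 \<kappa> \<theta> + complex_of_real (\<kappa> * n1 * sin \<theta>)))"

definition trans_coeff :: "real \<Rightarrow> real \<Rightarrow> real \<Rightarrow> real \<Rightarrow> complex" where
  "trans_coeff n1 n2 \<kappa> \<theta> = 1 + refl_coeff n1 n2 \<kappa> \<theta>"

text \<open>On the line \<open>x2 = 0\<close> both expressions agree, since \<open>T = 1 + R\<close>.\<close>

definition u_ex :: "real \<Rightarrow> real \<Rightarrow> real \<Rightarrow> real \<Rightarrow> field" where
  "u_ex n1 n2 \<kappa> \<theta> = (\<lambda>(x1, x2).
     if x2 > 0
     then trans_coeff n1 n2 \<kappa> \<theta>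
            * exp (\<i> * (complex_of_real (\<kappa> * n1 * cos \<theta> * x1) + K2 n1 n2 \<kappa> \<theta> * complex_of_real x2))
     else exp (\<i> * complex_of_real (\<kappa> * n1 * (cos \<theta> * x1 + sin \<theta> * x2)))
          + refl_coeff n1 n2 \<kappa> \<theta>
            * exp (\<i> * complex_of_real (\<kappa> * n1 * (cos \<theta> * x1 - sin \<theta> * x2))))"

definition harmonic_extension :: "field \<Rightarrow> field \<Rightarrow> bool" where
  "harmonic_extension g w \<longleftrightarrow> w \<in> H1 \<and> has_trace w g \<and> (\<forall>v\<in>H10. grad_form w v = 0)"

definition weak_solution :: "real \<Rightarrow> real \<Rightarrow> field \<Rightarrow> complex \<Rightarrow> field \<Rightarrow> bool" where
  "weak_solution n1 n2 w z u \<longleftrightarrow> u \<in> H10 \<and>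
     (\<forall>v\<in>H10. grad_form u v - z * eps_form n1 n2 u v = z * eps_form n1 n2 w v)"

text \<open>
  Meaningful for \<^term>\<open>z\<close> outside the spectrum, where the weak solution exists and is unique up
  to null sets.
\<close>

definition frequency_response :: "real \<Rightarrow> real \<Rightarrow> field \<Rightarrow> complex \<Rightarrow> field" where
  "frequency_response n1 n2 w z = (\<lambda>x. (SOME u. weak_solution n1 n2 w z u) x + w x)"

end

theory Submission
  imports Defs "HOL-Real_Asymp.Real_Asymp"
begin

text \<open>
  Inverting the Dirichlet Laplacian turns the problem into a linear equation with a compact
  operator. On \<open>H\<^sup>1\<^sub>0\<close> with the inner product \<open>\<integral>\<nabla>u \<cdot> \<nabla>v\<close> let \<open>B\<close> be the operator with
  \<open>\<langle>B u, v\<rangle> = \<integral>\<epsilon>\<^sub>r\<^sup>2 u v\<close> (Hermitian products), and let \<open>g\<close> represent the functional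
  \<open>v \<mapsto> \<integral>\<epsilon>\<^sub>r\<^sup>2 w v\<close> of the extension \<open>w\<close> of the boundary datum. Then the weak problem reads
  \<open>u = z B u + z g\<close>, and \<open>\<Lambda>\<close> consists of the numbers \<open>\<lambda>\<close> for which \<open>\<phi> = \<lambda> B \<phi>\<close> has a
  nonzero solution. The operator \<open>B\<close> is positive and symmetric, and by Rellich's theorem compact.

  Hence, for every radius \<open>R\<close>, there are only finitely many orthonormal eigenvectors \<open>e\<close> of \<open>B\<close> with
  eigenvalue \<open>\<mu>\<^sub>e \<ge> 1/R\<close>, and on their orthogonal complement the norm of \<open>B\<close> is some \<open>m < 1/R\<close>
  (\<open>spectral_cut\<close>). For \<open>|z| < R\<close> the solution is therefore
  \<open>u(z) = (\<Sum>\<^sub>e z/(1 - z \<mu>\<^sub>e) \<langle>g, e\<rangle> e) + (\<Sum>\<^sub>j z\<^bsup>j+1\<^esup> B\<^sup>j g')\<close>, where \<open>g'\<close> is the component of \<open>g\<close>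
  orthogonal to the \<open>e\<close>. The Neumann series is holomorphic in the disc, and the finite sum has at
  most simple poles, at the points \<open>1/\<mu>\<^sub>e\<close> (\<open>regular_part\<close>, \<open>solution_formula\<close>). The coefficient of
  the pole at \<open>\<lambda>\<close> is \<open>-\<lambda>\<^sup>2\<close> times the projection of \<open>g\<close> to the eigenspace. It is nonzero iff \<open>g\<close> is
  not orthogonal to the eigenspace, that is, iff \<open>\<integral>\<epsilon>\<^sub>r\<^sup>2 w \<phi>\<close> (Hermitian) is nonzero for some
  eigenfunction \<open>\<phi>\<close> (\<open>sol_pole\<close>). Adding \<open>w\<close>, which does not depend on \<open>z\<close>, changes neither
  holomorphy nor the poles.

  Two parts of this need work. First, the spaces: \<open>L\<^sup>2\<close> is made a Hilbert space by passing to classes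
  of functions (Riesz-Fischer). A function in \<open>H\<^sup>1\<close> is represented by its jet \<open>(u, \<partial>\<^sub>1u, \<partial>\<^sub>2u)\<close>, which
  is well defined since weak derivatives are unique (\<open>fundamental_lemma\<close>), and \<open>H\<^sup>1\<^sub>0\<close> is the closure
  of the jets of test functions, a closed subspace of \<open>(L\<^sup>2)\<^sup>3\<close>. Second, compactness: on a cell of
  side \<open>h\<close> the \<open>L\<^sup>2\<close> norm is bounded by the mean value and by \<open>h\<close> times the gradient
  (\<open>cell_estimate\<close>), so that on a fine grid finitely many linear functionals control the \<open>L\<^sup>2\<close> norm
  up to a small multiple of the gradient norm (\<open>jets0_rellich\<close>).
\<close>

section \<open>Compact positive operators on a Hilbert space\<close>

text \<open>The representing vector minimises \<open>|x|\<^sup>2 - 2 f x\<close>. By the parallelogram identity minimising sequences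
  are Cauchy, and at the minimum the first variation \<open>2 \<langle>g, h\<rangle> - 2 f h\<close> vanishes.\<close>

lemma riesz_representation:
  fixes f :: "'a::{real_inner,banach} \<Rightarrow> real"
  assumes "bounded_linear f"
  shows "\<exists>g. \<forall>x. f x = inner g x"
proof -
  interpret bounded_linear f by fact
  define Q where "Q x = inner x x - 2 * f x" for x
  obtain K where K: "\<And>x. norm (f x) \<le> norm x * K"
    using bounded by blast
  have lower: "- (K\<^sup>2) \<le> Q x" for x
  proof -
    have "f x \<le> norm x * K" using K[of x] by simp
    moreover have "0 \<le> (norm x - K)\<^sup>2" by simp
    ultimately show ?thesis
      by (simp add: Q_def power2_norm_eq_inner[symmetric] power2_diff)
  qed
  define I where "I = Inf (range Q)"
  have I_le: "I \<le> Q x" for x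
    unfolding I_def using lower by (intro cInf_lower) (auto intro!: bdd_belowI)
  have "\<exists>x. Q x < I + inverse (real (Suc n))" for n
    using cInf_lessD[of "range Q" "I + inverse (real (Suc n))"] by (auto simp: I_def)
  then obtain x where x: "\<And>n. Q (x n) < I + inverse (real (Suc n))" by metis
  have par: "(norm (y - z))\<^sup>2 \<le> 2 * (Q y - I) + 2 * (Q z - I)" for y z
  proof -
    have "(norm (y - z))\<^sup>2 = 2 * Q y + 2 * Q z - 4 * Q ((1/2) *\<^sub>R (y + z))"
      unfolding Q_def power2_norm_eq_inner
      by (simp add: inner_simps scaleR add inner_commute algebra_simps)
    then show ?thesis using I_le[of "(1/2) *\<^sub>R (y + z)"] by simp
  qed
  have "Cauchy x"
  proof (rule metric_CauchyI)
    fix e :: real assume "e > 0"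
    obtain N where N: "inverse (real (Suc N)) < e\<^sup>2 / 4"
      using reals_Archimedean[of "e\<^sup>2/4"] \<open>e > 0\<close> by auto
    have "dist (x m) (x n) < e" if "m \<ge> N" "n \<ge> N" for m n
    proof -
      have "inverse (real (Suc k)) \<le> inverse (real (Suc N))" if "k \<ge> N" for k
        using that by (simp add: field_simps)
      then have "Q (x k) - I < e\<^sup>2 / 4" if "k \<ge> N" for k
        using x[of k] N that by (smt (verit))
      from this[of m] this[of n] have "(norm (x m - x n))\<^sup>2 < e\<^sup>2"
        using par[of "x m" "x n"] that by simp
      then show ?thesis using \<open>e > 0\<close>
        by (simp add: dist_norm power_less_imp_less_base)
    qed
    then show "\<exists>M. \<forall>m\<ge>M. \<forall>n\<ge>M. dist (x m) (x n) < e" by blast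
  qed
  then obtain g where g: "x \<longlonglongrightarrow> g"
    using Cauchy_convergent_iff convergent_def by blast
  have "(\<lambda>n. Q (x n)) \<longlonglongrightarrow> Q g"
    unfolding Q_def by (intro tendsto_intros g tendsto)
  moreover have "(\<lambda>n. I + inverse (real (Suc n))) \<longlonglongrightarrow> I + 0"
    by (intro tendsto_intros LIMSEQ_inverse_real_of_nat)
  ultimately have "Q g \<le> I"
    using x by (intro LIMSEQ_le) (auto intro: less_imp_le)
  have "f h = inner g h" for h
  proof (cases "h = 0")
    case True then show ?thesis by (simp add: zero)
  next
    case False
    define t where "t = (f h - inner g h) / inner h h"
    have hh: "inner h h > 0" using False by simp
    have "Q g \<le> Q (g + t *\<^sub>R h)" using \<open>Q g \<le> I\<close> I_le by (rule order_trans)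
    then have "0 \<le> 2 * t * (inner g h - f h) + t * t * inner h h"
      by (simp add: Q_def inner_simps add scaleR inner_commute algebra_simps)
    also have "\<dots> = - ((f h - inner g h)\<^sup>2 / inner h h)"
      using hh by (simp add: t_def field_simps power2_eq_square)
    finally have "(f h - inner g h)\<^sup>2 / inner h h \<le> 0" by simp
    then show ?thesis using hh by (simp add: divide_le_0_iff power2_less_eq_zero_iff)
  qed
  then show ?thesis by blast
qed

lemma bounded_sequences_common_subsequence:
  fixes f :: "'b \<Rightarrow> nat \<Rightarrow> real"
  assumes "finite L" and "\<And>l. l \<in> L \<Longrightarrow> bounded (range (f l))"
  shows "\<exists>r::nat\<Rightarrow>nat. strict_mono r \<and> (\<forall>l\<in>L. convergent (f l \<circ> r))"
  using assms
proof (induction L)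
  case empty
  then show ?case using strict_mono_id by blast
next
  case (insert a L)
  then obtain r where r: "strict_mono r" "\<forall>l\<in>L. convergent (f l \<circ> r)" by (metis insertCI)
  have "bounded (range (f a \<circ> r))"
    using insert.prems[of a] by (auto intro: bounded_subset)
  then obtain s l where s: "strict_mono s" "((f a \<circ> r) \<circ> s) \<longlonglongrightarrow> l"
    using bounded_imp_convergent_subsequence by blast
  have "convergent (f b \<circ> (r \<circ> s))" if "b \<in> insert a L" for b
    using that r s by (metis convergentI convergent_subseq_convergent insertE o_assoc)
  then show ?case using strict_mono_o[OF r(1) s(1)] by blast
qed

lemma bessel_inequality:
  fixes E :: "'a::real_inner set"
  assumes "finite E" "\<And>e. e \<in> E \<Longrightarrow> norm e = 1" "pairwise (\<lambda>x y. inner x y = 0) E"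
  shows "(\<Sum>e\<in>E. (inner l e)\<^sup>2) \<le> (norm l)\<^sup>2"
proof -
  define p where "p = (\<Sum>e\<in>E. inner l e *\<^sub>R e)"
  have pe: "inner p e = inner l e" if "e \<in> E" for e
  proof -
    have "inner p e = (\<Sum>d\<in>E. inner l d * inner d e)"
      by (simp add: p_def inner_sum_left)
    also have "\<dots> = (\<Sum>d\<in>E. if d = e then inner l e else 0)"
      using assms that by (intro sum.cong) (auto simp: pairwise_def norm_eq_1)
    finally show ?thesis using assms(1) that by simp
  qed
  have lp: "inner l p = (\<Sum>e\<in>E. (inner l e)\<^sup>2)"
    by (simp add: p_def inner_sum_right power2_eq_square)
  have "inner p p = (\<Sum>e\<in>E. inner l e * inner p e)"
    unfolding p_def inner_sum_right inner_scaleR_right by simp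
  then have pp: "inner p p = (\<Sum>e\<in>E. (inner l e)\<^sup>2)"
    by (simp add: pe power2_eq_square)
  have "0 \<le> inner (l - p) (l - p)" by simp
  also have "\<dots> = (norm l)\<^sup>2 - (\<Sum>e\<in>E. (inner l e)\<^sup>2)"
    by (simp add: inner_diff_left inner_diff_right lp pp inner_commute[of p l] power2_norm_eq_inner)
  finally show ?thesis by simp
qed

text \<open>Compactness is expressed by an inequality: up to an arbitrarily small multiple of the norm,
  finitely many linear functionals control the form of \<open>B\<close>. This is how it arises from
  estimates on a grid. It bounds the number of large eigenvalues directly, and for a single
  \<open>\<epsilon>\<close> it turns convergence of finitely many scalar sequences into convergence of vectors.\<close>

locale compact_positive_operator =
  fixes B :: "'a::{real_inner,banach} \<Rightarrow> 'a"
  assumes B_bounded_linear: "bounded_linear B"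
    and B_sym: "inner (B x) y = inner x (B y)"
    and B_pos: "x \<noteq> 0 \<Longrightarrow> inner (B x) x > 0"
    and B_compact: "\<epsilon> > 0 \<Longrightarrow>
      \<exists>L. finite L \<and> (\<forall>x. inner (B x) x \<le> \<epsilon> * (norm x)\<^sup>2 + (\<Sum>l\<in>L. (inner l x)\<^sup>2))"
begin

sublocale B: bounded_linear B by (rule B_bounded_linear)

lemma B_nonneg: "inner (B x) x \<ge> 0"
  using B_pos[of x] by (cases "x = 0") (auto simp: less_imp_le)

lemma B_form_Cauchy_Schwarz: "(inner (B x) y)\<^sup>2 \<le> inner (B x) x * inner (B y) y"
proof (cases "y = 0")
  case True then show ?thesis by (simp add: B.zero)
next
  case False
  define c where "c = inner (B y) y"
  have c: "c > 0" using B_pos[OF False] by (simp add: c_def)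
  \<comment> \<open>This \<open>t\<close> minimises the form at \<open>x - t y\<close>.\<close>
  define t where "t = inner (B x) y / c"
  have "0 \<le> inner (B (x - t *\<^sub>R y)) (x - t *\<^sub>R y)" by (rule B_nonneg)
  also have "\<dots> = inner (B x) x - 2 * t * inner (B x) y + t * t * c"
    using B_sym[of y x] by (simp add: B.diff B.scaleR inner_simps c_def inner_commute algebra_simps)
  also have "\<dots> = inner (B x) x - (inner (B x) y)\<^sup>2 / c"
    using c by (simp add: t_def field_simps power2_eq_square)
  finally show ?thesis using c by (simp add: field_simps c_def)
qed

text \<open>This is the Cauchy-Schwarz inequality of the form \<open>\<langle>B x, y\<rangle>\<close> with \<open>y = B x\<close>.\<close>

lemma norm_B_le:
  assumes "\<And>y. y \<in> W \<Longrightarrow> inner (B y) y \<le> m * (norm y)\<^sup>2" "\<And>y. y \<in> W \<Longrightarrow> B y \<in> W" "x \<in> W"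
  shows "(norm (B x))\<^sup>2 \<le> m * inner (B x) x"
proof (cases "B x = 0")
  case True then show ?thesis by simp
next
  case False
  define N where "N = (norm (B x))\<^sup>2"
  have N: "N > 0" using False by (simp add: N_def)
  have "N\<^sup>2 \<le> inner (B x) x * inner (B (B x)) (B x)"
    using B_form_Cauchy_Schwarz[of x "B x"] by (simp add: N_def power2_norm_eq_inner)
  also have "\<dots> \<le> inner (B x) x * (m * N)"
    unfolding N_def using assms by (intro mult_left_mono B_nonneg) auto
  finally have "N * N \<le> (m * inner (B x) x) * N" by (simp add: power2_eq_square ac_simps)
  then show ?thesis using N by (simp add: N_def[symmetric])
qed

text \<open>The eigenvalue is the supremum \<open>m\<close> of \<open>\<langle>B x, x\<rangle>\<close> over the unit vectors of \<open>W\<close>. Along a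
  maximising sequence \<open>B x - m x\<close> tends to \<open>0\<close>, because its squared norm is at most
  \<open>m (m - \<langle>B x, x\<rangle>)\<close>. The compactness inequality for \<open>\<epsilon> = m/2\<close>, applied to differences of the sequence,
  leaves \<open>m/2\<close> times their squared norm on the left, so that the sequence is Cauchy as soon as the
  finitely many functionals in the inequality converge along it, which holds after passing to a
  subsequence.\<close>

lemma top_eigenvector:
  assumes W: "subspace W" "closed W" "\<And>y. y \<in> W \<Longrightarrow> B y \<in> W" and "w \<in> W" "w \<noteq> 0"
  shows "\<exists>x m. x \<in> W \<and> norm x = 1 \<and> B x = m *\<^sub>R x \<and> (\<forall>y\<in>W. inner (B y) y \<le> m * (norm y)\<^sup>2)"
proof -
  define U where "U = {inner (B y) y | y. y \<in> W \<and> norm y = 1}"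
  define m where "m = Sup U"
  obtain K where K: "\<And>x. norm (B x) \<le> norm x * K" using B.bounded by blast
  have bdd: "bdd_above U"
  proof (rule bdd_aboveI)
    fix u assume "u \<in> U"
    then obtain y where y: "u = inner (B y) y" "norm y = 1" by (auto simp: U_def)
    have "inner (B y) y \<le> norm (B y) * norm y" by (rule norm_cauchy_schwarz)
    also have "\<dots> \<le> K" using K[of y] y by simp
    finally show "u \<le> K" using y by simp
  qed
  have le_m: "inner (B y) y \<le> m * (norm y)\<^sup>2" if "y \<in> W" for y
  proof (cases "y = 0")
    case True then show ?thesis by simp
  next
    case False
    define u where "u = (1 / norm y) *\<^sub>R y"
    have "u \<in> W" "norm u = 1" using that False W(1) by (auto simp: u_def subspace_scale)
    then have "inner (B u) u \<le> m" unfolding m_def by (intro cSup_upper bdd) (auto simp: U_def)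
    moreover have "inner (B u) u = inner (B y) y / (norm y)\<^sup>2"
      by (simp add: u_def B.scaleR power2_eq_square)
    ultimately show ?thesis using False by (simp add: field_simps)
  qed
  have w: "inner (B w) w > 0" using B_pos assms by blast
  have "m > 0"
    using le_m[OF \<open>w \<in> W\<close>] w by (smt (verit) mult_nonpos_nonneg zero_le_power2)
  define v where "v = (1 / norm w) *\<^sub>R w"
  have "v \<in> W" "norm v = 1" using assms by (auto simp: v_def subspace_scale)
  then have "U \<noteq> {}" by (auto simp: U_def)
  have "\<exists>y. y \<in> W \<and> norm y = 1 \<and> m - inverse (real (Suc n)) < inner (B y) y" for n
  proof -
    have "m - inverse (real (Suc n)) < Sup U" by (simp add: m_def)
    then obtain u where "u \<in> U" "m - inverse (real (Suc n)) < u"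
      using less_cSup_iff[OF \<open>U \<noteq> {}\<close> bdd] by blast
    then show ?thesis by (auto simp: U_def)
  qed
  then obtain x where x: "\<And>n. x n \<in> W" "\<And>n. norm (x n) = 1"
    and xm: "\<And>n. m - inverse (real (Suc n)) < inner (B (x n)) (x n)" by metis
  have form_lim: "(\<lambda>n. inner (B (x n)) (x n)) \<longlonglongrightarrow> m"
  proof (rule tendsto_sandwich)
    show "(\<lambda>n. m - inverse (real (Suc n))) \<longlonglongrightarrow> m"
      using tendsto_diff[OF tendsto_const LIMSEQ_inverse_real_of_nat, of m] by simp
    show "\<forall>\<^sub>F n in sequentially. inner (B (x n)) (x n) \<le> m"
      using le_m[OF x(1)] x(2) by simp
    show "\<forall>\<^sub>F n in sequentially. m - inverse (real (Suc n)) \<le> inner (B (x n)) (x n)"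
      using xm by (intro always_eventually allI less_imp_le)
  qed simp
  have res_lim: "(\<lambda>n. B (x n) - m *\<^sub>R x n) \<longlonglongrightarrow> 0"
  proof -
    have "(norm (B (x n) - m *\<^sub>R x n))\<^sup>2 \<le> m * (m - inner (B (x n)) (x n))" for n
    proof -
      have "(norm (B (x n) - m *\<^sub>R x n))\<^sup>2
          = (norm (B (x n)))\<^sup>2 - 2 * m * inner (B (x n)) (x n) + m\<^sup>2 * (norm (x n))\<^sup>2"
        unfolding power2_norm_eq_inner by (simp add: inner_simps inner_commute power2_eq_square)
      also have "\<dots> \<le> m * inner (B (x n)) (x n) - 2 * m * inner (B (x n)) (x n) + m\<^sup>2"
        using norm_B_le[of W m "x n"] le_m W x by simp
      finally show ?thesis by (simp add: algebra_simps power2_eq_square)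
    qed
    then have bound: "\<forall>\<^sub>F n in sequentially.
        norm ((norm (B (x n) - m *\<^sub>R x n))\<^sup>2) \<le> m * (m - inner (B (x n)) (x n))" by simp
    have "(\<lambda>n. m * (m - inner (B (x n)) (x n))) \<longlonglongrightarrow> m * (m - m)"
      by (intro tendsto_intros form_lim)
    then have "(\<lambda>n. m * (m - inner (B (x n)) (x n))) \<longlonglongrightarrow> 0" by simp
    from Lim_null_comparison[OF bound this]
    have "(\<lambda>n. (norm (B (x n) - m *\<^sub>R x n))\<^sup>2) \<longlonglongrightarrow> 0" .
    then have "(\<lambda>n. sqrt ((norm (B (x n) - m *\<^sub>R x n))\<^sup>2)) \<longlonglongrightarrow> sqrt 0"
      by (intro tendsto_intros)
    then show ?thesis by (simp add: tendsto_norm_zero_iff)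
  qed
  obtain L where L: "finite L"
    "\<And>x. inner (B x) x \<le> (m/2) * (norm x)\<^sup>2 + (\<Sum>l\<in>L. (inner l x)\<^sup>2)"
    using B_compact[of "m/2"] \<open>m > 0\<close> by auto
  have "bounded (range (\<lambda>n. inner l (x n)))" for l
  proof -
    have "norm (inner l (x n)) \<le> norm l" for n
      using Cauchy_Schwarz_ineq2[of l "x n"] x(2)[of n] by simp
    then show ?thesis by (auto simp: bounded_iff)
  qed
  then obtain r where r: "strict_mono (r::nat\<Rightarrow>nat)"
    "\<forall>l\<in>L. convergent ((\<lambda>n. inner l (x n)) \<circ> r)"
    using bounded_sequences_common_subsequence[OF L(1), of "\<lambda>l n. inner l (x n)"] by auto
  define y where "y n = x (r n)" for n
  define \<rho> where "\<rho> n = B (y n) - m *\<^sub>R y n" for n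
  have \<rho>: "\<rho> \<longlonglongrightarrow> 0"
    using LIMSEQ_subseq_LIMSEQ[OF res_lim r(1)] by (simp add: \<rho>_def[abs_def] y_def o_def)
  have key: "(m/2) * (norm (y i - y j))\<^sup>2
      \<le> 2 * (norm (\<rho> i) + norm (\<rho> j)) + (\<Sum>l\<in>L. (inner l (y i) - inner l (y j))\<^sup>2)" for i j
  proof -
    let ?d = "y i - y j"
    have "norm ?d \<le> 2" using norm_triangle_ineq4[of "y i" "y j"] x(2) by (simp add: y_def)
    have "m * (norm ?d)\<^sup>2 - inner (B ?d) ?d = - inner (\<rho> i - \<rho> j) ?d"
      by (simp add: \<rho>_def B.diff power2_norm_eq_inner inner_simps algebra_simps)
    also have "\<dots> \<le> norm (\<rho> i - \<rho> j) * norm ?d"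
      using norm_cauchy_schwarz[of "\<rho> j - \<rho> i" ?d]
      by (simp add: inner_diff_left norm_minus_commute)
    also have "\<dots> \<le> (norm (\<rho> i) + norm (\<rho> j)) * 2"
      using \<open>norm ?d \<le> 2\<close> by (intro mult_mono norm_triangle_ineq4) auto
    finally have "m * (norm ?d)\<^sup>2 - inner (B ?d) ?d \<le> 2 * (norm (\<rho> i) + norm (\<rho> j))" by simp
    moreover have "inner (B ?d) ?d \<le> (m/2) * (norm ?d)\<^sup>2 + (\<Sum>l\<in>L. (inner l (y i) - inner l (y j))\<^sup>2)"
      using L(2)[of ?d] by (simp add: inner_diff_right)
    ultimately show ?thesis by (simp add: field_simps)
  qed
  have "Cauchy y"
  proof (rule metric_CauchyI)
    fix e :: real assume "e > 0"
    \<comment> \<open>The two residuals contribute at most \<open>4 d\<close>, each functional at most \<open>d\<close>; one more \<open>d\<close> keeps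
      the inequality strict and the denominator positive.\<close>
    define d where "d = (m/2) * e\<^sup>2 / (4 + real (card L) + 1)"
    have "d > 0" using \<open>m > 0\<close> \<open>e > 0\<close> by (simp add: d_def)
    have 1: "\<forall>\<^sub>F n in sequentially. norm (\<rho> n) < d"
      using \<rho> \<open>d > 0\<close> by (simp add: tendsto_iff)
    have "\<exists>M. \<forall>i\<ge>M. \<forall>j\<ge>M. dist (inner l (y i)) (inner l (y j)) < sqrt d" if "l \<in> L" for l
      using r(2) that \<open>d > 0\<close> convergent_Cauchy[of "\<lambda>n. inner l (y n)"]
      by (auto simp: y_def o_def intro!: metric_CauchyD)
    then obtain M where M: "\<And>l i j. l \<in> L \<Longrightarrow> i \<ge> M l \<Longrightarrow> j \<ge> M l \<Longrightarrow>
        dist (inner l (y i)) (inner l (y j)) < sqrt d" by metis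
    obtain N0 where N0: "\<And>n. n \<ge> N0 \<Longrightarrow> norm (\<rho> n) < d"
      using 1 by (auto simp: eventually_sequentially)
    define N where "N = Max (insert N0 (M ` L))"
    have N: "N \<ge> N0" "\<And>l. l \<in> L \<Longrightarrow> N \<ge> M l" using L(1) by (auto simp: N_def)
    have "dist (y i) (y j) < e" if ij: "i \<ge> N" "j \<ge> N" for i j
    proof -
      have "(inner l (y i) - inner l (y j))\<^sup>2 \<le> d" if "l \<in> L" for l
      proof -
        have "\<bar>inner l (y i) - inner l (y j)\<bar> < sqrt d"
          using M[OF that, of i j] N(2)[OF that] ij by (simp add: dist_real_def)
        then have "\<bar>inner l (y i) - inner l (y j)\<bar>\<^sup>2 \<le> (sqrt d)\<^sup>2"
          by (intro power_mono) auto
        then show ?thesis using \<open>d > 0\<close> by simp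
      qed
      then have "(\<Sum>l\<in>L. (inner l (y i) - inner l (y j))\<^sup>2) \<le> card L * d"
        using sum_mono[of L "\<lambda>l. (inner l (y i) - inner l (y j))\<^sup>2" "\<lambda>_. d"] by simp
      moreover have "2 * (norm (\<rho> i) + norm (\<rho> j)) < 4 * d" using N0[of i] N0[of j] ij N by simp
      ultimately have "(m/2) * (norm (y i - y j))\<^sup>2 < (4 + real (card L) + 1) * d"
        using key[of i j] \<open>d > 0\<close> by (simp add: algebra_simps)
      also have "\<dots> = (m/2) * e\<^sup>2"
        using nonzero_mult_div_cancel_left[of "4 + real (card L) + 1" "(m/2) * e\<^sup>2"]
        unfolding d_def times_divide_eq_right by linarith
      finally have "(norm (y i - y j))\<^sup>2 < e\<^sup>2" using \<open>m > 0\<close> by simp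
      then show ?thesis using \<open>e > 0\<close> by (simp add: dist_norm power_less_imp_less_base)
    qed
    then show "\<exists>M. \<forall>m\<ge>M. \<forall>n\<ge>M. dist (y m) (y n) < e" by blast
  qed
  then obtain x0 where x0: "y \<longlonglongrightarrow> x0"
    using Cauchy_convergent_iff convergent_def by blast
  have "x0 \<in> W" using closed_sequentially[OF W(2) _ x0] x by (auto simp: y_def)
  moreover have "norm x0 = 1"
    using tendsto_norm[OF x0] x(2) by (simp add: y_def LIMSEQ_const_iff)
  moreover have "B x0 = m *\<^sub>R x0"
  proof -
    have "\<rho> \<longlonglongrightarrow> B x0 - m *\<^sub>R x0" unfolding \<rho>_def[abs_def] by (intro tendsto_intros B.tendsto x0)
    then show ?thesis using \<rho> LIMSEQ_unique by fastforce
  qed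
  ultimately show ?thesis using le_m by blast
qed

text \<open>An orthonormal system of eigenvectors with eigenvalues at least \<open>\<delta>\<close>; it need not be complete.\<close>

definition eigenbasis_above :: "real \<Rightarrow> 'a set \<Rightarrow> bool" where
  "eigenbasis_above \<delta> E \<longleftrightarrow> pairwise (\<lambda>x y. inner x y = 0) E \<and>
     (\<forall>e\<in>E. norm e = 1 \<and> (\<exists>\<mu>\<ge>\<delta>. B e = \<mu> *\<^sub>R e))"

text \<open>At a unit eigenvector with eigenvalue at least \<open>\<delta>\<close>, the functionals of the compactness inequality
  for \<open>\<epsilon> = \<delta>/2\<close> have squares with sum at least \<open>\<delta>/2\<close>, whereas by Bessel's inequality all
  the squares together are bounded.\<close>

lemma eigenbasis_card_bound:
  assumes "\<delta> > 0"
  shows "\<exists>N. \<forall>E. finite E \<longrightarrow> eigenbasis_above \<delta> E \<longrightarrow> card E \<le> N"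
proof -
  obtain L where L: "finite L"
    "\<And>x. inner (B x) x \<le> (\<delta>/2) * (norm x)\<^sup>2 + (\<Sum>l\<in>L. (inner l x)\<^sup>2)"
    using B_compact[of "\<delta>/2"] assms by auto
  define C where "C = (\<Sum>l\<in>L. (norm l)\<^sup>2)"
  have "card E \<le> nat \<lceil>C / (\<delta>/2)\<rceil>" if "finite E" and E: "eigenbasis_above \<delta> E" for E
  proof -
    have "\<delta>/2 \<le> (\<Sum>l\<in>L. (inner l e)\<^sup>2)" if "e \<in> E" for e
    proof -
      obtain \<mu> where "\<mu> \<ge> \<delta>" "B e = \<mu> *\<^sub>R e" "norm e = 1"
        using E \<open>e \<in> E\<close> unfolding eigenbasis_above_def by blast
      moreover have "inner e e = 1" using \<open>norm e = 1\<close> by (simp add: norm_eq_1)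
      ultimately show ?thesis using L(2)[of e] by simp
    qed
    then have "(\<Sum>e\<in>E. \<delta>/2) \<le> (\<Sum>e\<in>E. \<Sum>l\<in>L. (inner l e)\<^sup>2)" by (rule sum_mono)
    also have "\<dots> = (\<Sum>l\<in>L. \<Sum>e\<in>E. (inner l e)\<^sup>2)" by (rule sum.swap)
    also have "\<dots> \<le> C" unfolding C_def
    proof (rule sum_mono)
      fix l
      have "pairwise (\<lambda>x y. inner x y = 0) E" "\<And>e. e \<in> E \<Longrightarrow> norm e = 1"
        using E by (simp_all add: eigenbasis_above_def)
      then show "(\<Sum>e\<in>E. (inner l e)\<^sup>2) \<le> (norm l)\<^sup>2"
        using \<open>finite E\<close> by (intro bessel_inequality)
    qed
    finally have "real (card E) \<le> C / (\<delta>/2)" using assms by (simp add: field_simps)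
    then show ?thesis by linarith
  qed
  then show ?thesis by blast
qed

text \<open>Take a system of maximal cardinality. If the top eigenvalue on its orthogonal complement were at
  least \<open>\<delta>\<close>, the eigenvector would enlarge the system.\<close>

lemma spectral_cut:
  assumes "\<delta> > 0"
  shows "\<exists>E m. finite E \<and> eigenbasis_above \<delta> E \<and> 0 \<le> m \<and> m < \<delta> \<and>
     (\<forall>x. (\<forall>e\<in>E. inner x e = 0) \<longrightarrow> inner (B x) x \<le> m * (norm x)\<^sup>2 \<and> norm (B x) \<le> m * norm x
        \<and> (\<forall>e\<in>E. inner (B x) e = 0))"
proof -
  obtain N where N: "\<And>E. finite E \<Longrightarrow> eigenbasis_above \<delta> E \<Longrightarrow> card E \<le> N"
    using eigenbasis_card_bound[OF assms] by blast
  define P where "P k \<longleftrightarrow> (\<exists>E. finite E \<and> eigenbasis_above \<delta> E \<and> card E = k)" for k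
  have "P 0" by (auto simp: P_def eigenbasis_above_def intro!: exI[of _ "{}"])
  moreover have "\<forall>k. P k \<longrightarrow> k \<le> N" using N by (auto simp: P_def)
  ultimately obtain k where "P k" and kmax: "\<And>j. P j \<Longrightarrow> j \<le> k"
    using GreatestI_nat[of P 0 N] Greatest_le_nat[of P _ N] by blast
  then obtain E where E: "finite E" "eigenbasis_above \<delta> E" "card E = k" by (auto simp: P_def)
  define W where "W = {x. \<forall>e\<in>E. inner x e = 0}"
  have W1: "subspace W" by (auto simp: W_def subspace_def inner_simps)
  have "W = (\<Inter>e\<in>E. {x. inner x e = 0})" by (auto simp: W_def)
  then have W2: "closed W" by (auto intro!: closed_Collect_eq continuous_intros)
  have W3: "B x \<in> W" if "x \<in> W" for x
  proof -
    have "inner (B x) e = 0" if "e \<in> E" for e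
      using E(2) that \<open>x \<in> W\<close> B_sym[of x e] by (auto simp: eigenbasis_above_def W_def)
    then show ?thesis by (simp add: W_def)
  qed
  have "\<exists>m. 0 \<le> m \<and> m < \<delta> \<and> (\<forall>y\<in>W. inner (B y) y \<le> m * (norm y)\<^sup>2)"
  proof (cases "W = {0}")
    case True
    then show ?thesis using assms by (intro exI[of _ 0]) (auto simp: B.zero)
  next
    case False
    then obtain w where "w \<in> W" "w \<noteq> 0" using W1 subspace_0 by blast
    then obtain x m where x: "x \<in> W" "norm x = 1" "B x = m *\<^sub>R x"
      "\<forall>y\<in>W. inner (B y) y \<le> m * (norm y)\<^sup>2"
      using top_eigenvector[OF W1 W2 W3, of w] by blast
    have "m = inner (B x) x" using x by (simp add: norm_eq_1)
    then have "0 \<le> m" using B_nonneg by simp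
    moreover have "m < \<delta>"
    proof (rule ccontr)
      assume "\<not> m < \<delta>"
      have "x \<notin> E" using x(1,2) by (auto simp: W_def norm_eq_1)
      have "eigenbasis_above \<delta> (insert x E)"
        using E(2) x \<open>\<not> m < \<delta>\<close> unfolding eigenbasis_above_def
        by (auto simp: W_def pairwise_insert inner_commute intro!: exI[of _ m])
      then have "P (Suc k)" using E \<open>x \<notin> E\<close> by (auto simp: P_def intro!: exI[of _ "insert x E"])
      then show False using kmax by fastforce
    qed
    ultimately show ?thesis using x by blast
  qed
  then obtain m where m: "0 \<le> m" "m < \<delta>" "\<And>y. y \<in> W \<Longrightarrow> inner (B y) y \<le> m * (norm y)\<^sup>2" by blast
  have "norm (B x) \<le> m * norm x" if "x \<in> W" for x
  proof -
    have "(norm (B x))\<^sup>2 \<le> m * inner (B x) x" using norm_B_le[of W m x] m W3 that by blast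
    also have "\<dots> \<le> m * (m * (norm x)\<^sup>2)" using m that by (intro mult_left_mono) auto
    finally have "(norm (B x))\<^sup>2 \<le> (m * norm x)\<^sup>2" by (simp add: power2_eq_square ac_simps)
    then show ?thesis using m(1) by (rule power2_le_imp_le[OF _ mult_nonneg_nonneg[OF _ norm_ge_zero]])
  qed
  then have "\<forall>x\<in>W. inner (B x) x \<le> m * (norm x)\<^sup>2 \<and> norm (B x) \<le> m * norm x \<and> B x \<in> W"
    using m(3) W3 by blast
  then have "\<forall>x. (\<forall>e\<in>E. inner x e = 0) \<longrightarrow> inner (B x) x \<le> m * (norm x)\<^sup>2 \<and> norm (B x) \<le> m * norm x
        \<and> (\<forall>e\<in>E. inner (B x) e = 0)"
    unfolding W_def by blast
  then show ?thesis using E m(1,2) by blast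
qed

end

section \<open>The resolvent of a compact positive operator on a complex Hilbert space\<close>

text \<open>A complex Hilbert space seen as a real one: \<^const>\<open>inner\<close> is the real part of the Hermitian product,
  and multiplication by \<open>z\<close> scales the norm by \<open>|z|\<close>.\<close>

locale complex_structure =
  fixes cs :: "complex \<Rightarrow> 'a::{real_inner,banach} \<Rightarrow> 'a"
  assumes cs_add_left: "cs (z + w) x = cs z x + cs w x"
    and cs_add_right: "cs z (x + y) = cs z x + cs z y"
    and cs_cs: "cs z (cs w x) = cs (z * w) x"
    and cs_of_real: "cs (complex_of_real r) x = r *\<^sub>R x"
    and norm_cs: "norm (cs z x) = cmod z * norm x"
begin

sublocale cs: bounded_bilinear cs
proof
  show "cs (r *\<^sub>R a) b = r *\<^sub>R cs a b" for r a b
    by (simp add: scaleR_conv_of_real cs_cs[symmetric] cs_of_real)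
  show "cs a (r *\<^sub>R b) = r *\<^sub>R cs a b" for r a b
    by (simp add: cs_of_real[symmetric] cs_cs mult.commute)
  show "\<exists>K. \<forall>a b. norm (cs a b) \<le> norm a * norm b * K"
    by (intro exI[of _ 1]) (simp add: norm_cs)
qed (rule cs_add_left cs_add_right)+

lemma cs_one [simp]: "cs 1 x = x"
  using cs_of_real[of 1 x] by simp

lemma cs_eq_0_iff [simp]: "cs z x = 0 \<longleftrightarrow> z = 0 \<or> x = 0"
  by (metis norm_cs mult_eq_0_iff norm_eq_zero)

lemma cs_eq_Re_Im: "cs z x = Re z *\<^sub>R x + Im z *\<^sub>R cs \<i> x"
proof -
  have "z = of_real (Re z) + of_real (Im z) * \<i>" by (simp add: complex_eq_iff)
  then have "cs z x = cs (of_real (Re z) + of_real (Im z) * \<i>) x" by (rule arg_cong)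
  then show ?thesis by (simp add: cs_add_left cs_of_real cs_cs[symmetric])
qed

text \<open>Multiplication by \<open>\<i>\<close> preserves the norm, hence by polarisation the inner product, and its square is
  \<open>-1\<close>.\<close>

lemma inner_cs_i: "inner (cs \<i> x) y = - inner x (cs \<i> y)"
proof -
  have iso: "inner (cs \<i> x) (cs \<i> y) = inner x y" for x y
    using dot_norm[of "cs \<i> x" "cs \<i> y"] dot_norm[of x y]
    by (simp add: cs.add_right[symmetric] norm_cs)
  have "cs \<i> (cs \<i> y) = - y" using cs_of_real[of "-1" y] by (simp add: cs_cs)
  then show ?thesis using iso[of x "cs \<i> y"] by simp
qed

lemma inner_cs: "inner (cs z x) y = inner x (cs (cnj z) y)"
  using cs_eq_Re_Im[of z x] cs_eq_Re_Im[of "cnj z" y]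
  by (simp add: inner_add_left inner_add_right inner_diff_right inner_cs_i)

text \<open>The Hermitian product, linear in the first argument, recovered from its real part.\<close>

definition cinner :: "'a \<Rightarrow> 'a \<Rightarrow> complex" where
  "cinner x y = Complex (inner x y) (inner x (cs \<i> y))"

lemma cinner_diff_left: "cinner (x - y) v = cinner x v - cinner y v"
  by (simp add: cinner_def inner_diff_left complex_eq_iff)

lemma cinner_cs_left: "cinner (cs z x) y = z * cinner x y"
proof -
  have "cs \<i> (cs \<i> y) = - y" using cs_of_real[of "-1" y] by (simp add: cs_cs)
  then have "inner (cs z x) (cs \<i> y) = Re z * inner x (cs \<i> y) + Im z * inner x y"
    using cs_eq_Re_Im[of z x] inner_cs_i[of x "cs \<i> y"] by (simp add: inner_add_left)
  moreover have "inner (cs z x) y = Re z * inner x y - Im z * inner x (cs \<i> y)"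
    using cs_eq_Re_Im[of z x] inner_cs_i[of x y] by (simp add: inner_add_left)
  ultimately show ?thesis by (simp add: cinner_def complex_eq_iff)
qed

lemma cinner_eq_0_imp: "(\<And>y. cinner x y = 0) \<Longrightarrow> x = 0"
  by (metis cinner_def complex.sel(1) inner_eq_zero_iff zero_complex.sel(1))

text \<open>Complex differentiability: the real derivative is multiplication of a vector by complex numbers.\<close>

definition holo_at :: "(complex \<Rightarrow> 'a) \<Rightarrow> complex \<Rightarrow> bool" where
  "holo_at f z \<longleftrightarrow> (\<exists>d. (f has_derivative (\<lambda>k. cs k d)) (at z))"

lemma holo_at_difference_quotient:
  assumes "(f has_derivative (\<lambda>k. cs k d)) (at z)"
  shows "((\<lambda>w. norm (cs (1 / (w - z)) (f w - f z) - d)) \<longlongrightarrow> 0) (at z)"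
proof -
  have "((\<lambda>w. norm ((f w - f z) - cs (w - z) d) / norm (w - z)) \<longlongrightarrow> 0) (at z)"
    using assms by (simp add: has_derivative_iff_norm)
  moreover have "\<forall>\<^sub>F w in at z. norm ((f w - f z) - cs (w - z) d) / norm (w - z)
      = norm (cs (1 / (w - z)) (f w - f z) - d)"
    unfolding eventually_at_filter
  proof (intro always_eventually allI impI)
    fix w assume that: "w \<noteq> z"
    have "cs (1 / (w - z)) ((f w - f z) - cs (w - z) d) = cs (1 / (w - z)) (f w - f z) - d"
      using that by (simp add: cs.diff_right[of _ "f w - f z"] cs_cs)
    then show "norm ((f w - f z) - cs (w - z) d) / norm (w - z)
        = norm (cs (1 / (w - z)) (f w - f z) - d)"
      by (metis norm_cs norm_divide norm_one divide_inverse mult.commute mult_1)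
  qed
  ultimately show ?thesis by (rule Lim_transform_eventually)
qed

lemma holo_at_add: "holo_at f z \<Longrightarrow> holo_at g z \<Longrightarrow> holo_at (\<lambda>w. f w + g w) z"
proof -
  assume "holo_at f z" "holo_at g z"
  then obtain d d' where "(f has_derivative (\<lambda>k. cs k d)) (at z)" "(g has_derivative (\<lambda>k. cs k d')) (at z)"
    by (auto simp: holo_at_def)
  from has_derivative_add[OF this] show ?thesis
    unfolding holo_at_def cs.add_right[symmetric] by blast
qed

lemma holo_at_const: "holo_at (\<lambda>_. c) z"
  unfolding holo_at_def by (rule exI[of _ 0]) (simp add: cs.zero_right)

lemma holo_at_sum: "(\<And>i. i \<in> I \<Longrightarrow> holo_at (f i) z) \<Longrightarrow> holo_at (\<lambda>w. \<Sum>i\<in>I. f i w) z"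
  by (induction I rule: infinite_finite_induct) (auto intro: holo_at_add holo_at_const)

lemma holo_at_cs:
  assumes "(f has_field_derivative f') (at z)" "holo_at g z"
  shows "holo_at (\<lambda>w. cs (f w) (g w)) z"
proof -
  obtain d where "(g has_derivative (\<lambda>k. cs k d)) (at z)" using assms by (auto simp: holo_at_def)
  from cs.FDERIV[OF assms(1)[unfolded has_field_derivative_def] this]
  have "((\<lambda>w. cs (f w) (g w)) has_derivative (\<lambda>h. cs (f z) (cs h d) + cs (f' * h) (g z))) (at z)" .
  moreover have "(\<lambda>h. cs (f z) (cs h d) + cs (f' * h) (g z))
      = (\<lambda>h. cs h (cs (f z) d + cs f' (g z)))"
    by (simp add: fun_eq_iff cs_cs cs_add_right mult.commute)
  ultimately show ?thesis by (auto simp: holo_at_def)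
qed

lemma holo_at_transform_open:
  assumes "holo_at f z" "open S" "z \<in> S" "\<And>w. w \<in> S \<Longrightarrow> f w = g w"
  shows "holo_at g z"
  using assms has_derivative_transform_within_open[of f _ z UNIV S g]
  unfolding holo_at_def by blast

text \<open>The termwise derivatives are dominated by \<open>(n+1) (m R)\<^sup>n\<close> on the disc, so that they converge
  uniformly and the series may be differentiated term by term.\<close>

lemma holo_at_power_series:
  assumes v: "\<And>n. norm (v n) \<le> C * m ^ n" and m: "0 \<le> m" "m * R < 1" and z: "norm z < R"
  shows "holo_at (\<lambda>z. \<Sum>n. cs (z ^ Suc n) (v n)) z"
    and "summable (\<lambda>n. cs (z ^ Suc n) (v n))"
proof -
  have R: "R > 0" using z by (meson norm_ge_zero order_le_less_trans)
  have C: "0 \<le> C" using v[of 0] by (metis mult_1_right norm_ge_zero order_trans power_0)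
  define q where "q = m * R"
  have q: "0 \<le> q" "norm q < 1" using m R by (auto simp: q_def)
  define S where "S = ball (0::complex) R"
  have S: "convex S" "open S" "z \<in> S" using z by (auto simp: S_def)
  define T where "T n w = cs (of_nat (Suc n) * w ^ n) (v n)" for n w
  have T_le: "norm (T n w) \<le> C * (of_nat (Suc n) * q ^ n)" if "w \<in> S" for n w
  proof -
    have "norm (T n w) = of_nat (Suc n) * (cmod w ^ n * norm (v n))"
      by (simp add: T_def norm_cs norm_mult norm_power del: of_nat_Suc)
    also have "\<dots> \<le> of_nat (Suc n) * (R ^ n * (C * m ^ n))"
      using that v R by (intro mult_left_mono mult_mono power_mono) (auto simp: S_def)
    finally show ?thesis by (simp add: q_def power_mult_distrib ac_simps)
  qed
  have dsum: "summable (\<lambda>n. C * (of_nat (Suc n) * q ^ n))"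
    using geometric_deriv_sums[OF q(2)] by (intro summable_mult) (rule sums_summable)
  have unif: "uniform_limit S (\<lambda>n w. \<Sum>i<n. T i w) (\<lambda>w. \<Sum>i. T i w) sequentially"
    by (rule Weierstrass_m_test[OF T_le dsum])
  have sm: "summable (\<lambda>n. cs (w ^ Suc n) (v n))" if "w \<in> S" for w
  proof (rule summable_comparison_test')
    show "summable (\<lambda>n. R * (C * q ^ n))"
      using q by (intro summable_mult summable_geometric) simp
    fix n :: nat assume "n \<ge> 0"
    have "norm (cs (w ^ Suc n) (v n)) = cmod w * (cmod w ^ n * norm (v n))"
      by (simp add: norm_cs norm_mult norm_power)
    also have "\<dots> \<le> R * (R ^ n * (C * m ^ n))"
      using that v R m C by (intro mult_mono power_mono) (auto simp: S_def)
    finally show "norm (cs (w ^ Suc n) (v n)) \<le> R * (C * q ^ n)"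
      by (simp add: q_def power_mult_distrib ac_simps)
  qed
  then show "summable (\<lambda>n. cs (z ^ Suc n) (v n))" using S by blast
  have "\<exists>g. \<forall>w\<in>S. (\<lambda>n. cs (w ^ Suc n) (v n)) sums g w
      \<and> (g has_derivative (\<lambda>k. cs k (\<Sum>i. T i w))) (at w within S)"
  proof (rule has_derivative_series[where f' = "\<lambda>n w k. cs k (T n w)", OF S(1) _ _ S(3)])
    show "((\<lambda>w. cs (w ^ Suc n) (v n)) has_derivative (\<lambda>k. cs k (T n w))) (at w within S)" for n w
    proof -
      have "((\<lambda>w. w ^ Suc n) has_field_derivative of_nat (Suc n) * w ^ n) (at w within S)"
        using DERIV_power_Suc[OF DERIV_ident, of n w S] by simp
      then have "((\<lambda>w. w ^ Suc n) has_derivative (\<lambda>k. of_nat (Suc n) * w ^ n * k)) (at w within S)"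
        by (simp only: has_field_derivative_def)
      from bounded_linear.has_derivative[OF cs.bounded_linear_left this]
      show ?thesis by (simp add: T_def cs_cs mult.commute del: of_nat_Suc power_Suc)
    qed
    show "\<forall>\<^sub>F n in sequentially. \<forall>w\<in>S. \<forall>h.
        norm ((\<Sum>i<n. cs h (T i w)) - cs h (\<Sum>i. T i w)) \<le> e * norm h" if "e > 0" for e
    proof -
      have "\<forall>\<^sub>F n in sequentially. \<forall>w\<in>S. dist (\<Sum>i<n. T i w) (\<Sum>i. T i w) < e"
        using unif that by (auto simp: uniform_limit_iff)
      then show ?thesis
      proof (rule eventually_mono, intro ballI allI)
        fix n w h assume "\<forall>w\<in>S. dist (\<Sum>i<n. T i w) (\<Sum>i. T i w) < e" and "w \<in> S"
        then have "norm ((\<Sum>i<n. T i w) - (\<Sum>i. T i w)) \<le> e" by (simp add: dist_norm less_imp_le)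
        then show "norm ((\<Sum>i<n. cs h (T i w)) - cs h (\<Sum>i. T i w)) \<le> e * norm h"
          using mult_left_mono[of _ e "norm h"]
          by (simp add: cs.sum_right[symmetric] cs.diff_right[symmetric] norm_cs mult.commute[of e])
      qed
    qed
    show "(\<lambda>n. cs (z ^ Suc n) (v n)) sums (\<Sum>n. cs (z ^ Suc n) (v n))"
      using sm S by blast
  qed
  then obtain g where g: "\<And>w. w \<in> S \<Longrightarrow> (\<lambda>n. cs (w ^ Suc n) (v n)) sums g w"
    "\<And>w. w \<in> S \<Longrightarrow> (g has_derivative (\<lambda>k. cs k (\<Sum>i. T i w))) (at w within S)" by blast
  have "holo_at g z" using g(2)[OF S(3)] unfolding holo_at_def at_within_open[OF S(3,2)] by blast
  then show "holo_at (\<lambda>z. \<Sum>n. cs (z ^ Suc n) (v n)) z"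
    by (rule holo_at_transform_open[OF _ S(2,3)]) (simp add: sums_unique[OF g(1)] del: power_Suc)
qed

end

locale complex_compact_positive_operator =
  complex_structure cs + compact_positive_operator B
  for cs :: "complex \<Rightarrow> 'a::{real_inner,banach} \<Rightarrow> 'a" and B :: "'a \<Rightarrow> 'a" +
  assumes B_cs: "B (cs z x) = cs z (B x)"
begin

text \<open>Reciprocals of the eigenvalues of \<open>B\<close>: with \<open>B\<close> as the inverse of a Laplacian, these are the
  eigenvalues of the Laplacian.\<close>

definition eigs :: "complex set" where
  "eigs = {z. \<exists>x. x \<noteq> 0 \<and> x = cs z (B x)}"

text \<open>The form \<open>\<langle>B x, \<i> x\<rangle>\<close> is antisymmetric and hence zero, so that pairing \<open>x = z B x\<close> with \<open>\<i> x\<close>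
  leaves \<open>Im z \<langle>B x, x\<rangle> = 0\<close>.\<close>

lemma eigs_real:
  assumes "x \<noteq> 0" "x = cs z (B x)"
  shows "z = of_real (Re z)" and "Re z > 0" and "x = Re z *\<^sub>R B x"
proof -
  have eq: "x = Re z *\<^sub>R B x + Im z *\<^sub>R cs \<i> (B x)"
    using assms(2) by (subst (asm) cs_eq_Re_Im)
  have orth: "inner (B x) (cs \<i> x) = 0"
  proof -
    have "inner (B x) (cs \<i> x) = - inner (cs \<i> (B x)) x" by (simp add: inner_cs_i)
    also have "\<dots> = - inner (B (cs \<i> x)) x" by (simp add: B_cs)
    also have "\<dots> = - inner (B x) (cs \<i> x)" by (simp add: B_sym inner_commute)
    finally show ?thesis by simp
  qed
  have pos: "inner (B x) x > 0" by (rule B_pos) fact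
  have "inner x (cs \<i> x) = 0" using inner_cs_i[of x x] by (simp add: inner_commute)
  moreover have "inner x (cs \<i> x) = Im z * inner (cs \<i> (B x)) (cs \<i> x)"
    by (subst eq) (simp add: inner_add_left orth)
  moreover have "inner (cs \<i> (B x)) (cs \<i> x) = inner (B x) x"
    using cs_of_real[of "-1" "x"] by (simp add: inner_cs_i cs_cs)
  ultimately have "Im z = 0" using pos by simp
  then show "z = of_real (Re z)" by (simp add: complex_eq_iff)
  show x: "x = Re z *\<^sub>R B x" using eq \<open>Im z = 0\<close> by simp
  have "inner x x = Re z * inner (B x) x" by (subst (1) x) simp
  moreover have "inner x x > 0" using assms(1) by simp
  ultimately show "Re z > 0" using pos by (simp add: zero_less_mult_iff)
qed

definition solves :: "'a \<Rightarrow> complex \<Rightarrow> 'a \<Rightarrow> bool" where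
  "solves g z x \<longleftrightarrow> x = cs z (B x) + cs z g"

lemma solves_unique:
  assumes "z \<notin> eigs" "solves g z x" "solves g z y"
  shows "x = y"
proof -
  have "x - y = (cs z (B x) + cs z g) - (cs z (B y) + cs z g)"
    using assms(2,3) unfolding solves_def by (rule arg_cong2)
  also have "\<dots> = cs z (B (x - y))" by (simp add: B.diff cs.diff_right)
  finally have "x - y = cs z (B (x - y))" .
  then have "\<not> x - y \<noteq> 0" using assms(1) unfolding eigs_def by blast
  then show ?thesis by simp
qed

definition eigval :: "'a \<Rightarrow> real" where "eigval e = inner (B e) e"

lemma eigenbasis_aboveD:
  assumes "eigenbasis_above \<delta> E" "e \<in> E"
  shows "norm e = 1" "B e = eigval e *\<^sub>R e" "eigval e \<ge> \<delta>"
proof -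
  obtain \<mu> where \<mu>: "\<mu> \<ge> \<delta>" "B e = \<mu> *\<^sub>R e" and 1: "norm e = 1"
    using assms unfolding eigenbasis_above_def by blast
  moreover have "inner e e = 1" using 1 by (simp add: norm_eq_1)
  ultimately show "norm e = 1" "B e = eigval e *\<^sub>R e" "eigval e \<ge> \<delta>" by (simp_all add: eigval_def)
qed

text \<open>The component of \<open>g\<close> orthogonal to the eigenvectors with eigenvalue at least \<open>1/R\<close> stays orthogonal
  to them under \<open>B\<close>, and there \<open>B\<close> contracts by some \<open>m < 1/R\<close>. The Neumann series thus converges for
  \<open>|z| < R\<close>; it sums to \<open>h z\<close>. If \<open>z\<close> in the disc is none of the \<open>1/\<mu>\<^sub>e\<close>, then any \<open>x\<close> with
  \<open>x = z B x\<close> is orthogonal to the system, and the contraction forces \<open>x = 0\<close>.\<close>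

lemma regular_part:
  assumes "R > 0"
  shows "\<exists>E h. finite E \<and> eigenbasis_above (1/R) E \<and>
     (\<forall>z\<in>ball 0 R. holo_at h z \<and>
        h z = cs z (B (h z)) + cs z (g - (\<Sum>e\<in>E. inner g e *\<^sub>R e))) \<and>
     (\<forall>z\<in>ball 0 R \<inter> eigs. \<exists>e\<in>E. z * of_real (eigval e) = 1)"
proof -
  obtain E m where E: "finite E" "eigenbasis_above (1/R) E" and m: "0 \<le> m" "m < 1/R"
    and form_le: "\<And>x. (\<And>e. e \<in> E \<Longrightarrow> inner x e = 0) \<Longrightarrow> inner (B x) x \<le> m * (norm x)\<^sup>2"
    and norm_le: "\<And>x. (\<And>e. e \<in> E \<Longrightarrow> inner x e = 0) \<Longrightarrow> norm (B x) \<le> m * norm x"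
    and invariant: "\<And>x e. (\<And>e. e \<in> E \<Longrightarrow> inner x e = 0) \<Longrightarrow> e \<in> E \<Longrightarrow> inner (B x) e = 0"
    using spectral_cut[of "1/R"] assms by (smt (verit) divide_pos_pos)
  define g' where "g' = g - (\<Sum>e\<in>E. inner g e *\<^sub>R e)"
  have g': "inner g' e = 0" if "e \<in> E" for e
  proof -
    have "(\<Sum>d\<in>E. inner g d * inner d e) = (\<Sum>d\<in>E. if d = e then inner g e else 0)"
      using E that by (intro sum.cong) (auto simp: eigenbasis_above_def pairwise_def norm_eq_1)
    then show ?thesis using that E(1) by (simp add: g'_def inner_diff_left inner_sum_left)
  qed
  define v where "v n = (B ^^ n) g'" for n
  have v_orth: "inner (v n) e = 0" if "e \<in> E" for n e
    using that by (induction n arbitrary: e) (auto simp: v_def g' invariant)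
  have v_le: "norm (v n) \<le> norm g' * m ^ n" for n
  proof (induction n)
    case (Suc n)
    have "norm (v (Suc n)) \<le> m * norm (v n)"
      using norm_le[of "v n"] v_orth by (simp add: v_def)
    also have "\<dots> \<le> m * (norm g' * m ^ n)" using Suc m by (intro mult_left_mono)
    finally show ?case by (simp add: ac_simps)
  qed (simp add: v_def)
  have mR: "m * R < 1" using m assms by (simp add: field_simps)
  define h where "h z = (\<Sum>n. cs (z ^ Suc n) (v n))" for z
  have "holo_at h z \<and> h z = cs z (B (h z)) + cs z g'" if z: "z \<in> ball 0 R" for z
  proof
    have z: "norm z < R" using z by simp
    note ps = holo_at_power_series[OF v_le m(1) mR z]
    show "holo_at h z" using ps(1) by (simp add: h_def[abs_def])
    have "B (h z) = (\<Sum>n. B (cs (z ^ Suc n) (v n)))"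
      unfolding h_def by (rule B.suminf[OF ps(2)])
    also have "\<dots> = (\<Sum>n. cs (z ^ Suc n) (v (Suc n)))"
      by (simp add: B_cs v_def del: power_Suc)
    finally have "cs z (B (h z)) = cs z (\<Sum>n. cs (z ^ Suc n) (v (Suc n)))" by simp
    also have "\<dots> = (\<Sum>n. cs z (cs (z ^ Suc n) (v (Suc n))))"
    proof (rule bounded_linear.suminf[OF cs.bounded_linear_right])
      have "summable (\<lambda>n. B (cs (z ^ Suc n) (v n)))" by (rule B.summable[OF ps(2)])
      then show "summable (\<lambda>n. cs (z ^ Suc n) (v (Suc n)))"
        by (simp add: B_cs v_def del: power_Suc)
    qed
    also have "\<dots> = (\<Sum>n. cs (z ^ Suc (Suc n)) (v (Suc n)))" by (simp add: cs_cs)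
    also have "\<dots> = h z - cs z g'"
      unfolding h_def using suminf_split_head[OF ps(2)] by (simp add: v_def)
    finally show "h z = cs z (B (h z)) + cs z g'" by simp
  qed
  moreover have "\<exists>e\<in>E. z * of_real (eigval e) = 1" if z: "z \<in> ball 0 R" "z \<in> eigs" for z
  proof (rule ccontr)
    assume none: "\<not> ?thesis"
    obtain x where x: "x \<noteq> 0" "x = cs z (B x)" using z(2) by (auto simp: eigs_def)
    note r = eigs_real[OF x]
    define r where "r = Re z"
    have r': "r > 0" "x = r *\<^sub>R B x" "z = of_real r" "r < R"
      using r z(1) unfolding r_def by (auto, metis abs_Re_le_cmod abs_of_pos order_le_less_trans)
    have "inner x e = 0" if e: "e \<in> E" for e
    proof -
      have "inner x e = r * inner (B x) e" by (subst r'(2)) simp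
      also have "inner (B x) e = eigval e * inner x e"
        using eigenbasis_aboveD(2)[OF E(2) e] by (metis B_sym inner_scaleR_right)
      finally have "inner x e * (1 - r * eigval e) = 0" by (simp add: algebra_simps)
      moreover have "r * eigval e \<noteq> 1" using none e r'(3)
        by (metis of_real_1 of_real_mult)
      ultimately show ?thesis by simp
    qed
    then have "inner (B x) x \<le> m * (norm x)\<^sup>2" by (rule form_le)
    moreover have "inner x x = r * inner (B x) x" by (subst (1) r'(2)) simp
    ultimately have "inner x x \<le> r * (m * inner x x)"
      using r'(1) by (simp add: power2_norm_eq_inner)
    then have "1 \<le> r * m" using x(1) by (simp add: mult.assoc[symmetric])
    moreover have "r * m < 1" using m r' assms
      by (metis mR less_eq_real_def mult.commute mult_left_mono order_le_less_trans)
    ultimately show False by simp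
  qed
  ultimately show ?thesis using E unfolding g'_def by blast
qed

lemma eigenbasis_eigs:
  assumes "eigenbasis_above \<delta> E" "e \<in> E" "z * of_real (eigval e) = 1"
  shows "e = cs z (B e)" "z \<in> eigs"
proof -
  have "cs z (B e) = cs z (cs (of_real (eigval e)) e)"
    using eigenbasis_aboveD(2)[OF assms(1,2)] by (simp add: cs_of_real)
  also have "\<dots> = e" using assms(3) by (simp add: cs_cs)
  finally show "e = cs z (B e)" by simp
  moreover have "e \<noteq> 0" using eigenbasis_aboveD(1)[OF assms(1,2)] by auto
  ultimately show "z \<in> eigs" by (auto simp: eigs_def)
qed

lemma eigs_no_limpt: "\<not> z islimpt eigs"
proof
  assume "z islimpt eigs"
  define R where "R = norm z + 1"
  have "R > 0" unfolding R_def using norm_ge_zero[of z] by linarith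
  obtain E h where "finite E"
    and eig: "\<forall>w\<in>ball 0 R \<inter> eigs. \<exists>e\<in>E. w * of_real (eigval e) = 1"
    using regular_part[OF \<open>R > 0\<close>, of 0] by blast
  have "ball z 1 \<subseteq> ball 0 R"
  proof
    fix w assume "w \<in> ball z 1"
    then show "w \<in> ball 0 R" using norm_triangle_sub[of w z]
      by (simp add: R_def dist_norm norm_minus_commute)
  qed
  then have "eigs \<inter> ball z 1 \<subseteq> (\<lambda>e. 1 / of_real (eigval e)) ` E"
  proof (intro subsetI)
    fix w assume sub: "ball z 1 \<subseteq> ball 0 R" and "w \<in> eigs \<inter> ball z 1"
    then obtain e where "e \<in> E" "w * of_real (eigval e) = 1" using eig by blast
    then show "w \<in> (\<lambda>e. 1 / of_real (eigval e)) ` E"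
      by (intro image_eqI[of _ _ e]) (auto simp: eq_divide_eq)
  qed
  then have "finite (eigs \<inter> ball z 1)" using \<open>finite E\<close> by (meson finite_imageI finite_subset)
  then show False using \<open>z islimpt eigs\<close> by (auto simp: islimpt_eq_infinite_ball)
qed

text \<open>On the line of an eigenvector \<open>e\<close> the equation is scalar, \<open>c = z \<mu>\<^sub>e c + z \<langle>g, e\<rangle>\<close>.\<close>

lemma solution_formula:
  assumes E: "finite E" "eigenbasis_above \<delta> E"
    and y: "y = cs z (B y) + cs z (g - (\<Sum>e\<in>E. inner g e *\<^sub>R e))"
    and z: "\<And>e. e \<in> E \<Longrightarrow> z * of_real (eigval e) \<noteq> 1"
  shows "solves g z ((\<Sum>e\<in>E. cs (z / (1 - z * of_real (eigval e))) (inner g e *\<^sub>R e)) + y)"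
proof -
  define S where "S = (\<Sum>e\<in>E. cs (z / (1 - z * of_real (eigval e))) (inner g e *\<^sub>R e))"
  have summand: "cs (z / (1 - z * of_real (eigval e))) (inner g e *\<^sub>R e)
      = cs z (B (cs (z / (1 - z * of_real (eigval e))) (inner g e *\<^sub>R e))) + cs z (inner g e *\<^sub>R e)"
    if "e \<in> E" for e
  proof -
    let ?x = "inner g e *\<^sub>R e" and ?w = "z / (1 - z * of_real (eigval e))"
    have "B ?x = cs (of_real (eigval e)) ?x"
      by (simp add: B.scaleR cs_of_real) (subst eigenbasis_aboveD(2)[OF E(2) that], simp)
    then have "cs z (B (cs ?w ?x)) + cs z ?x = cs (z * ?w * of_real (eigval e) + z) ?x"
      by (simp add: B_cs cs_cs cs_add_left mult.assoc)
    also have "z * ?w * of_real (eigval e) + z = ?w" using z[OF that] by (simp add: field_simps)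
    finally show ?thesis by simp
  qed
  have "S = cs z (B S) + cs z (\<Sum>e\<in>E. inner g e *\<^sub>R e)"
    unfolding S_def B.sum cs.sum_right sum.distrib[symmetric]
    by (intro sum.cong refl summand)
  then have "S + y = (cs z (B S) + cs z (\<Sum>e\<in>E. inner g e *\<^sub>R e))
      + (cs z (B y) + cs z (g - (\<Sum>e\<in>E. inner g e *\<^sub>R e)))"
    using y by (rule arg_cong2)
  also have "\<dots> = cs z (B (S + y)) + cs z g"
    by (simp add: B.add cs.add_right cs.diff_right)
  finally have "S + y = cs z (B (S + y)) + cs z g" .
  then show ?thesis by (simp add: solves_def S_def)
qed

definition sol :: "'a \<Rightarrow> complex \<Rightarrow> 'a" where
  "sol g z = (THE x. solves g z x)"

lemma sol_eqI: "z \<notin> eigs \<Longrightarrow> solves g z x \<Longrightarrow> sol g z = x"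
  unfolding sol_def using solves_unique by blast

lemma eigval_factor_derivative:
  assumes "z * of_real \<mu> \<noteq> 1"
  shows "\<exists>d. ((\<lambda>z. z / (1 - z * complex_of_real \<mu>)) has_field_derivative d) (at z)"
  using assms by (intro exI) (auto intro!: derivative_eq_intros)

lemma sol_off_eigs:
  assumes "z \<notin> eigs"
  shows "solves g z (sol g z)" "holo_at (sol g) z"
proof -
  define R where "R = norm z + 1"
  have R: "R > 0" "z \<in> ball 0 R" by (simp_all add: R_def add_nonneg_pos)
  obtain E h where E: "finite E" "eigenbasis_above (1/R) E"
    and h: "\<And>z. z \<in> ball 0 R \<Longrightarrow> holo_at h z"
      "\<And>z. z \<in> ball 0 R \<Longrightarrow> h z = cs z (B (h z)) + cs z (g - (\<Sum>e\<in>E. inner g e *\<^sub>R e))"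
    and eig: "\<And>z. z \<in> ball 0 R \<Longrightarrow> z \<in> eigs \<Longrightarrow> \<exists>e\<in>E. z * of_real (eigval e) = 1"
    using regular_part[OF R(1), of g] by blast
  define F where "F z = (\<Sum>e\<in>E. cs (z / (1 - z * of_real (eigval e))) (inner g e *\<^sub>R e)) + h z" for z
  have sF: "sol g w = F w \<and> solves g w (F w)" if "w \<in> ball 0 R" "w \<notin> eigs" for w
    using solution_formula[OF E h(2)[OF that(1)]] eigenbasis_eigs(2)[OF E(2)] that(2) sol_eqI[OF that(2)]
    unfolding F_def by blast
  show "solves g z (sol g z)" using sF[OF R(2) assms] by simp
  have "closed eigs" using eigs_no_limpt by (auto simp: closed_limpt)
  then have op: "open (ball 0 R - eigs)" by auto
  have "holo_at F z"
    unfolding F_def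
  proof (intro holo_at_add holo_at_sum h(1) R(2))
    fix e assume "e \<in> E"
    then have "z * of_real (eigval e) \<noteq> 1" using assms eigenbasis_eigs(2)[OF E(2)] by blast
    then obtain d where "((\<lambda>z. z / (1 - z * of_real (eigval e))) has_field_derivative d) (at z)"
      using eigval_factor_derivative by blast
    then show "holo_at (\<lambda>z. cs (z / (1 - z * of_real (eigval e))) (inner g e *\<^sub>R e)) z"
      by (rule holo_at_cs[OF _ holo_at_const])
  qed
  then show "holo_at (sol g) z"
    by (rule holo_at_transform_open[OF _ op]) (use sF R assms in auto)
qed

text \<open>The summands with \<open>\<mu>\<^sub>e = 1/\<lambda>\<close> become \<open>-\<lambda> z \<langle>g, e\<rangle> e\<close> after multiplication by \<open>z - \<lambda>\<close>,
  everything else is holomorphic near \<open>\<lambda>\<close> and gets a factor that vanishes there. So \<open>G \<lambda>\<close> is \<open>-\<lambda>\<^sup>2 p\<close>,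
  where \<open>p\<close> is the projection of \<open>g\<close> to the span of these \<open>e\<close>. If \<open>p \<noteq> 0\<close>, then \<open>p\<close> is an eigenvector
  with \<open>\<langle>g, p\<rangle> = |p|\<^sup>2\<close>. Conversely, let \<open>x\<close> be an eigenvector with \<open>\<langle>g, x\<rangle> \<noteq> 0\<close>. The equation for
  the regular part at \<open>\<lambda>\<close> itself shows that \<open>g'\<close> is orthogonal to \<open>x\<close>, and the eigenvectors of the
  other eigenvalues are so too; hence some \<open>\<langle>g, e\<rangle>\<close> with \<open>\<mu>\<^sub>e = 1/\<lambda>\<close> is nonzero.\<close>

lemma sol_pole:
  assumes "lam \<in> eigs"
  shows "\<exists>r>0. \<exists>G. (\<forall>z\<in>ball lam r. holo_at G z) \<and> ball lam r \<inter> eigs = {lam} \<and>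
     (\<forall>z\<in>ball lam r - {lam}. sol g z = cs (1 / (z - lam)) (G z)) \<and>
     (G lam \<noteq> 0 \<longleftrightarrow> (\<exists>x. x = cs lam (B x) \<and> inner g x \<noteq> 0))"
proof -
  define R where "R = norm lam + 1"
  have R: "R > 0" "lam \<in> ball 0 R" by (simp_all add: R_def add_nonneg_pos)
  obtain E h where E: "finite E" "eigenbasis_above (1/R) E"
    and h: "\<And>z. z \<in> ball 0 R \<Longrightarrow> holo_at h z"
      "\<And>z. z \<in> ball 0 R \<Longrightarrow> h z = cs z (B (h z)) + cs z (g - (\<Sum>e\<in>E. inner g e *\<^sub>R e))"
    using regular_part[OF R(1), of g] by blast
  obtain x1 where "x1 \<noteq> 0" "x1 = cs lam (B x1)" using assms by (auto simp: eigs_def)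
  note lam_real = eigs_real[OF this]
  have "lam \<noteq> 0" using lam_real(2) by auto
  define E0 where "E0 = {e\<in>E. lam * of_real (eigval e) = 1}"
  define E1 where "E1 = E - E0"
  have fin: "finite E0" "finite E1" using E(1) by (auto simp: E0_def E1_def)
  obtain r0 where r0: "r0 > 0" "\<And>z. z \<in> ball lam r0 \<Longrightarrow> z \<noteq> lam \<Longrightarrow> z \<notin> eigs"
    using eigs_no_limpt[of lam] by (auto simp: islimpt_approachable dist_commute)
  \<comment> \<open>A radius of at most \<open>1\<close> keeps the disc inside the disc of radius \<open>R\<close> around \<open>0\<close>.\<close>
  define r where "r = min r0 1"
  have r: "r > 0" "\<And>z. z \<in> ball lam r \<Longrightarrow> z \<in> ball 0 R"
      "\<And>z. z \<in> ball lam r \<Longrightarrow> z \<noteq> lam \<Longrightarrow> z \<notin> eigs"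
  proof -
    show "z \<in> ball 0 R" if "z \<in> ball lam r" for z
      using that norm_triangle_sub[of z lam] by (simp add: r_def R_def dist_norm norm_minus_commute)
  qed (use r0 in \<open>auto simp: r_def\<close>)
  have int: "ball lam r \<inter> eigs = {lam}" 
  proof (intro set_eqI iffI)
    fix z assume "z \<in> ball lam r \<inter> eigs" then show "z \<in> {lam}" using r(3) by blast
  qed (use r(1) assms in auto)
  define G where "G z = (\<Sum>e\<in>E0. cs (- lam * z) (inner g e *\<^sub>R e))
     + (\<Sum>e\<in>E1. cs ((z - lam) * (z / (1 - z * of_real (eigval e)))) (inner g e *\<^sub>R e))
     + cs (z - lam) (h z)" for z
  have "holo_at G z" if z: "z \<in> ball lam r" for z
    unfolding G_def
  proof (intro holo_at_add holo_at_sum)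
    show "holo_at (\<lambda>w. cs (w - lam) (h w)) z"
      by (rule holo_at_cs[of _ 1]) (auto intro!: derivative_eq_intros h(1) r(2) z)
  next
    fix e assume "e \<in> E0"
    show "holo_at (\<lambda>w. cs (- lam * w) (inner g e *\<^sub>R e)) z"
      by (rule holo_at_cs[of _ "- lam"]) (auto intro!: derivative_eq_intros holo_at_const)
  next
    fix e assume e: "e \<in> E1"
    have "z * of_real (eigval e) \<noteq> 1"
    proof (cases "z = lam")
      case True then show ?thesis using e by (auto simp: E1_def E0_def)
    next
      case False
      then show ?thesis using eigenbasis_eigs(2)[OF E(2)] e r(3)[OF z] by (auto simp: E1_def)
    qed
    then obtain d where "((\<lambda>z. z / (1 - z * of_real (eigval e))) has_field_derivative d) (at z)"
      using eigval_factor_derivative by blast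
    then have "\<exists>d. ((\<lambda>z. (z - lam) * (z / (1 - z * of_real (eigval e)))) has_field_derivative d) (at z)"
      by (intro exI) (rule DERIV_mult, auto intro!: derivative_eq_intros)
    then show "holo_at (\<lambda>z. cs ((z - lam) * (z / (1 - z * of_real (eigval e)))) (inner g e *\<^sub>R e)) z"
      using holo_at_cs[OF _ holo_at_const] by blast
  qed
  moreover have "sol g z = cs (1 / (z - lam)) (G z)" if z: "z \<in> ball lam r - {lam}" for z
  proof -
    have zl: "z \<noteq> lam" "z \<notin> eigs" using z r(3) by auto
    have "sol g z = (\<Sum>e\<in>E. cs (z / (1 - z * of_real (eigval e))) (inner g e *\<^sub>R e)) + h z"
      using z zl r(2) eigenbasis_eigs(2)[OF E(2)]
      by (intro sol_eqI solution_formula[OF E h(2)]) auto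
    also have "E = E0 \<union> E1" by (auto simp: E0_def E1_def)
    also have "(\<Sum>e\<in>E0 \<union> E1. cs (z / (1 - z * of_real (eigval e))) (inner g e *\<^sub>R e))
        = (\<Sum>e\<in>E0. cs (z / (1 - z * of_real (eigval e))) (inner g e *\<^sub>R e))
        + (\<Sum>e\<in>E1. cs (z / (1 - z * of_real (eigval e))) (inner g e *\<^sub>R e))"
      using fin by (intro sum.union_disjoint) (auto simp: E1_def)
    also have "(\<Sum>e\<in>E0. cs (z / (1 - z * of_real (eigval e))) (inner g e *\<^sub>R e))
        = (\<Sum>e\<in>E0. cs (1 / (z - lam)) (cs (- lam * z) (inner g e *\<^sub>R e)))"
    proof (intro sum.cong refl)
      fix e assume "e \<in> E0"
      then have ev: "complex_of_real (eigval e) = 1 / lam"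
        using \<open>lam \<noteq> 0\<close> by (simp add: E0_def eq_divide_eq mult.commute)
      have "z / (1 - z * of_real (eigval e)) = 1 / (z - lam) * (- lam * z)"
        unfolding ev using \<open>lam \<noteq> 0\<close> zl(1) by (simp add: divide_simps) (simp add: algebra_simps)
      then show "cs (z / (1 - z * of_real (eigval e))) (inner g e *\<^sub>R e)
          = cs (1 / (z - lam)) (cs (- lam * z) (inner g e *\<^sub>R e))" by (simp only: cs_cs)
    qed
    also have "\<dots> + (\<Sum>e\<in>E1. cs (z / (1 - z * of_real (eigval e))) (inner g e *\<^sub>R e)) + h z
        = cs (1 / (z - lam)) (G z)"
      unfolding G_def using zl(1) by (simp add: cs.add_right cs.sum_right cs_cs)
    finally show ?thesis .
  qed
  moreover have "G lam \<noteq> 0 \<longleftrightarrow> (\<exists>x. x = cs lam (B x) \<and> inner g x \<noteq> 0)"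
  proof -
    define p where "p = (\<Sum>e\<in>E0. inner g e *\<^sub>R e)"
    have G: "G lam = cs (- lam * lam) p" by (simp add: G_def p_def cs.sum_right cs.zero_left)
    have "cs lam (B p) = (\<Sum>e\<in>E0. inner g e *\<^sub>R cs lam (B e))"
      by (simp add: p_def B.sum B.scaleR cs.sum_right cs.scaleR_right)
    also have "\<dots> = p" unfolding p_def
    proof (intro sum.cong refl)
      fix e assume "e \<in> E0"
      then have "e = cs lam (B e)" by (intro eigenbasis_eigs(1)[OF E(2)]) (auto simp: E0_def)
      then show "inner g e *\<^sub>R cs lam (B e) = inner g e *\<^sub>R e" by simp
    qed
    finally have p: "p = cs lam (B p)" by simp
    have gp: "inner g p = (\<Sum>e\<in>E0. (inner g e)\<^sup>2)"
      by (simp add: p_def inner_sum_right power2_eq_square)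
    show ?thesis
    proof
      assume "G lam \<noteq> 0"
      then have "p \<noteq> 0" using G by (simp add: cs.zero_right)
      moreover have "p = 0" if "\<forall>e\<in>E0. inner g e = 0"
        unfolding p_def using that by (intro sum.neutral) simp
      ultimately obtain e where "e \<in> E0" "inner g e \<noteq> 0" by blast
      then have "inner g p > 0" unfolding gp by (intro sum_pos2[OF fin(1), of e]) simp_all
      then have "inner g p \<noteq> 0" by simp
      then show "\<exists>x. x = cs lam (B x) \<and> inner g x \<noteq> 0" using p by blast
    next
      assume "\<exists>x. x = cs lam (B x) \<and> inner g x \<noteq> 0"
      then obtain x where x: "x = cs lam (B x)" "inner g x \<noteq> 0" by blast
      define l where "l = Re lam"
      have "x \<noteq> 0" using x(2) by auto
      from eigs_real[OF this x(1)] have l: "lam = of_real l" "l > 0" "x = l *\<^sub>R B x"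
        unfolding l_def by auto
      have "inner (h lam) x = inner (l *\<^sub>R B (h lam) + l *\<^sub>R (g - (\<Sum>e\<in>E. inner g e *\<^sub>R e))) x"
        by (subst h(2)[OF R(2)]) (simp only: l(1) cs_of_real)
      also have "\<dots> = inner (h lam) (l *\<^sub>R B x) + l * inner (g - (\<Sum>e\<in>E. inner g e *\<^sub>R e)) x"
        by (simp add: inner_add_left B_sym)
      also have "l *\<^sub>R B x = x" using l(3) by simp
      finally have "inner (g - (\<Sum>e\<in>E. inner g e *\<^sub>R e)) x = 0" using l(2) by simp
      then have gx: "inner g x = (\<Sum>e\<in>E. inner g e * inner e x)"
        by (simp add: inner_diff_left inner_sum_left)
      have "\<exists>e\<in>E0. inner g e \<noteq> 0"
      proof (rule ccontr)
        assume none: "\<not> ?thesis"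
        have "inner g e * inner e x = 0" if e: "e \<in> E" for e
        proof (cases "e \<in> E0")
          case True then show ?thesis using none by auto
        next
          case False
          then have "lam * of_real (eigval e) \<noteq> 1" using e by (auto simp: E0_def)
          then have ne: "l * eigval e \<noteq> 1" unfolding l(1) by (metis of_real_1 of_real_mult)
          have "inner e x = l * inner e (B x)" by (subst l(3)) simp
          also have "inner e (B x) = eigval e * inner e x"
            using eigenbasis_aboveD(2)[OF E(2) e] by (metis B_sym inner_scaleR_left)
          finally have "inner e x * (1 - l * eigval e) = 0" by (simp add: algebra_simps)
          then show ?thesis using ne by simp
        qed
        then have "inner g x = 0" unfolding gx by (intro sum.neutral) auto
        then show False using x(2) by simp
      qed
      then obtain e where "e \<in> E0" "inner g e \<noteq> 0" by blast
      then have "inner g p > 0" unfolding gp by (intro sum_pos2[OF fin(1), of e]) simp_all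
      then have "p \<noteq> 0" by auto
      then show "G lam \<noteq> 0" using G \<open>lam \<noteq> 0\<close> by auto
    qed
  qed
  ultimately show ?thesis using r(1) int by blast
qed

end

section \<open>The Hilbert space of square-integrable functions\<close>

lemma D_borel [measurable, simp]: "D \<in> sets borel"
  unfolding D_def by (rule borel_Times) auto

lemma space_leb_D [simp]: "space leb_D = D"
  by (simp add: space_restrict_space)

lemma D_eq_box: "D = box (-1, -1) (1, 1)"
  by (auto simp: D_def box_prod)

interpretation leb_D: finite_measure leb_D
proof
  have "emeasure leb_D D = emeasure lborel (box (-1::real, -1::real) (1, 1))"
    by (simp add: emeasure_restrict_space D_eq_box)
  also have "\<dots> < \<infinity>" by (rule emeasure_lborel_box_finite)
  finally show "emeasure leb_D (space leb_D) \<noteq> \<infinity>" by simp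
qed

lemma L2D:
  assumes "u \<in> L2"
  shows "u \<in> borel_measurable leb_D" "integrable leb_D (\<lambda>x. (cmod (u x))\<^sup>2)"
  using assms by (auto simp: L2_def)

lemma L2_of_bounded:
  assumes "u \<in> borel_measurable leb_D" "\<And>x. x \<in> D \<Longrightarrow> cmod (u x) \<le> K"
  shows "u \<in> L2"
proof -
  have "integrable leb_D (\<lambda>x. (cmod (u x))\<^sup>2)"
  proof (rule leb_D.integrable_const_bound[of _ "K\<^sup>2"])
    show "AE x in leb_D. norm ((cmod (u x))\<^sup>2) \<le> K\<^sup>2"
      using assms(2) by (intro AE_I2) (simp add: power_mono)
  qed (use assms(1) in measurable)
  then show ?thesis using assms by (simp add: L2_def)
qed

lemma L2_add:
  assumes "u \<in> L2" "v \<in> L2"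
  shows "(\<lambda>x. u x + v x) \<in> L2"
proof -
  note [measurable] = L2D(1)[OF assms(1)] L2D(1)[OF assms(2)]
  have "integrable leb_D (\<lambda>x. (cmod (u x + v x))\<^sup>2)"
  proof (rule Bochner_Integration.integrable_bound)
    show "integrable leb_D (\<lambda>x. 2 * (cmod (u x))\<^sup>2 + 2 * (cmod (v x))\<^sup>2)"
      using assms[THEN L2D(2)] by simp
    show "AE x in leb_D. norm ((cmod (u x + v x))\<^sup>2) \<le> norm (2 * (cmod (u x))\<^sup>2 + 2 * (cmod (v x))\<^sup>2)"
    proof (rule AE_I2)
      fix x
      have "(cmod (u x + v x))\<^sup>2 \<le> (cmod (u x) + cmod (v x))\<^sup>2"
        by (intro power_mono norm_triangle_ineq) auto
      also have "\<dots> \<le> 2 * (cmod (u x))\<^sup>2 + 2 * (cmod (v x))\<^sup>2"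
        using sum_squares_bound[of "cmod (u x)" "cmod (v x)"] by (simp add: power2_sum)
      finally show "norm ((cmod (u x + v x))\<^sup>2) \<le> norm (2 * (cmod (u x))\<^sup>2 + 2 * (cmod (v x))\<^sup>2)" by simp
    qed
  qed measurable
  then show ?thesis by (simp add: L2_def)
qed

lemma L2_mult_bounded:
  assumes "u \<in> L2" "c \<in> borel_measurable leb_D" "\<And>x. x \<in> D \<Longrightarrow> cmod (c x) \<le> K"
  shows "(\<lambda>x. c x * u x) \<in> L2"
proof -
  note [measurable] = L2D(1)[OF assms(1)] assms(2)
  have "integrable leb_D (\<lambda>x. (cmod (c x * u x))\<^sup>2)"
  proof (rule Bochner_Integration.integrable_bound)
    show "integrable leb_D (\<lambda>x. K\<^sup>2 * (cmod (u x))\<^sup>2)"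
      using L2D(2)[OF assms(1)] by simp
    show "AE x in leb_D. norm ((cmod (c x * u x))\<^sup>2) \<le> norm (K\<^sup>2 * (cmod (u x))\<^sup>2)"
      using assms(3) by (intro AE_I2)
        (auto simp: norm_mult power_mult_distrib intro!: mult_right_mono power_mono)
  qed measurable
  then show ?thesis by (simp add: L2_def)
qed

lemma L2_scale: "u \<in> L2 \<Longrightarrow> (\<lambda>x. c * u x) \<in> L2"
  by (rule L2_mult_bounded[of _ _ "cmod c"]) auto

lemma L2_uminus: "u \<in> L2 \<Longrightarrow> (\<lambda>x. - u x) \<in> L2"
  using L2_scale[of u "-1"] by simp

lemma L2_diff: "u \<in> L2 \<Longrightarrow> v \<in> L2 \<Longrightarrow> (\<lambda>x. u x - v x) \<in> L2"
  using L2_add[of u "\<lambda>x. - v x"] L2_uminus[of v] by simp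

lemma L2_zero: "(\<lambda>_. 0) \<in> L2"
  by (rule L2_of_bounded[of _ 0]) auto

lemma L2_cnj: "u \<in> L2 \<Longrightarrow> (\<lambda>x. cnj (u x)) \<in> L2"
  using borel_measurable_continuous_on[of cnj u leb_D] unfolding L2_def
  by (auto intro!: continuous_intros)

lemma L2_mult_integrable:
  assumes "u \<in> L2" "v \<in> L2"
  shows "integrable leb_D (\<lambda>x. u x * v x)"
proof (rule Bochner_Integration.integrable_bound)
  show "integrable leb_D (\<lambda>x. (cmod (u x))\<^sup>2 + (cmod (v x))\<^sup>2)"
    using assms[THEN L2D(2)] by simp
  show "AE x in leb_D. norm (u x * v x) \<le> norm ((cmod (u x))\<^sup>2 + (cmod (v x))\<^sup>2)"
  proof (rule AE_I2)
    fix x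
    have "2 * cmod (u x) * cmod (v x) \<le> (cmod (u x))\<^sup>2 + (cmod (v x))\<^sup>2" by (rule sum_squares_bound)
    moreover have "0 \<le> cmod (u x) * cmod (v x)" by simp
    ultimately have "cmod (u x) * cmod (v x) \<le> (cmod (u x))\<^sup>2 + (cmod (v x))\<^sup>2" by linarith
    then show "norm (u x * v x) \<le> norm ((cmod (u x))\<^sup>2 + (cmod (v x))\<^sup>2)"
      by (simp add: norm_mult)
  qed
qed (use assms[THEN L2D(1)] in measurable)

definition l2_rel :: "field \<Rightarrow> field \<Rightarrow> bool" where
  "l2_rel u v \<longleftrightarrow> u \<in> L2 \<and> v \<in> L2 \<and> ae_eq u v"

lemma ae_eq_sym: "ae_eq u v \<Longrightarrow> ae_eq v u"
  unfolding ae_eq_def by (auto elim: eventually_mono)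

lemma ae_eq_trans: "ae_eq u v \<Longrightarrow> ae_eq v w \<Longrightarrow> ae_eq u w"
  unfolding ae_eq_def by (rule eventually_elim2[of "\<lambda>x. u x = v x" _ "\<lambda>x. v x = w x"]) auto

lemma ae_eq_binary:
  "ae_eq u u' \<Longrightarrow> ae_eq v v' \<Longrightarrow> ae_eq (\<lambda>x. h (u x) (v x)) (\<lambda>x. h (u' x) (v' x))"
  unfolding ae_eq_def by (rule eventually_elim2[of "\<lambda>x. u x = u' x" _ "\<lambda>x. v x = v' x"]) auto

lemma ae_eq_unary: "ae_eq u u' \<Longrightarrow> ae_eq (\<lambda>x. h (u x)) (\<lambda>x. h (u' x))"
  unfolding ae_eq_def by (erule eventually_mono) simp

lemma ae_eq_refl [simp]: "ae_eq u u"
  by (simp add: ae_eq_def)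

lemma l2_rel_integral_mult:
  assumes "l2_rel u u'" "l2_rel v v'"
  shows "(\<integral>x. u x * v x \<partial>leb_D) = (\<integral>x. u' x * v' x \<partial>leb_D)"
proof (rule integral_cong_AE)
  show "AE x in leb_D. u x * v x = u' x * v' x"
    using assms ae_eq_binary[of u u' v v' "(*)"] unfolding l2_rel_def ae_eq_def by blast
  show "(\<lambda>x. u x * v x) \<in> borel_measurable leb_D" "(\<lambda>x. u' x * v' x) \<in> borel_measurable leb_D"
    using assms by (auto simp: l2_rel_def dest!: L2D(1))
qed

lemma l2_rel_cnj: "l2_rel u v \<Longrightarrow> l2_rel (\<lambda>x. cnj (u x)) (\<lambda>x. cnj (v x))"
  unfolding l2_rel_def using L2_cnj ae_eq_unary[of u v cnj] by blast

quotient_type l2 = field / partial: l2_rel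
proof (rule part_equivpI)
  show "\<exists>u. l2_rel u u" using L2_zero by (auto simp: l2_rel_def)
  show "symp l2_rel" unfolding symp_def l2_rel_def using ae_eq_sym by blast
  show "transp l2_rel" unfolding transp_def l2_rel_def using ae_eq_trans by blast
qed

text \<open>The class of a function that is not square-integrable is a junk value.\<close>

abbreviation cls :: "field \<Rightarrow> l2" where "cls \<equiv> abs_l2"

lemma cls_eq_iff: "u \<in> L2 \<Longrightarrow> v \<in> L2 \<Longrightarrow> cls u = cls v \<longleftrightarrow> ae_eq u v"
  using Quotient_rel[OF Quotient_l2, of u v] by (auto simp: l2_rel_def)

lemma cls_surj: "\<exists>u\<in>L2. x = cls u"
proof -
  have "l2_rel (rep_l2 x) (rep_l2 x)" by (rule Quotient_rep_reflp[OF Quotient_l2])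
  moreover have "cls (rep_l2 x) = x" by (rule Quotient_abs_rep[OF Quotient_l2])
  ultimately show ?thesis by (auto simp: l2_rel_def intro!: bexI[of _ "rep_l2 x"])
qed

instantiation l2 :: real_vector
begin

lift_definition zero_l2 :: l2 is "\<lambda>_. 0" by (simp add: l2_rel_def L2_zero)

lift_definition plus_l2 :: "l2 \<Rightarrow> l2 \<Rightarrow> l2" is "\<lambda>u v x. u x + v x"
  unfolding l2_rel_def by (auto intro: L2_add ae_eq_binary)

lift_definition uminus_l2 :: "l2 \<Rightarrow> l2" is "\<lambda>u x. - u x"
  unfolding l2_rel_def by (auto intro: L2_uminus ae_eq_unary)

lift_definition minus_l2 :: "l2 \<Rightarrow> l2 \<Rightarrow> l2" is "\<lambda>u v x. u x - v x"
  unfolding l2_rel_def by (auto intro: L2_diff ae_eq_binary)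

lift_definition scaleR_l2 :: "real \<Rightarrow> l2 \<Rightarrow> l2" is "\<lambda>r u x. complex_of_real r * u x"
  unfolding l2_rel_def by (auto intro: L2_scale ae_eq_unary)

instance
proof
  fix x y z :: l2 and a b :: real
  show "x + y + z = x + (y + z)"
    by transfer (simp add: l2_rel_def L2_add add.assoc)
  show "x + y = y + x"
    by transfer (simp add: l2_rel_def L2_add add.commute)
  show "0 + x = x"
    by transfer (simp add: l2_rel_def )
  show "- x + x = 0"
    by transfer (simp add: l2_rel_def L2_zero)
  show "x - y = x + - y"
    by transfer (simp add: l2_rel_def L2_diff)
  show "a *\<^sub>R (x + y) = a *\<^sub>R x + a *\<^sub>R y"
    by transfer (simp add: l2_rel_def L2_add L2_scale distrib_left)
  show "(a + b) *\<^sub>R x = a *\<^sub>R x + b *\<^sub>R x"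
    by transfer (simp add: l2_rel_def L2_add L2_scale distrib_right)
  show "a *\<^sub>R b *\<^sub>R x = (a * b) *\<^sub>R x"
    by transfer (simp add: l2_rel_def L2_scale mult.assoc)
  show "1 *\<^sub>R x = x"
    by transfer (simp add: l2_rel_def )
qed

end

lemma Re_integral_mult_cnj: "Re (\<integral>x. u x * cnj (u x) \<partial>leb_D) = (\<integral>x. (cmod (u x))\<^sup>2 \<partial>leb_D)"
  by (simp only: complex_norm_square[symmetric] integral_complex_of_real Re_complex_of_real)

instantiation l2 :: real_inner
begin

lift_definition inner_l2 :: "l2 \<Rightarrow> l2 \<Rightarrow> real" is "\<lambda>u v. Re (\<integral>x. u x * cnj (v x) \<partial>leb_D)"
  by (intro arg_cong[of _ _ Re] l2_rel_integral_mult l2_rel_cnj)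

definition norm_l2 :: "l2 \<Rightarrow> real" where "norm_l2 x = sqrt (inner x x)"
definition dist_l2 :: "l2 \<Rightarrow> l2 \<Rightarrow> real" where "dist_l2 x y = norm (x - y)"
definition sgn_l2 :: "l2 \<Rightarrow> l2" where "sgn_l2 x = x /\<^sub>R norm x"
definition uniformity_l2 :: "(l2 \<times> l2) filter" where
  "uniformity_l2 = (INF e\<in>{0<..}. principal {(x, y). dist x y < e})"
definition open_l2 :: "l2 set \<Rightarrow> bool" where
  "open_l2 U \<longleftrightarrow> (\<forall>x\<in>U. \<forall>\<^sub>F (x', y) in uniformity. x' = x \<longrightarrow> y \<in> U)"

instance
proof
  fix x y z :: l2 and a b :: real and U :: "l2 set"
  show "inner x y = inner y x"
  proof transfer
    fix u v
    have "(\<integral>x. v x * cnj (u x) \<partial>leb_D) = (\<integral>x. cnj (u x * cnj (v x)) \<partial>leb_D)"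
      by (simp only: complex_cnj_mult complex_cnj_cnj mult.commute)
    also have "\<dots> = cnj (\<integral>x. u x * cnj (v x) \<partial>leb_D)"
      by (rule Bochner_Integration.integral_cnj)
    finally show "Re (\<integral>x. u x * cnj (v x) \<partial>leb_D) = Re (\<integral>x. v x * cnj (u x) \<partial>leb_D)" by simp
  qed
  show "inner (x + y) z = inner x z + inner y z"
    by transfer (simp add: l2_rel_def ring_distribs L2_mult_integrable L2_cnj)
  show "inner (a *\<^sub>R x) y = a * inner x y"
    by transfer (simp add: l2_rel_def mult.assoc)
  show "0 \<le> inner x x"
    by transfer (simp only: Re_integral_mult_cnj, simp)
  show "inner x x = 0 \<longleftrightarrow> x = 0"
  proof transfer
    fix u assume "l2_rel u u"
    then have u: "u \<in> L2" by (simp add: l2_rel_def)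
    show "(Re (\<integral>x. u x * cnj (u x) \<partial>leb_D) = 0) = l2_rel u (\<lambda>_. 0)"
      unfolding Re_integral_mult_cnj
      using integral_nonneg_eq_0_iff_AE[OF L2D(2)[OF u]] u by (simp add: l2_rel_def L2_zero ae_eq_def)
  qed
  show "norm x = sqrt (inner x x)" by (rule norm_l2_def)
  show "dist x y = norm (x - y)" by (rule dist_l2_def)
  show "sgn x = x /\<^sub>R norm x" by (rule sgn_l2_def)
  show "(uniformity :: (l2 \<times> l2) filter) = (INF e\<in>{0<..}. principal {(x, y). dist x y < e})"
    by (rule uniformity_l2_def)
  show "open U \<longleftrightarrow> (\<forall>x\<in>U. \<forall>\<^sub>F (x', y) in uniformity. x' = x \<longrightarrow> y \<in> U)"
    by (rule open_l2_def)
qed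

end

lemma cls_add: "u \<in> L2 \<Longrightarrow> v \<in> L2 \<Longrightarrow> cls (\<lambda>x. u x + v x) = cls u + cls v"
  by (simp add: plus_l2.abs_eq l2_rel_def)

lemma cls_diff: "u \<in> L2 \<Longrightarrow> v \<in> L2 \<Longrightarrow> cls (\<lambda>x. u x - v x) = cls u - cls v"
  by (simp add: minus_l2.abs_eq l2_rel_def)

lemma cls_zero: "cls (\<lambda>_. 0) = 0"
  by (simp add: zero_l2_def)

lemma inner_cls: "u \<in> L2 \<Longrightarrow> v \<in> L2 \<Longrightarrow> inner (cls u) (cls v) = Re (\<integral>x. u x * cnj (v x) \<partial>leb_D)"
  by (simp add: inner_l2.abs_eq l2_rel_def)

lemma norm_cls:
  assumes "u \<in> L2"
  shows "(norm (cls u))\<^sup>2 = (\<integral>x. (cmod (u x))\<^sup>2 \<partial>leb_D)"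
  using power2_norm_eq_inner[of "cls u"] inner_cls[OF assms assms] Re_integral_mult_cnj by metis

lift_definition l2_scale :: "complex \<Rightarrow> l2 \<Rightarrow> l2" is "\<lambda>c u x. c * u x"
  unfolding l2_rel_def by (auto intro: L2_scale ae_eq_unary)

lemma l2_scale_cls: "u \<in> L2 \<Longrightarrow> l2_scale c (cls u) = cls (\<lambda>x. c * u x)"
  by (simp add: l2_scale.abs_eq l2_rel_def)

lemma l2_scale_add_left: "l2_scale (z + w) x = l2_scale z x + l2_scale w x"
  by transfer (simp add: l2_rel_def L2_add L2_scale ring_distribs)

lemma l2_scale_add_right: "l2_scale z (x + y) = l2_scale z x + l2_scale z y"
  by transfer (simp add: l2_rel_def L2_add L2_scale ring_distribs)

lemma l2_scale_assoc: "l2_scale z (l2_scale w x) = l2_scale (z * w) x"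
  by transfer (simp add: l2_rel_def L2_scale mult.assoc)

lemma l2_scale_of_real: "l2_scale (complex_of_real r) x = r *\<^sub>R x"
  by transfer (simp add: l2_rel_def L2_scale)

lemma norm_l2_scale: "norm (l2_scale z x) = cmod z * norm x"
proof -
  obtain u where u: "u \<in> L2" "x = cls u" using cls_surj by blast
  have "(norm (l2_scale z x))\<^sup>2 = (\<integral>y. (cmod z)\<^sup>2 * (cmod (u y))\<^sup>2 \<partial>leb_D)"
    unfolding u(2) l2_scale_cls[OF u(1)] norm_cls[OF L2_scale[OF u(1)]]
    by (simp only: norm_mult power_mult_distrib)
  also have "\<dots> = (cmod z * norm x)\<^sup>2"
    unfolding u(2) power_mult_distrib norm_cls[OF u(1)] by (rule integral_mult_right_zero)
  finally show ?thesis by (rule power2_eq_imp_eq) auto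
qed

lemma inner_l2_scale_i:
  assumes "u \<in> L2" "v \<in> L2"
  shows "inner (cls u) (l2_scale \<i> (cls v)) = Im (\<integral>x. u x * cnj (v x) \<partial>leb_D)"
proof -
  have "(\<integral>x. u x * cnj (\<i> * v x) \<partial>leb_D) = (\<integral>x. (- \<i>) * (u x * cnj (v x)) \<partial>leb_D)"
    by (simp add: ac_simps)
  also have "\<dots> = (- \<i>) * (\<integral>x. u x * cnj (v x) \<partial>leb_D)" by (rule integral_mult_right_zero)
  finally show ?thesis using assms by (simp add: l2_scale_cls inner_cls L2_scale)
qed

lemma integral_cmod_le_norm:
  assumes "u \<in> L2"
  shows "(\<integral>x. cmod (u x) \<partial>leb_D) \<le> norm (cls u) * norm (cls (\<lambda>_. 1))"
    and "integrable leb_D (\<lambda>x. cmod (u x))"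
proof -
  have 1: "(\<lambda>_. 1) \<in> L2" by (rule L2_of_bounded[of _ 1]) auto
  have a: "(\<lambda>x. complex_of_real (cmod (u x))) \<in> L2"
    using assms by (auto simp: L2_def)
  have "(\<integral>x. cmod (u x) \<partial>leb_D) = inner (cls (\<lambda>x. complex_of_real (cmod (u x)))) (cls (\<lambda>_. 1))"
    using inner_cls[OF a 1] by simp
  also have "\<dots> \<le> norm (cls (\<lambda>x. complex_of_real (cmod (u x)))) * norm (cls (\<lambda>_. 1))"
    by (rule norm_cauchy_schwarz)
  also have "norm (cls (\<lambda>x. complex_of_real (cmod (u x)))) = norm (cls u)"
    by (rule power2_eq_imp_eq) (simp_all add: norm_cls a assms)
  finally show "(\<integral>x. cmod (u x) \<partial>leb_D) \<le> norm (cls u) * norm (cls (\<lambda>_. 1))" .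
  show "integrable leb_D (\<lambda>x. cmod (u x))"
    using L2_mult_integrable[OF assms 1] by simp
qed

lemma L2_integrable: "u \<in> L2 \<Longrightarrow> integrable leb_D u"
  using integral_cmod_le_norm(2)[of u] L2D(1)[of u] by (simp add: integrable_norm_iff)

lemma L2_of_nn_integral:
  assumes [measurable]: "u \<in> borel_measurable leb_D"
    and le: "(\<integral>\<^sup>+x. ennreal ((cmod (u x))\<^sup>2) \<partial>leb_D) \<le> ennreal (c\<^sup>2)" and "c \<ge> 0"
  shows "u \<in> L2" "norm (cls u) \<le> c"
proof -
  have int: "integrable leb_D (\<lambda>x. (cmod (u x))\<^sup>2)"
    using le by (intro integrableI_nonneg) (auto simp: le_less_trans[OF _ ennreal_less_top])
  then show u: "u \<in> L2" by (simp add: L2_def)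
  have "ennreal ((norm (cls u))\<^sup>2) \<le> ennreal (c\<^sup>2)"
    unfolding norm_cls[OF u] using le nn_integral_eq_integral[OF int] by simp
  then have "(norm (cls u))\<^sup>2 \<le> c\<^sup>2" by simp
  then show "norm (cls u) \<le> c" using \<open>c \<ge> 0\<close> by (rule power2_le_imp_le)
qed

text \<open>Riesz-Fischer: along a subsequence with geometrically small increments, the increments are
  summable in \<open>L\<^sup>1\<close>, since the square has finite measure. Hence the subsequence converges almost
  everywhere, and by Fatou's lemma also in \<open>L\<^sup>2\<close>.\<close>

instance l2 :: banach
proof
  fix X :: "nat \<Rightarrow> l2" assume X: "Cauchy X"
  have "\<exists>N. \<forall>i\<ge>N. \<forall>j\<ge>N. dist (X i) (X j) < (1/2)^k" for k
    using metric_CauchyD[OF X, of "(1/2)^k"] by simp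
  then obtain N where N: "\<And>k i j. i \<ge> N k \<Longrightarrow> j \<ge> N k \<Longrightarrow> dist (X i) (X j) < (1/2)^k" by metis
  define r where "r k = (\<Sum>i\<le>k. Suc (N i))" for k
  have r: "strict_mono r" by (rule strict_mono_Suc_iff[THEN iffD2]) (simp add: r_def)
  have rN: "r k \<ge> N k" for k unfolding r_def by (cases k) simp_all
  have near: "dist (X (r k)) (X (r n)) < (1/2)^n" if "k \<ge> n" for k n
    using N[of n "r k" "r n"] rN that strict_mono_mono[OF r] by (meson le_trans monoD)
  \<comment> \<open>From here on the classes are replaced by representatives.\<close>
  have "\<forall>k. \<exists>u\<in>L2. X (r k) = cls u" using cls_surj by blast
  then obtain f where f: "\<And>k. f k \<in> L2" and Xf: "\<And>k. X (r k) = cls (f k)" by metis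
  note [measurable] = L2D(1)[OF f]
  define g where "g k x = f (Suc k) x - f k x" for k x
  have g: "g k \<in> L2" for k using L2_diff[OF f f] by (simp add: g_def[abs_def])
  note [measurable] = L2D(1)[OF g]
  define C where "C = norm (cls (\<lambda>_. 1))"
  have g_le: "(\<integral>x. cmod (g k x) \<partial>leb_D) \<le> (1/2)^k * C" for k
  proof -
    have "norm (cls (g k)) \<le> (1/2)^k"
      using near[of k "Suc k"] cls_diff[OF f f, of "Suc k" k] by (simp add: g_def[abs_def] dist_norm Xf)
    then have "norm (cls (g k)) * C \<le> (1/2)^k * C" by (intro mult_right_mono) (auto simp: C_def)
    then show ?thesis using integral_cmod_le_norm(1)[OF g, of k] by (simp add: C_def)
  qed
  have "(\<integral>\<^sup>+x. (\<Sum>k. ennreal (cmod (g k x))) \<partial>leb_D) = (\<Sum>k. \<integral>\<^sup>+x. ennreal (cmod (g k x)) \<partial>leb_D)"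
    by (rule nn_integral_suminf) measurable
  also have "\<dots> \<le> (\<Sum>k. ennreal ((1/2)^k * C))"
  proof (rule suminf_le)
    fix k
    have "(\<integral>\<^sup>+x. ennreal (cmod (g k x)) \<partial>leb_D) = ennreal (\<integral>x. cmod (g k x) \<partial>leb_D)"
      by (rule nn_integral_eq_integral) (auto intro: integral_cmod_le_norm(2) g)
    then show "(\<integral>\<^sup>+x. ennreal (cmod (g k x)) \<partial>leb_D) \<le> ennreal ((1/2)^k * C)"
      using g_le[of k] by (simp add: ennreal_leI)
  qed auto
  also have "\<dots> = ennreal (\<Sum>k. (1/2)^k * C)"
    by (rule suminf_ennreal2) (auto simp: C_def intro!: summable_mult2 summable_geometric)
  also have "\<dots> < \<infinity>" by simp
  finally have "(\<integral>\<^sup>+x. (\<Sum>k. ennreal (cmod (g k x))) \<partial>leb_D) \<noteq> \<infinity>" by simp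
  then have "AE x in leb_D. (\<Sum>k. ennreal (cmod (g k x))) \<noteq> \<infinity>"
    by (intro nn_integral_PInf_AE) measurable
  then have conv: "AE x in leb_D. (\<lambda>k. f k x) \<longlonglongrightarrow> lim (\<lambda>k. f k x)"
  proof (rule eventually_mono)
    fix x assume "(\<Sum>k. ennreal (cmod (g k x))) \<noteq> \<infinity>"
    then have "summable (\<lambda>k. cmod (g k x))" by (intro summable_suminf_not_top) auto
    then have "summable (\<lambda>k. g k x)" by (rule summable_norm_cancel)
    then have "convergent (\<lambda>n. \<Sum>k<n. g k x)" by (simp add: summable_iff_convergent)
    then have "convergent (\<lambda>n. f n x - f 0 x)" 
      using sum_lessThan_telescope[of "\<lambda>k. f k x"] by (simp add: g_def)
    then have "convergent (\<lambda>n. f n x)" using convergent_diff_const_right_iff by blast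
    then show "(\<lambda>k. f k x) \<longlonglongrightarrow> lim (\<lambda>k. f k x)" by (simp add: convergent_LIMSEQ_iff)
  qed
  define F where "F x = lim (\<lambda>k. f k x)" for x
  have [measurable]: "F \<in> borel_measurable leb_D" unfolding F_def by measurable
  have fatou: "(\<integral>\<^sup>+x. ennreal ((cmod (F x - f n x))\<^sup>2) \<partial>leb_D) \<le> ennreal (((1/2)^n)\<^sup>2)" for n
  proof -
    have "(\<integral>\<^sup>+x. ennreal ((cmod (F x - f n x))\<^sup>2) \<partial>leb_D)
        = (\<integral>\<^sup>+x. liminf (\<lambda>k. ennreal ((cmod (f k x - f n x))\<^sup>2)) \<partial>leb_D)"
    proof (rule nn_integral_cong_AE, use conv in eventually_elim)
      fix x assume "(\<lambda>k. f k x) \<longlonglongrightarrow> lim (\<lambda>k. f k x)"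
      then have "(\<lambda>k. ennreal ((cmod (f k x - f n x))\<^sup>2)) \<longlonglongrightarrow> ennreal ((cmod (F x - f n x))\<^sup>2)"
        unfolding F_def by (intro tendsto_intros)
      then show "ennreal ((cmod (F x - f n x))\<^sup>2) = liminf (\<lambda>k. ennreal ((cmod (f k x - f n x))\<^sup>2))"
        by (rule lim_imp_Liminf[OF sequentially_bot, symmetric])
    qed
    also have "\<dots> \<le> liminf (\<lambda>k. \<integral>\<^sup>+x. ennreal ((cmod (f k x - f n x))\<^sup>2) \<partial>leb_D)"
      by (rule nn_integral_liminf) measurable
    also have "\<dots> \<le> liminf (\<lambda>k. ennreal (((1/2)^n)\<^sup>2))"
    proof (rule Liminf_mono, rule eventually_sequentiallyI[of n])
      fix k assume "n \<le> k"
      have d: "(\<lambda>x. f k x - f n x) \<in> L2" by (rule L2_diff[OF f f])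
      have "(\<integral>\<^sup>+x. ennreal ((cmod (f k x - f n x))\<^sup>2) \<partial>leb_D) = ennreal ((norm (cls (\<lambda>x. f k x - f n x)))\<^sup>2)"
        unfolding norm_cls[OF d] by (rule nn_integral_eq_integral[OF L2D(2)[OF d]]) simp
      moreover have "norm (cls (\<lambda>x. f k x - f n x)) \<le> (1/2)^n"
        using near[OF \<open>n \<le> k\<close>] by (simp add: cls_diff[OF f f] Xf dist_norm)
      then have "(norm (cls (\<lambda>x. f k x - f n x)))\<^sup>2 \<le> ((1/2)^n)\<^sup>2"
        by (intro power_mono) auto
      ultimately show "(\<integral>\<^sup>+x. ennreal ((cmod (f k x - f n x))\<^sup>2) \<partial>leb_D) \<le> ennreal (((1/2)^n)\<^sup>2)"
        by (simp only: ennreal_leI)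
    qed
    finally show ?thesis by (simp add: Liminf_const)
  qed
  have FL2: "F \<in> L2"
  proof -
    have "(\<lambda>x. F x - f 0 x) \<in> L2"
      by (rule L2_of_nn_integral(1)[OF _ fatou[of 0]]) auto
    from L2_add[OF this f[of 0]] show ?thesis by simp
  qed
  have "norm (X (r n) - cls F) \<le> (1/2)^n" for n
  proof -
    have "norm (cls (\<lambda>x. F x - f n x)) \<le> (1/2)^n"
      by (rule L2_of_nn_integral(2)[OF _ fatou[of n]]) auto
    then show ?thesis by (simp add: cls_diff[OF FL2 f] Xf norm_minus_commute)
  qed
  then have "\<forall>\<^sub>F n in sequentially. norm (X (r n) - cls F) \<le> (1/2)^n"
    by (rule always_eventually[OF allI])
  moreover have "(\<lambda>n. (1/2)^n :: real) \<longlonglongrightarrow> 0" by (rule LIMSEQ_realpow_zero) auto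
  ultimately have "(\<lambda>n. X (r n) - cls F) \<longlonglongrightarrow> 0" by (rule Lim_null_comparison)
  then have "(X \<circ> r) \<longlonglongrightarrow> cls F" by (simp add: o_def LIM_zero_iff)
  then show "convergent X" using Cauchy_converges_subseq[OF X r] by (auto simp: convergent_def)
qed

section \<open>Smooth functions and cut-offs\<close>

lemma pdiff_eqI: "(f has_derivative f') (at x) \<Longrightarrow> pdiff e f x = f' e"
  unfolding pdiff_def using frechet_derivative_at by metis

text \<open>Smoothness of a single function is shown by embedding it in a family of differentiable functions
  that is closed under partial derivatives.\<close>

lemma smooth_coinduct:
  assumes "f \<in> F" and diff: "\<And>g x. g \<in> F \<Longrightarrow> g differentiable (at x)"
    and closed: "\<And>g e. g \<in> F \<Longrightarrow> e \<in> Basis \<Longrightarrow> pdiff e g \<in> F"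
  shows "smooth f"
  unfolding smooth_def
proof (intro allI impI)
  fix es :: "point list" and x
  assume "set es \<subseteq> Basis"
  then have "foldr pdiff es f \<in> F" by (induction es) (auto simp: assms)
  then show "foldr pdiff es f differentiable at x" by (rule diff)
qed

lemma smooth_differentiable: "smooth f \<Longrightarrow> f differentiable (at x)"
proof -
  assume "smooth f"
  then have "foldr pdiff [] f differentiable (at x)"
    unfolding smooth_def by (metis empty_subsetI list.set(1))
  then show ?thesis by (simp only: foldr.simps id_apply)
qed

lemma differentiable_pdiff: "f differentiable (at x) \<Longrightarrow> (f has_derivative (\<lambda>e. pdiff e f x)) (at x)"
  unfolding pdiff_def by (simp only: frechet_derivative_works)

lemma smooth_has_derivative: "smooth f \<Longrightarrow> (f has_derivative (\<lambda>e. pdiff e f x)) (at x)"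
  by (intro differentiable_pdiff smooth_differentiable)

lemma smooth_pdiff:
  assumes "smooth f" "e \<in> Basis"
  shows "smooth (pdiff e f)"
  unfolding smooth_def
proof (intro allI impI)
  fix es :: "point list" and x
  assume "set es \<subseteq> Basis"
  then have "set (es @ [e]) \<subseteq> Basis" using assms(2) by simp
  then have "foldr pdiff (es @ [e]) f differentiable at x"
    using assms(1) unfolding smooth_def by blast
  then show "foldr pdiff es (pdiff e f) differentiable at x" by simp
qed

lemma smooth_continuous: "smooth f \<Longrightarrow> continuous_on A f"
  by (meson continuous_at_imp_continuous_on differentiable_imp_continuous_within smooth_differentiable)

lemma pdiff_mult:
  assumes "smooth f" "smooth g"
  shows "pdiff e (\<lambda>x. f x * g x) = (\<lambda>x. f x * pdiff e g x + pdiff e f x * g x)"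
  by (rule ext, rule pdiff_eqI) (intro has_derivative_mult smooth_has_derivative assms)

lemma pdiff_bounded_linear:
  assumes "bounded_linear h" "smooth f"
  shows "pdiff e (\<lambda>x. h (f x)) = (\<lambda>x. h (pdiff e f x))"
  by (rule ext, rule pdiff_eqI)
    (intro bounded_linear.has_derivative[OF assms(1)] smooth_has_derivative assms)

lemma smooth_bounded_linear:
  assumes "bounded_linear h" "smooth f"
  shows "smooth (\<lambda>x. h (f x))"
proof (rule smooth_coinduct[where F = "{\<lambda>x. h (f x) | f. smooth f}"])
  fix g and x :: point assume "g \<in> {\<lambda>x. h (f x) | f. smooth f}"
  then obtain f where f: "g = (\<lambda>x. h (f x))" "smooth f" by blast
  show "g differentiable (at x)"
    unfolding f(1) differentiable_def
    using bounded_linear.has_derivative[OF assms(1) smooth_has_derivative[OF f(2)]] by blast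
next
  fix g and e :: point assume "g \<in> {\<lambda>x. h (f x) | f. smooth f}" "e \<in> Basis"
  then obtain f where f: "g = (\<lambda>x. h (f x))" "smooth f" by blast
  show "pdiff e g \<in> {\<lambda>x. h (f x) | f. smooth f}"
    using smooth_pdiff[OF f(2) \<open>e \<in> Basis\<close>] pdiff_bounded_linear[OF assms(1) f(2)] f(1) by auto
qed (use assms in blast)

text \<open>The products of smooth functions are not closed under differentiation, their sums are.\<close>

inductive_set smooth_products :: "field set" where
  mult: "smooth f \<Longrightarrow> smooth g \<Longrightarrow> (\<lambda>x. f x * g x) \<in> smooth_products"
| add: "u \<in> smooth_products \<Longrightarrow> v \<in> smooth_products \<Longrightarrow> (\<lambda>x. u x + v x) \<in> smooth_products"

lemma smooth_products_differentiable:
  "u \<in> smooth_products \<Longrightarrow> u differentiable (at x)"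
proof (induction rule: smooth_products.induct)
  case (mult f g)
  then show ?case by (intro differentiable_mult smooth_differentiable)
next
  case (add u v)
  then show ?case by (intro differentiable_add)
qed

lemma smooth_products_pdiff:
  assumes "u \<in> smooth_products" "e \<in> Basis"
  shows "pdiff e u \<in> smooth_products"
  using assms(1)
proof induction
  case (mult f g)
  then show ?case
    unfolding pdiff_mult[OF mult]
    by (intro smooth_products.intros smooth_pdiff assms(2))
next
  case (add u v)
  have "pdiff e (\<lambda>x. u x + v x) = (\<lambda>x. pdiff e u x + pdiff e v x)"
    by (rule ext, rule pdiff_eqI)
      (intro has_derivative_add differentiable_pdiff smooth_products_differentiable add.hyps)
  then show ?case using add.IH by (simp add: smooth_products.add)
qed

lemma smooth_products_smooth: "u \<in> smooth_products \<Longrightarrow> smooth u"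
  by (rule smooth_coinduct[where F = smooth_products])
    (auto intro: smooth_products_differentiable smooth_products_pdiff)

lemma smooth_mult: "smooth f \<Longrightarrow> smooth g \<Longrightarrow> smooth (\<lambda>x. f x * g x)"
  by (rule smooth_products_smooth[OF smooth_products.mult])

lemma smooth_const: "smooth (\<lambda>_. c)"
proof (rule smooth_coinduct[where F = "range (\<lambda>c _. c)"])
  fix g :: field and e :: point assume "g \<in> range (\<lambda>c _. c)"
  then obtain c where g: "g = (\<lambda>_. c)" by blast
  have "pdiff e g = (\<lambda>_. 0)" unfolding g by (rule ext, rule pdiff_eqI) (rule has_derivative_const)
  then show "pdiff e g \<in> range (\<lambda>c _. c)" by auto
qed auto

lemma smooth_add: "smooth f \<Longrightarrow> smooth g \<Longrightarrow> smooth (\<lambda>x. f x + g x)"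
  using smooth_products_smooth[OF smooth_products.add[OF
      smooth_products.mult[of f "\<lambda>_. 1"] smooth_products.mult[of g "\<lambda>_. 1"]]] smooth_const[of 1]
  by simp

lemma smooth_prod:
  assumes "finite I" "\<And>i. i \<in> I \<Longrightarrow> smooth (f i)"
  shows "smooth (\<lambda>x. \<Prod>i\<in>I. f i x)"
  using assms by (induction I) (simp_all add: smooth_const smooth_mult)

text \<open>These functions vanish to infinite order at \<open>0\<close>. With the polynomial as parameter they are closed
  under differentiation; \<open>p = 1\<close> is the standard building block of cut-offs.\<close>

definition flat :: "real poly \<Rightarrow> real \<Rightarrow> real" where
  "flat p t = (if t > 0 then poly p (1 / t) * exp (- 1 / t) else 0)"

lemma poly_div_exp_tendsto_0: "((\<lambda>x. poly p x / exp x) \<longlongrightarrow> (0::real)) at_top"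
proof -
  have "((\<lambda>x. \<Sum>i\<le>degree p. coeff p i * (x ^ i / exp x)) \<longlongrightarrow> (\<Sum>i\<le>degree p. coeff p i * 0)) at_top"
    by (intro tendsto_intros tendsto_power_div_exp_0)
  then show ?thesis by (simp add: poly_altdef sum_divide_distrib)
qed

lemma flat_has_derivative:
  "(flat p has_real_derivative flat (pCons 0 (pCons 0 (p - pderiv p))) t) (at t)"
proof -
  consider "t > 0" | "t < 0" | "t = 0" by linarith
  then show ?thesis
  proof cases
    case 1
    have "((\<lambda>t. poly p (1 / t) * exp (- 1 / t)) has_real_derivative
        flat (pCons 0 (pCons 0 (p - pderiv p))) t) (at t)"
      using 1 by (auto intro!: derivative_eq_intros DERIV_chain2[OF poly_DERIV]
          simp: flat_def field_simps power2_eq_square)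
    then show ?thesis
      by (rule has_field_derivative_transform_within_open[where S = "{0<..}"])
        (use 1 in \<open>auto simp: flat_def\<close>)
  next
    case 2
    have "((\<lambda>t. 0) has_real_derivative flat (pCons 0 (pCons 0 (p - pderiv p))) t) (at t)"
      using 2 by (simp add: flat_def)
    then show ?thesis
      by (rule has_field_derivative_transform_within_open[where S = "{..<0}"])
        (use 2 in \<open>auto simp: flat_def\<close>)
  next
    case 3
    have "((\<lambda>h. flat p h / h) \<longlongrightarrow> 0) (at_left 0)"
      by (rule tendsto_eventually) (auto simp: eventually_at_filter flat_def)
    moreover have "((\<lambda>h. flat p h / h) \<longlongrightarrow> 0) (at_right 0)"
      unfolding filterlim_at_right_to_top
    proof (rule Lim_transform_eventually[OF poly_div_exp_tendsto_0[of "pCons 0 p"]])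
      show "\<forall>\<^sub>F x in at_top. poly (pCons 0 p) x / exp x = flat p (inverse x) / inverse x"
        using eventually_gt_at_top[of 0]
        by eventually_elim (simp add: flat_def field_simps exp_minus)
    qed
    ultimately have "((\<lambda>h. flat p h / h) \<longlongrightarrow> 0) (at 0)" by (simp add: filterlim_at_split)
    then show ?thesis using 3 by (simp add: has_field_derivative_iff flat_def)
  qed
qed

lemma smooth_flat_affine: "smooth (\<lambda>x. complex_of_real (flat p (inner x v + d)))"
proof (rule smooth_coinduct[where F = "{\<lambda>x. complex_of_real (flat p (inner x v + d)) * c | p c. True}"])
  have der: "((\<lambda>x. complex_of_real (flat p (inner x v + d)) * c) has_derivative
      (\<lambda>e. complex_of_real (flat (pCons 0 (pCons 0 (p - pderiv p))) (inner x v + d) * inner e v) * c)) (at x)"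
    for p c x
  proof -
    have "((\<lambda>x. flat p (inner x v + d)) has_derivative
        (\<lambda>e. flat (pCons 0 (pCons 0 (p - pderiv p))) (inner x v + d) * inner e v)) (at x)"
      by (rule has_derivative_compose[OF _ flat_has_derivative[unfolded has_field_derivative_def]])
        (auto intro!: derivative_eq_intros)
    then show ?thesis by (intro has_derivative_mult_left has_derivative_of_real)
  qed
  show "(\<lambda>x. complex_of_real (flat p (inner x v + d)))
      \<in> {\<lambda>x. complex_of_real (flat p (inner x v + d)) * c | p c. True}"
    by (rule CollectI, rule exI[of _ p], rule exI[of _ 1]) simp
  fix g and x assume "g \<in> {\<lambda>x. complex_of_real (flat p (inner x v + d)) * c | p c. True}"
  then obtain p c where g: "g = (\<lambda>x. complex_of_real (flat p (inner x v + d)) * c)" by blast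
  show "g differentiable (at x)" unfolding g differentiable_def using der by blast
  fix e :: point
  have "pdiff e g = (\<lambda>x. complex_of_real (flat (pCons 0 (pCons 0 (p - pderiv p))) (inner x v + d))
      * (complex_of_real (inner e v) * c))"
    unfolding g by (rule ext) (simp add: pdiff_eqI[OF der])
  then show "pdiff e g \<in> {\<lambda>x. complex_of_real (flat p (inner x v + d)) * c | p c. True}" by blast
qed

lemma test_smooth: "\<phi> \<in> test_functions \<Longrightarrow> smooth \<phi>"
  by (simp add: test_functions_def)

lemma test_functionI:
  assumes "smooth \<phi>" "compact S" "S \<subseteq> D" "\<And>x. \<phi> x \<noteq> 0 \<Longrightarrow> x \<in> S"
  shows "\<phi> \<in> test_functions"
proof -
  have "closure {x. \<phi> x \<noteq> 0} \<subseteq> S"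
    using assms(2,4) by (intro closure_minimal compact_imp_closed) auto
  moreover have "compact (closure {x. \<phi> x \<noteq> 0})"
    using assms(2) calculation by (metis closed_closure closed_Int_compact inf.absorb_iff2 inf_commute)
  ultimately show ?thesis using assms by (auto simp: test_functions_def)
qed

lemma test_function_support:
  assumes "\<phi> \<in> test_functions"
  shows "\<exists>S. compact S \<and> S \<subseteq> D \<and> (\<forall>x. x \<notin> S \<longrightarrow> \<phi> x = 0)"
proof (intro exI conjI)
  show "\<forall>x. x \<notin> closure {x. \<phi> x \<noteq> 0} \<longrightarrow> \<phi> x = 0"
    using closure_subset[of "{x. \<phi> x \<noteq> 0}"] by blast
qed (use assms in \<open>simp_all add: test_functions_def\<close>)

lemma test_zero_outside: "\<phi> \<in> test_functions \<Longrightarrow> x \<notin> D \<Longrightarrow> \<phi> x = 0"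
  using test_function_support[of \<phi>] by blast

lemma test_add:
  assumes "\<phi> \<in> test_functions" "\<psi> \<in> test_functions"
  shows "(\<lambda>x. \<phi> x + \<psi> x) \<in> test_functions"
proof -
  obtain S where S: "compact S" "S \<subseteq> D" "\<And>x. x \<notin> S \<Longrightarrow> \<phi> x = 0"
    using test_function_support[OF assms(1)] by blast
  obtain T where T: "compact T" "T \<subseteq> D" "\<And>x. x \<notin> T \<Longrightarrow> \<psi> x = 0"
    using test_function_support[OF assms(2)] by blast
  show ?thesis
  proof (rule test_functionI[of _ "S \<union> T"])
    show "smooth (\<lambda>x. \<phi> x + \<psi> x)" by (rule smooth_add[OF assms[THEN test_smooth]])
    show "compact (S \<union> T)" "S \<union> T \<subseteq> D" using S(1,2) T(1,2) by (simp_all add: compact_Un)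
    show "x \<in> S \<union> T" if "\<phi> x + \<psi> x \<noteq> 0" for x
      using that S(3)[of x] T(3)[of x] by (metis UnCI add.right_neutral)
  qed
qed

lemma test_bounded_linear:
  assumes "bounded_linear h" "\<phi> \<in> test_functions"
  shows "(\<lambda>x. h (\<phi> x)) \<in> test_functions"
proof -
  obtain S where S: "compact S" "S \<subseteq> D" "\<And>x. x \<notin> S \<Longrightarrow> \<phi> x = 0"
    using test_function_support[OF assms(2)] by blast
  interpret bounded_linear h by fact
  show ?thesis
  proof (rule test_functionI[of _ S])
    show "smooth (\<lambda>x. h (\<phi> x))" by (rule smooth_bounded_linear[OF assms(1) test_smooth[OF assms(2)]])
    show "x \<in> S" if "h (\<phi> x) \<noteq> 0" for x using that S(3)[of x] zero by metis
  qed (rule S)+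
qed

lemma test_scale: "\<phi> \<in> test_functions \<Longrightarrow> (\<lambda>x. c * \<phi> x) \<in> test_functions"
  by (rule test_bounded_linear[OF bounded_linear_mult_right])

lemma test_cnj: "\<phi> \<in> test_functions \<Longrightarrow> (\<lambda>x. cnj (\<phi> x)) \<in> test_functions"
  by (rule test_bounded_linear[OF bounded_linear_cnj])

lemma test_pdiff:
  assumes "\<phi> \<in> test_functions" "e \<in> Basis"
  shows "pdiff e \<phi> \<in> test_functions"
proof -
  obtain S where S: "compact S" "S \<subseteq> D" "\<And>x. x \<notin> S \<Longrightarrow> \<phi> x = 0"
    using test_function_support[OF assms(1)] by blast
  have zero: "pdiff e \<phi> x = 0" if "x \<notin> S" for x
  proof -
    have "((\<lambda>_. 0) has_derivative (\<lambda>_. 0)) (at x)" by (rule has_derivative_const)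
    then have "(\<phi> has_derivative (\<lambda>_. 0)) (at x)"
      by (rule has_derivative_transform_within_open[where s = "- S"])
        (use S(1) S(3)[symmetric] that in \<open>simp_all add: compact_imp_closed open_Compl\<close>)
    then show ?thesis by (rule pdiff_eqI)
  qed
  show ?thesis
    by (rule test_functionI[OF smooth_pdiff[OF test_smooth[OF assms(1)] assms(2)] S(1,2)])
      (use zero in blast)
qed

lemma test_bounded:
  assumes "\<phi> \<in> test_functions"
  shows "\<exists>K. \<forall>x. cmod (\<phi> x) \<le> K"
proof -
  obtain S where S: "compact S" "S \<subseteq> D" "\<And>x. x \<notin> S \<Longrightarrow> \<phi> x = 0"
    using test_function_support[OF assms] by blast
  have "bounded (\<phi> ` S)"
    by (rule compact_imp_bounded[OF compact_continuous_image[OF smooth_continuous[OF test_smooth[OF assms]] S(1)]])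
  then obtain K where "\<And>x. x \<in> S \<Longrightarrow> cmod (\<phi> x) \<le> K" by (auto simp: bounded_iff)
  then have "cmod (\<phi> x) \<le> max K 0" for x using S(3)[of x] by (metis le_max_iff_disj norm_zero order_refl)
  then show ?thesis by blast
qed

lemma smooth_measurable: "smooth \<phi> \<Longrightarrow> \<phi> \<in> borel_measurable leb_D"
  by (intro measurable_restrict_space1)
    (simp add: borel_measurable_continuous_onI smooth_continuous)

lemma test_L2: "\<phi> \<in> test_functions \<Longrightarrow> \<phi> \<in> L2"
  using test_bounded[of \<phi>] L2_of_bounded[of \<phi>] smooth_measurable[OF test_smooth, of \<phi>] by blast

text \<open>The one-dimensional factors \<open>exp (-1/(n s - 1))\<close>, where \<open>s\<close> is the distance to a face of the box,
  vanish for \<open>s \<le> 1/n\<close>, stay below \<open>1\<close>, and tend to \<open>1\<close> for every \<open>s > 0\<close>. So the cut-offs are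
  test functions that converge boundedly to the indicator of the open box.\<close>

definition cutoff :: "point \<Rightarrow> point \<Rightarrow> nat \<Rightarrow> field" where
  "cutoff a b n x =
     (\<Prod>e\<in>Basis. complex_of_real (flat 1 (inner x (real n *\<^sub>R e) + (- real n * inner a e - 1)))
       * complex_of_real (flat 1 (inner x (- real n *\<^sub>R e) + (real n * inner b e - 1))))"

lemma cutoff_bounded: "cmod (cutoff a b n x) \<le> 1"
proof -
  have "\<bar>flat 1 t\<bar> \<le> 1" for t by (simp add: flat_def)
  then show ?thesis
    unfolding cutoff_def prod_norm[symmetric] norm_mult norm_of_real
    by (intro prod_le_1) (auto intro!: mult_le_one)
qed

lemma cutoff_eq_0:
  assumes "x \<notin> cbox (a + (1 / real n) *\<^sub>R One) (b - (1 / real n) *\<^sub>R One)" "n > 0"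
  shows "cutoff a b n x = 0"
proof -
  obtain e where e: "e \<in> Basis"
    "inner x e < inner a e + 1 / real n \<or> inner x e > inner b e - 1 / real n"
    using assms(1) by (force simp: mem_box inner_simps)
  have "flat 1 (inner x (real n *\<^sub>R e) + (- real n * inner a e - 1)) = 0
      \<or> flat 1 (inner x (- real n *\<^sub>R e) + (real n * inner b e - 1)) = 0"
    using e(2) assms(2) by (auto simp: flat_def field_simps)
  then show ?thesis unfolding cutoff_def using e(1) by (intro prod_zero) auto
qed

lemma shrunk_cbox_subset:
  fixes a b :: point
  assumes "n > 0"
  shows "cbox (a + (1 / real n) *\<^sub>R One) (b - (1 / real n) *\<^sub>R One) \<subseteq> box a b"
proof
  fix x assume x: "x \<in> cbox (a + (1 / real n) *\<^sub>R One) (b - (1 / real n) *\<^sub>R One)"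
  have "inner a e < inner x e \<and> inner x e < inner b e" if e: "e \<in> Basis" for e
  proof -
    have "inner (a + (1 / real n) *\<^sub>R One) e \<le> inner x e" "inner x e \<le> inner (b - (1 / real n) *\<^sub>R One) e"
      using x e unfolding mem_box by blast+
    then have "inner a e + 1 / real n \<le> inner x e" "inner x e \<le> inner b e - 1 / real n"
      using e by (simp_all add: inner_add_left inner_diff_left)
    moreover have "0 < 1 / real n" using assms by simp
    ultimately show ?thesis by linarith
  qed
  then show "x \<in> box a b" unfolding mem_box by blast
qed

lemma cutoff_test:
  assumes "box a b \<subseteq> D" "n > 0"
  shows "cutoff a b n \<in> test_functions"
proof (rule test_functionI)
  show "smooth (cutoff a b n)"
    unfolding cutoff_def[abs_def] by (intro smooth_prod smooth_mult smooth_flat_affine finite_Basis)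
  show "cbox (a + (1 / real n) *\<^sub>R One) (b - (1 / real n) *\<^sub>R One) \<subseteq> D"
    using shrunk_cbox_subset[OF assms(2)] assms(1) by blast
  show "x \<in> cbox (a + (1 / real n) *\<^sub>R One) (b - (1 / real n) *\<^sub>R One)" if "cutoff a b n x \<noteq> 0" for x
    using cutoff_eq_0[of x a n b] that assms(2) by blast
qed (rule compact_cbox)

lemma flat_limit:
  assumes "t > 0"
  shows "(\<lambda>n. flat 1 (real n * t - 1)) \<longlonglongrightarrow> 1"
proof -
  have lin: "filterlim (\<lambda>n. real n * t - 1) at_top sequentially"
    using assms by real_asymp
  have "(\<lambda>n. exp (- 1 / (real n * t - 1))) \<longlonglongrightarrow> exp (- 0)"
    using tendsto_exp[OF tendsto_divide_0[OF tendsto_const filterlim_at_top_imp_at_infinity[OF lin]], of "-1"]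
    by simp
  moreover have "\<forall>\<^sub>F n in sequentially. exp (- 1 / (real n * t - 1)) = flat 1 (real n * t - 1)"
    using filterlim_at_top_dense[THEN iffD1, OF lin, rule_format, of 0]
    by eventually_elim (simp add: flat_def)
  ultimately show ?thesis by (simp add: Lim_transform_eventually)
qed

lemma cutoff_tendsto: "(\<lambda>n. cutoff a b n x) \<longlonglongrightarrow> (if x \<in> box a b then 1 else 0)"
proof (cases "x \<in> box a b")
  case True
  have "(\<lambda>n. cutoff a b n x) \<longlonglongrightarrow> (\<Prod>e\<in>(Basis :: point set). complex_of_real 1 * complex_of_real 1)"
    unfolding cutoff_def
  proof (intro tendsto_intros)
    fix e :: point assume "e \<in> Basis"
    then have e: "inner (x - a) e > 0" "inner (b - x) e > 0"
      using True by (auto simp: mem_box inner_simps)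
    show "(\<lambda>n. flat 1 (inner x (real n *\<^sub>R e) + (- real n * inner a e - 1))) \<longlonglongrightarrow> 1"
      using flat_limit[OF e(1)] by (simp add: inner_simps algebra_simps)
    show "(\<lambda>n. flat 1 (inner x (- real n *\<^sub>R e) + (real n * inner b e - 1))) \<longlonglongrightarrow> 1"
      using flat_limit[OF e(2)] by (simp add: inner_simps algebra_simps)
  qed
  then show ?thesis using True by simp
next
  case False
  have "\<forall>\<^sub>F n in sequentially. cutoff a b n x = 0"
    using eventually_gt_at_top[of 0]
  proof eventually_elim
    case (elim n)
    then have "x \<notin> cbox (a + (1 / real n) *\<^sub>R One) (b - (1 / real n) *\<^sub>R One)"
      using shrunk_cbox_subset[OF elim] False by blast
    then show ?case using elim by (rule cutoff_eq_0)
  qed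
  then show ?thesis using False by (simp add: tendsto_eventually)
qed

section \<open>Weak derivatives\<close>

text \<open>The positive and the negative part of \<open>f\<close> are densities of finite measures that agree on boxes,
  which form an intersection-stable generator of the Borel sets.\<close>

lemma boxes_integral_zero_imp_AE_zero:
  fixes f :: "'a::euclidean_space \<Rightarrow> real"
  assumes f: "integrable lborel f"
    and zero: "\<And>a b. (\<integral>x. indicator (box a b) x *\<^sub>R f x \<partial>lborel) = 0"
  shows "AE x in lborel. f x = 0"
proof -
  have [measurable]: "f \<in> borel_measurable lborel" using f by auto
  define p where "p x = ennreal (f x)" for x
  define n where "n x = ennreal (- f x)" for x
  have [measurable]: "p \<in> borel_measurable lborel" "n \<in> borel_measurable lborel"
    unfolding p_def n_def by measurable
  have fin: "(\<integral>\<^sup>+x. p x \<partial>lborel) \<noteq> \<infinity>"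
    using f unfolding p_def real_integrable_def by simp
  have "density lborel p = density lborel n"
  proof (rule measure_eqI_generator_eq)
    let ?E = "range (\<lambda>(a, b). box a b :: 'a set)"
    show "Int_stable ?E" by (auto simp: Int_stable_def box_Int_box)
    show "?E \<subseteq> Pow UNIV" "sets (density lborel p) = sigma_sets UNIV ?E"
      "sets (density lborel n) = sigma_sets UNIV ?E"
      by (simp_all add: borel_eq_box)
    let ?A = "\<lambda>n::nat. box (- (real n *\<^sub>R One)) (real n *\<^sub>R One) :: 'a set"
    show "range ?A \<subseteq> ?E" "(\<Union>i. ?A i) = UNIV"
      unfolding UN_box_eq_UNIV by auto
    show "emeasure (density lborel p) (?A i) \<noteq> \<infinity>" for i
    proof -
      have "emeasure (density lborel p) (?A i) \<le> (\<integral>\<^sup>+x. p x \<partial>lborel)"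
        by (simp add: emeasure_density) (intro nn_integral_mono, simp split: split_indicator)
      then show ?thesis using fin by (metis infinity_ennreal_def neq_top_trans)
    qed
    show "emeasure (density lborel p) X = emeasure (density lborel n) X" if "X \<in> ?E" for X
    proof -
      obtain a b where X: "X = box a b" using \<open>X \<in> ?E\<close> by auto
      have [measurable]: "X \<in> sets lborel" by (simp add: X)
      define h where "h x = indicator X x * f x" for x
      have h: "integrable lborel h"
        unfolding h_def using integrable_mult_indicator[OF \<open>X \<in> sets lborel\<close> f] by simp
      have "(\<integral>x. h x \<partial>lborel) = 0" using zero[of a b] by (simp add: h_def X)
      then have "enn2real (\<integral>\<^sup>+x. ennreal (h x) \<partial>lborel) = enn2real (\<integral>\<^sup>+x. ennreal (- h x) \<partial>lborel)"
        using real_lebesgue_integral_def[OF h] by simp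
      then have "(\<integral>\<^sup>+x. ennreal (h x) \<partial>lborel) = (\<integral>\<^sup>+x. ennreal (- h x) \<partial>lborel)"
        using h unfolding real_integrable_def
        by (metis ennreal_enn2real infinity_ennreal_def top.not_eq_extremum)
      moreover have "ennreal (h x) = p x * indicator X x" "ennreal (- h x) = n x * indicator X x" for x
        by (simp_all add: h_def p_def n_def split: split_indicator)
      ultimately show ?thesis
        by (simp add: emeasure_density[OF _ \<open>X \<in> sets lborel\<close>])
    qed
  qed
  then have "AE x in lborel. p x = n x"
    by (rule iffD1[OF finite_density_unique, rotated -1]) (use fin in auto)
  then show ?thesis
  proof eventually_elim
    case (elim x)
    then show ?case unfolding p_def n_def
      by (cases "f x \<ge> 0") (simp_all add: ennreal_neg)
  qed
qed

lemma integral_leb_D: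
  fixes f :: "point \<Rightarrow> 'b::{banach, second_countable_topology}"
  shows "(\<integral>x. f x \<partial>leb_D) = (\<integral>x. indicator D x *\<^sub>R f x \<partial>lborel)"
  by (rule integral_restrict_space) simp

lemma integrable_leb_D:
  fixes f :: "point \<Rightarrow> 'b::{banach, second_countable_topology}"
  shows "integrable leb_D f \<longleftrightarrow> integrable lborel (\<lambda>x. indicator D x *\<^sub>R f x)"
  by (rule integrable_restrict_space) simp

lemma box_Int_D: "\<exists>a' b'. box a b \<inter> D = box a' b'"
  unfolding D_eq_box box_Int_box by blast

text \<open>Testing with cut-offs gives, by dominated convergence, integral zero over every box.\<close>

lemma fundamental_lemma:
  assumes u: "u \<in> L2" and zero: "\<And>\<phi>. \<phi> \<in> test_functions \<Longrightarrow> (\<integral>x. u x * \<phi> x \<partial>leb_D) = 0"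
  shows "ae_eq u (\<lambda>_. 0)"
proof -
  note [measurable] = L2D(1)[OF u]
  have int: "integrable leb_D u" by (rule L2_integrable[OF u])
  have inD: "(\<integral>x. u x * (if x \<in> box a b then 1 else 0) \<partial>leb_D) = 0" if sub: "box a b \<subseteq> D" for a b
  proof (rule LIMSEQ_unique)
    show "(\<lambda>n. \<integral>x. u x * cutoff a b (Suc n) x \<partial>leb_D)
        \<longlonglongrightarrow> (\<integral>x. u x * (if x \<in> box a b then 1 else 0) \<partial>leb_D)"
    proof (rule integral_dominated_convergence[where w = "\<lambda>x. cmod (u x)"])
      show "AE x in leb_D. (\<lambda>n. u x * cutoff a b (Suc n) x) \<longlonglongrightarrow> u x * (if x \<in> box a b then 1 else 0)"
        by (intro AE_I2 tendsto_mult tendsto_const LIMSEQ_Suc cutoff_tendsto)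
      show "AE x in leb_D. norm (u x * cutoff a b (Suc n) x) \<le> cmod (u x)" for n
        by (rule AE_I2) (simp add: norm_mult mult_left_le cutoff_bounded)
      show "(\<lambda>x. u x * cutoff a b (Suc n) x) \<in> borel_measurable leb_D" for n
        using smooth_measurable[OF test_smooth[OF cutoff_test[OF sub, of "Suc n"]]] by simp
      have "(\<lambda>x. if x \<in> box a b then 1 else 0 :: complex) \<in> borel_measurable leb_D"
        by (intro measurable_restrict_space1 measurable_If_set) auto
      then show "(\<lambda>x. u x * (if x \<in> box a b then 1 else 0)) \<in> borel_measurable leb_D" by measurable
      show "integrable leb_D (\<lambda>x. cmod (u x))" using int by simp
    qed
    show "(\<lambda>n. \<integral>x. u x * cutoff a b (Suc n) x \<partial>leb_D) \<longlonglongrightarrow> 0"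
      using zero[OF cutoff_test[OF sub]] by simp
  qed
  have box0: "(\<integral>x. indicator (box a b) x *\<^sub>R (indicator D x *\<^sub>R u x) \<partial>lborel) = 0" for a b
  proof -
    obtain a' b' where eq: "box a b \<inter> D = box a' b'" using box_Int_D by blast
    have "(\<integral>x. u x * (if x \<in> box a' b' then 1 else 0) \<partial>leb_D) = 0"
      by (rule inD) (use eq in blast)
    then have "(\<integral>x. indicator D x *\<^sub>R (u x * (if x \<in> box a b \<inter> D then 1 else 0)) \<partial>lborel) = 0"
      by (simp only: integral_leb_D eq)
    moreover have "indicator D x *\<^sub>R (u x * (if x \<in> box a b \<inter> D then 1 else 0))
        = indicator (box a b) x *\<^sub>R (indicator D x *\<^sub>R u x)" for x
      by (simp split: split_indicator)
    ultimately show ?thesis by simp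
  qed
  define v where "v x = indicator D x *\<^sub>R u x" for x
  have v: "integrable lborel v" using int unfolding v_def integrable_leb_D .
  have iv: "integrable lborel (\<lambda>x. indicator (box a b) x *\<^sub>R v x)" for a b
    by (rule integrable_mult_indicator[OF _ v]) simp
  have "AE x in lborel. Re (v x) = 0"
  proof (rule boxes_integral_zero_imp_AE_zero)
    show "integrable lborel (\<lambda>x. Re (v x))" using v by simp
    show "(\<integral>x. indicator (box a b) x *\<^sub>R Re (v x) \<partial>lborel) = 0" for a b
      using integral_Re[OF iv[of a b]] box0[of a b] by (simp add: v_def mult.assoc)
  qed
  moreover have "AE x in lborel. Im (v x) = 0"
  proof (rule boxes_integral_zero_imp_AE_zero)
    show "integrable lborel (\<lambda>x. Im (v x))" using v by simp
    show "(\<integral>x. indicator (box a b) x *\<^sub>R Im (v x) \<partial>lborel) = 0" for a b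
      using integral_Im[OF iv[of a b]] box0[of a b] by (simp add: v_def mult.assoc)
  qed
  ultimately have "AE x in lborel. x \<in> D \<longrightarrow> u x = 0"
    by eventually_elim (simp add: v_def complex_eq_iff indicator_def)
  then show ?thesis unfolding ae_eq_def by (simp add: AE_restrict_space_iff)
qed

lemma pdiff_linear: "smooth f \<Longrightarrow> linear (\<lambda>e. pdiff e f x)"
  by (rule has_derivative_linear[OF smooth_has_derivative])

lemma smooth_vector_derivative_fst:
  assumes "smooth f"
  shows "((\<lambda>s. f (s, y)) has_vector_derivative pdiff (1, 0) f (s, y)) (at s within T)"
proof -
  have "((\<lambda>s. (s, y)) has_derivative (\<lambda>h. (h, 0))) (at s within T)"
    by (rule has_derivative_Pair[OF has_derivative_ident has_derivative_const])
  from has_derivative_compose[OF this smooth_has_derivative[OF assms]]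
  have "((\<lambda>s. f (s, y)) has_derivative (\<lambda>h. pdiff (h, 0) f (s, y))) (at s within T)" .
  moreover have "(\<lambda>h. pdiff (h, 0) f (s, y)) = (\<lambda>h. h *\<^sub>R pdiff (1, 0) f (s, y))" (is "?lhs = ?rhs")
  proof
    fix h :: real
    from linear_scale[OF pdiff_linear[OF assms], of h "(1, 0)"]
    show "?lhs h = ?rhs h"
      by (simp only: scaleR_Pair real_scaleR_def mult_1_right mult_zero_right)
  qed
  ultimately show ?thesis unfolding has_vector_derivative_def by (simp only:)
qed

lemma smooth_vector_derivative_snd:
  assumes "smooth f"
  shows "((\<lambda>t. f (x, t)) has_vector_derivative pdiff (0, 1) f (x, t)) (at t within T)"
proof -
  have "((\<lambda>t. (x, t)) has_derivative (\<lambda>h. (0, h))) (at t within T)"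
    by (rule has_derivative_Pair[OF has_derivative_const has_derivative_ident])
  from has_derivative_compose[OF this smooth_has_derivative[OF assms]]
  have "((\<lambda>t. f (x, t)) has_derivative (\<lambda>h. pdiff (0, h) f (x, t))) (at t within T)" .
  moreover have "(\<lambda>h. pdiff (0, h) f (x, t)) = (\<lambda>h. h *\<^sub>R pdiff (0, 1) f (x, t))" (is "?lhs = ?rhs")
  proof
    fix h :: real
    from linear_scale[OF pdiff_linear[OF assms], of h "(0, 1)"]
    show "?lhs h = ?rhs h"
      by (simp only: scaleR_Pair real_scaleR_def mult_1_right mult_zero_right)
  qed
  ultimately show ?thesis unfolding has_vector_derivative_def by (simp only:)
qed

lemma integral_leb_D_continuous:
  fixes f :: "point \<Rightarrow> 'b::euclidean_space"
  assumes "continuous_on UNIV f"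
  shows "(\<integral>x. f x \<partial>leb_D) = integral (cbox (-1) 1) (\<lambda>x. integral (cbox (-1) 1) (\<lambda>y. f (x, y)))"
proof -
  have c: "continuous_on S f" for S using assms by (rule continuous_on_subset) simp
  have "integrable lborel (\<lambda>x. indicator (cbox (-1, -1) (1, 1)) x *\<^sub>R f x)"
    by (rule borel_integrable_compact[OF compact_cbox c])
  then have "set_integrable lborel (cbox (-1, -1) (1, 1)) f" by (simp add: set_integrable_def)
  then have si: "set_integrable lborel D f"
    by (rule set_integrable_subset) (auto simp: D_eq_box box_subset_cbox)
  have "(\<integral>x. f x \<partial>leb_D) = integral D f"
    using set_borel_integral_eq_integral(2)[OF si] by (simp add: integral_leb_D set_lebesgue_integral_def)
  also have "\<dots> = integral (cbox (-1, -1) (1, 1)) f"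
    unfolding D_eq_box by (rule integral_open_interval)
  also have "\<dots> = integral (cbox (-1) 1) (\<lambda>x. integral (cbox (-1) 1) (\<lambda>y. f (x, y)))"
    by (rule integral_prod_continuous[OF c])
  finally show ?thesis .
qed

lemma Basis_point: "(Basis :: point set) = {(1, 0), (0, 1)}"
  by (auto simp: Basis_prod_def)

text \<open>Integrating first in the direction of the derivative leaves boundary values, which vanish.\<close>

lemma test_integral_pdiff_eq_0:
  assumes \<phi>: "\<phi> \<in> test_functions" and e: "e \<in> Basis"
  shows "(\<integral>x. pdiff e \<phi> x \<partial>leb_D) = 0"
proof -
  have s: "smooth \<phi>" by (rule test_smooth[OF \<phi>])
  have c: "continuous_on S (pdiff e \<phi>)" for S by (rule smooth_continuous[OF smooth_pdiff[OF s e]])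
  have out: "\<phi> (a, b) = 0" if "\<bar>a\<bar> = 1 \<or> \<bar>b\<bar> = 1" for a b
  proof (rule test_zero_outside[OF \<phi>])
    show "(a, b) \<notin> D" using that by (auto simp: D_def abs_if split: if_splits)
  qed
  consider "e = (1, 0)" | "e = (0, 1)" using e by (auto simp: Basis_point)
  then show ?thesis
  proof cases
    case 1
    have "integral (cbox (-1) 1) (\<lambda>x. integral (cbox (-1) 1) (\<lambda>y. pdiff e \<phi> (x, y)))
        = integral (cbox (-1) 1) (\<lambda>y. integral (cbox (-1) 1) (\<lambda>x. pdiff e \<phi> (x, y)))"
      by (rule integral_swap_continuous[where f = "\<lambda>x y. pdiff e \<phi> (x, y)"]) (simp add: c)
    also have "\<dots> = integral (cbox (-1) 1) (\<lambda>y::real. 0)"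
    proof (rule Henstock_Kurzweil_Integration.integral_cong)
      fix y :: real
      have "((\<lambda>x. pdiff e \<phi> (x, y)) has_integral \<phi> (1, y) - \<phi> (-1, y)) {-1..1}"
        unfolding 1 by (rule fundamental_theorem_of_calculus) (auto intro: smooth_vector_derivative_fst s)
      then show "integral (cbox (-1) 1) (\<lambda>x. pdiff e \<phi> (x, y)) = 0" by (simp add: out integral_unique)
    qed
    finally show ?thesis by (simp add: integral_leb_D_continuous[OF c])
  next
    case 2
    have "integral (cbox (-1) 1) (\<lambda>x. integral (cbox (-1) 1) (\<lambda>y. pdiff e \<phi> (x, y)))
        = integral (cbox (-1) 1) (\<lambda>x::real. 0)"
    proof (rule Henstock_Kurzweil_Integration.integral_cong)
      fix x :: real
      have "((\<lambda>y. pdiff e \<phi> (x, y)) has_integral \<phi> (x, 1) - \<phi> (x, -1)) {-1..1}"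
        unfolding 2 by (rule fundamental_theorem_of_calculus) (auto intro: smooth_vector_derivative_snd s)
      then show "integral (cbox (-1) 1) (\<lambda>y. pdiff e \<phi> (x, y)) = 0" by (simp add: out integral_unique)
    qed
    then show ?thesis by (simp add: integral_leb_D_continuous[OF c])
  qed
qed

lemma test_mult_smooth:
  assumes "\<phi> \<in> test_functions" "smooth f"
  shows "(\<lambda>x. f x * \<phi> x) \<in> test_functions"
proof -
  obtain S where S: "compact S" "S \<subseteq> D" "\<forall>x. x \<notin> S \<longrightarrow> \<phi> x = 0"
    using test_function_support[OF assms(1)] by blast
  show ?thesis
    by (rule test_functionI[OF smooth_mult[OF assms(2) test_smooth[OF assms(1)]] S(1,2)])
      (use S(3) in force)
qed

lemma test_has_weak_pdiff:
  assumes "\<phi> \<in> test_functions" "e \<in> Basis"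
  shows "has_weak_pdiff e \<phi> (pdiff e \<phi>)"
  unfolding has_weak_pdiff_def
proof (intro conjI ballI)
  show "pdiff e \<phi> \<in> L2" by (intro test_L2 test_pdiff assms)
  fix \<psi> assume \<psi>: "\<psi> \<in> test_functions"
  have "0 = (\<integral>x. pdiff e (\<lambda>x. \<phi> x * \<psi> x) x \<partial>leb_D)"
    using test_integral_pdiff_eq_0[OF test_mult_smooth[OF \<psi> test_smooth[OF assms(1)]] assms(2)] by simp
  also have "\<dots> = (\<integral>x. \<phi> x * pdiff e \<psi> x + pdiff e \<phi> x * \<psi> x \<partial>leb_D)"
    by (simp only: pdiff_mult[OF test_smooth[OF assms(1)] test_smooth[OF \<psi>]])
  also have "\<dots> = (\<integral>x. \<phi> x * pdiff e \<psi> x \<partial>leb_D) + (\<integral>x. pdiff e \<phi> x * \<psi> x \<partial>leb_D)"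
    by (intro Bochner_Integration.integral_add L2_mult_integrable test_L2 test_pdiff assms \<psi>)
  finally show "(\<integral>x. \<phi> x * pdiff e \<psi> x \<partial>leb_D) = - (\<integral>x. pdiff e \<phi> x * \<psi> x \<partial>leb_D)"
    by (simp add: eq_neg_iff_add_eq_0)
qed

text \<open>Weak differentiability on the level of classes. Real parts suffice, since test functions may be
  multiplied by \<open>\<i>\<close>; in this form the relation is visibly closed.\<close>

definition weakly_diff :: "point \<Rightarrow> l2 \<Rightarrow> l2 \<Rightarrow> bool" where
  "weakly_diff e u g \<longleftrightarrow> (\<forall>\<phi>\<in>test_functions. inner u (cls (pdiff e \<phi>)) = - inner g (cls \<phi>))"

lemma pdiff_scale: "smooth f \<Longrightarrow> pdiff e (\<lambda>x. c * f x) = (\<lambda>x. c * pdiff e f x)"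
  by (rule pdiff_bounded_linear[OF bounded_linear_mult_right])

lemma pdiff_cnj: "smooth f \<Longrightarrow> pdiff e (\<lambda>x. cnj (f x)) = (\<lambda>x. cnj (pdiff e f x))"
  by (rule pdiff_bounded_linear[OF bounded_linear_cnj])

lemma has_weak_pdiff_iff:
  assumes u: "u \<in> L2" and g: "g \<in> L2" and e: "e \<in> Basis"
  shows "has_weak_pdiff e u g \<longleftrightarrow> weakly_diff e (cls u) (cls g)"
proof -
  have inner_u: "inner (cls u) (cls (pdiff e (\<lambda>x. cnj (c * \<phi> x)))) = Re (c * (\<integral>x. u x * pdiff e \<phi> x \<partial>leb_D))"
    and inner_g: "inner (cls g) (cls (\<lambda>x. cnj (c * \<phi> x))) = Re (c * (\<integral>x. g x * \<phi> x \<partial>leb_D))"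
    if \<phi>: "\<phi> \<in> test_functions" for c \<phi>
  proof -
    have s: "smooth \<phi>" "smooth (\<lambda>x. c * \<phi> x)" using test_smooth \<phi> test_scale by blast+
    have t: "(\<lambda>x. cnj (c * \<phi> x)) \<in> test_functions" using test_cnj[OF test_scale[OF \<phi>]] .
    have "pdiff e (\<lambda>x. cnj (c * \<phi> x)) = (\<lambda>x. cnj (c * pdiff e \<phi> x))"
      unfolding pdiff_cnj[OF s(2)] pdiff_scale[OF s(1)] ..
    moreover have "pdiff e (\<lambda>x. cnj (c * \<phi> x)) \<in> L2" by (intro test_L2 test_pdiff t e)
    ultimately have "inner (cls u) (cls (pdiff e (\<lambda>x. cnj (c * \<phi> x))))
        = Re (\<integral>x. c * (u x * pdiff e \<phi> x) \<partial>leb_D)"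
      by (simp add: inner_cls[OF u] mult.left_commute)
    then show "inner (cls u) (cls (pdiff e (\<lambda>x. cnj (c * \<phi> x)))) = Re (c * (\<integral>x. u x * pdiff e \<phi> x \<partial>leb_D))"
      by (simp only: integral_mult_right_zero)
    have "inner (cls g) (cls (\<lambda>x. cnj (c * \<phi> x))) = Re (\<integral>x. c * (g x * \<phi> x) \<partial>leb_D)"
      using test_L2[OF t] by (simp add: inner_cls[OF g] mult.left_commute)
    then show "inner (cls g) (cls (\<lambda>x. cnj (c * \<phi> x))) = Re (c * (\<integral>x. g x * \<phi> x \<partial>leb_D))"
      by (simp only: integral_mult_right_zero)
  qed
  show ?thesis
  proof
    assume w: "has_weak_pdiff e u g"
    show "weakly_diff e (cls u) (cls g)"
      unfolding weakly_diff_def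
    proof
      fix \<phi> assume \<phi>: "\<phi> \<in> test_functions"
      from inner_u[OF test_cnj[OF this], of 1] inner_g[OF test_cnj[OF this], of 1]
      show "inner (cls u) (cls (pdiff e \<phi>)) = - inner (cls g) (cls \<phi>)"
        using w test_cnj[OF \<phi>] unfolding has_weak_pdiff_def by simp
    qed
  next
    assume w: "weakly_diff e (cls u) (cls g)"
    show "has_weak_pdiff e u g"
      unfolding has_weak_pdiff_def
    proof (intro conjI ballI g)
      fix \<phi> assume \<phi>: "\<phi> \<in> test_functions"
      have "Re (c * (\<integral>x. u x * pdiff e \<phi> x \<partial>leb_D)) = - Re (c * (\<integral>x. g x * \<phi> x \<partial>leb_D))" for c
        using w test_cnj[OF test_scale[OF \<phi>], of c] inner_u[OF \<phi>, of c] inner_g[OF \<phi>, of c]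
        unfolding weakly_diff_def by metis
      from this[of 1] this[of \<i>]
      show "(\<integral>x. u x * pdiff e \<phi> x \<partial>leb_D) = - (\<integral>x. g x * \<phi> x \<partial>leb_D)"
        by (simp add: complex_eq_iff)
    qed
  qed
qed

lemma test_functions_total:
  assumes "\<And>\<phi>. \<phi> \<in> test_functions \<Longrightarrow> inner g (cls \<phi>) = 0"
  shows "g = 0"
proof -
  obtain f where f: "f \<in> L2" "g = cls f" using cls_surj by blast
  have "(\<integral>x. f x * \<phi> x \<partial>leb_D) = 0" if \<phi>: "\<phi> \<in> test_functions" for \<phi>
  proof -
    have "inner (cls f) (cls (\<lambda>x. cnj (\<phi> x))) = Re (\<integral>x. f x * \<phi> x \<partial>leb_D)"
      using inner_cls[OF f(1) test_L2[OF test_cnj[OF \<phi>]]] by simp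
    moreover have "inner (cls f) (cls (\<lambda>x. \<i> * cnj (\<phi> x))) = Im (\<integral>x. f x * \<phi> x \<partial>leb_D)"
      using inner_l2_scale_i[OF f(1) test_L2[OF test_cnj[OF \<phi>]]]
        l2_scale_cls[OF test_L2[OF test_cnj[OF \<phi>]], of \<i>] by simp
    ultimately show ?thesis
      using assms[OF test_cnj[OF \<phi>]] assms[OF test_scale[OF test_cnj[OF \<phi>], of \<i>]] f(2)
      by (simp add: complex_eq_iff)
  qed
  then have "ae_eq f (\<lambda>_. 0)" by (rule fundamental_lemma[OF f(1)])
  then show ?thesis using cls_eq_iff[OF f(1) L2_zero] f(2) by (simp add: cls_zero)
qed

lemma weakly_diff_unique:
  assumes "weakly_diff e u g" "weakly_diff e u g'"
  shows "g = g'"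
proof -
  have "g - g' = 0"
    by (rule test_functions_total) (use assms in \<open>simp add: weakly_diff_def inner_diff_left\<close>)
  then show ?thesis by simp
qed

lemma weakly_diff_add:
  "weakly_diff e u g \<Longrightarrow> weakly_diff e u' g' \<Longrightarrow> weakly_diff e (u + u') (g + g')"
  by (simp add: weakly_diff_def inner_add_left)

lemma H1_L2: "u \<in> H1 \<Longrightarrow> u \<in> L2"
  by (simp add: H1_def)

text \<open>The chosen representative \<^const>\<open>weak_pdiff\<close> is arbitrary, but its class is determined.\<close>

definition wgrad :: "point \<Rightarrow> field \<Rightarrow> l2" where
  "wgrad e u = cls (weak_pdiff e u)"

lemma weak_pdiff_works:
  assumes "u \<in> H1" "e \<in> Basis"
  shows "has_weak_pdiff e u (weak_pdiff e u)" "weak_pdiff e u \<in> L2" "weakly_diff e (cls u) (wgrad e u)"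
proof -
  have "\<exists>g. has_weak_pdiff e u g" using assms by (simp add: H1_def)
  then show 1: "has_weak_pdiff e u (weak_pdiff e u)" unfolding weak_pdiff_def by (rule someI_ex)
  then show 2: "weak_pdiff e u \<in> L2" by (simp add: has_weak_pdiff_def)
  show "weakly_diff e (cls u) (wgrad e u)"
    unfolding wgrad_def using has_weak_pdiff_iff[OF H1_L2[OF assms(1)] 2 assms(2)] 1 by blast
qed

lemma wgrad_eqI: "u \<in> H1 \<Longrightarrow> e \<in> Basis \<Longrightarrow> weakly_diff e (cls u) g \<Longrightarrow> wgrad e u = g"
  using weak_pdiff_works(3) weakly_diff_unique by blast

lemma H1I:
  assumes "u \<in> L2" "\<And>e. e \<in> Basis \<Longrightarrow> weakly_diff e (cls u) (g e)"
  shows "u \<in> H1"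
  unfolding H1_def
proof (intro CollectI conjI ballI assms(1))
  fix e :: point assume e: "e \<in> Basis"
  obtain f where f: "f \<in> L2" "g e = cls f" using cls_surj by blast
  have "weakly_diff e (cls u) (cls f)" using assms(2)[OF e] f(2) by simp
  then have "has_weak_pdiff e u f" using has_weak_pdiff_iff[OF assms(1) f(1) e] by blast
  then show "\<exists>g. has_weak_pdiff e u g" by blast
qed

lemma test_weakly_diff:
  "\<phi> \<in> test_functions \<Longrightarrow> e \<in> Basis \<Longrightarrow> weakly_diff e (cls \<phi>) (cls (pdiff e \<phi>))"
  using has_weak_pdiff_iff[OF test_L2 test_L2[OF test_pdiff]] test_has_weak_pdiff by blast

lemma test_H1: "\<phi> \<in> test_functions \<Longrightarrow> \<phi> \<in> H1"
  using H1I[OF test_L2 test_weakly_diff] by blast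

lemma wgrad_test: "\<phi> \<in> test_functions \<Longrightarrow> e \<in> Basis \<Longrightarrow> wgrad e \<phi> = cls (pdiff e \<phi>)"
  by (rule wgrad_eqI[OF test_H1 _ test_weakly_diff])

lemma weakly_diff_scale:
  assumes "weakly_diff e u g" "e \<in> Basis"
  shows "weakly_diff e (l2_scale c u) (l2_scale c g)"
proof -
  obtain u' where u': "u' \<in> L2" "u = cls u'" using cls_surj by blast
  obtain g' where g': "g' \<in> L2" "g = cls g'" using cls_surj by blast
  have "has_weak_pdiff e u' g'" using assms u' g' has_weak_pdiff_iff by blast
  then have "has_weak_pdiff e (\<lambda>x. c * u' x) (\<lambda>x. c * g' x)"
    unfolding has_weak_pdiff_def by (simp add: L2_scale mult.assoc)
  then show ?thesis
    using has_weak_pdiff_iff[OF L2_scale[OF u'(1)] L2_scale[OF g'(1)] assms(2)] u' g'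
    by (simp add: l2_scale_cls)
qed

lemma H1_add:
  assumes "u \<in> H1" "v \<in> H1"
  shows "(\<lambda>x. u x + v x) \<in> H1" "e \<in> Basis \<Longrightarrow> wgrad e (\<lambda>x. u x + v x) = wgrad e u + wgrad e v"
proof -
  have w: "weakly_diff e (cls (\<lambda>x. u x + v x)) (wgrad e u + wgrad e v)" if "e \<in> Basis" for e
    unfolding cls_add[OF assms[THEN H1_L2]]
    by (intro weakly_diff_add weak_pdiff_works(3) assms that)
  then show h: "(\<lambda>x. u x + v x) \<in> H1" by (rule H1I[OF L2_add[OF assms[THEN H1_L2]]])
  show "wgrad e (\<lambda>x. u x + v x) = wgrad e u + wgrad e v" if "e \<in> Basis"
    by (rule wgrad_eqI[OF h that w[OF that]])
qed

lemma H1_scale: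
  assumes "u \<in> H1"
  shows "(\<lambda>x. c * u x) \<in> H1" "e \<in> Basis \<Longrightarrow> wgrad e (\<lambda>x. c * u x) = l2_scale c (wgrad e u)"
proof -
  have w: "weakly_diff e (cls (\<lambda>x. c * u x)) (l2_scale c (wgrad e u))" if "e \<in> Basis" for e
    unfolding l2_scale_cls[OF H1_L2[OF assms], symmetric]
    by (intro weakly_diff_scale weak_pdiff_works(3) assms that)
  then show h: "(\<lambda>x. c * u x) \<in> H1" by (rule H1I[OF L2_scale[OF H1_L2[OF assms]]])
  show "wgrad e (\<lambda>x. c * u x) = l2_scale c (wgrad e u)" if "e \<in> Basis"
    by (rule wgrad_eqI[OF h that w[OF that]])
qed

type_synonym jet = "l2 \<times> l2 \<times> l2"

text \<open>The norm of the jet is the \<open>H\<^sup>1\<close> norm, so that questions of convergence in \<open>H\<^sup>1\<close> move to the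
  Hilbert space of triples.\<close>

definition jet :: "field \<Rightarrow> jet" where
  "jet u = (cls u, wgrad (1, 0) u, wgrad (0, 1) u)"

definition jet_scale :: "complex \<Rightarrow> jet \<Rightarrow> jet" where
  "jet_scale c = (\<lambda>(u, p, q). (l2_scale c u, l2_scale c p, l2_scale c q))"

lemma jet_add: "u \<in> H1 \<Longrightarrow> v \<in> H1 \<Longrightarrow> jet (\<lambda>x. u x + v x) = jet u + jet v"
  by (simp add: jet_def cls_add H1_L2 H1_add(2) Basis_point)

lemma jet_scale: "u \<in> H1 \<Longrightarrow> jet (\<lambda>x. c * u x) = jet_scale c (jet u)"
  by (simp add: jet_def jet_scale_def l2_scale_cls H1_L2 H1_scale(2) Basis_point)

lemma h1_norm_jet:
  assumes "u \<in> H1"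
  shows "h1_norm u = norm (jet u)"
proof -
  have "(\<integral>x. (cmod (weak_pdiff e u x))\<^sup>2 \<partial>leb_D) = (norm (wgrad e u))\<^sup>2" if "e \<in> Basis" for e
    unfolding wgrad_def by (rule norm_cls[OF weak_pdiff_works(2)[OF assms that], symmetric])
  then show ?thesis
    unfolding h1_norm_def norm_cls[OF H1_L2[OF assms], symmetric]
    by (simp add: Basis_point jet_def norm_Pair add.assoc)
qed

section \<open>Poincare inequalities on the square and on small cells\<close>

text \<open>The norm of \<open>g\<close> deviates from its mean by a function whose square has nonnegative integral.\<close>

lemma integral_norm_square_bound:
  fixes g :: "'a::euclidean_space \<Rightarrow> 'b::euclidean_space"
  assumes g: "continuous_on (cbox a b) g"
  shows "(norm (integral (cbox a b) g))\<^sup>2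
     \<le> measure lborel (cbox a b) * integral (cbox a b) (\<lambda>x. (norm (g x))\<^sup>2)"
proof (cases "measure lborel (cbox a b) = 0")
  case True
  then have "integral (cbox a b) g = 0" by (rule integral_null)
  then show ?thesis using True by simp
next
  case False
  define c where "c = measure lborel (cbox a b)"
  have c: "c > 0" using False by (simp add: c_def zero_less_measure_iff)
  define S where "S = integral (cbox a b) (\<lambda>x. norm (g x))"
  define Q where "Q = integral (cbox a b) (\<lambda>x. (norm (g x))\<^sup>2)"
  have i: "g integrable_on cbox a b" "(\<lambda>x. norm (g x)) integrable_on cbox a b"
    "(\<lambda>x. (norm (g x))\<^sup>2) integrable_on cbox a b"
    by (intro integrable_continuous continuous_intros g)+
  have "norm (integral (cbox a b) g) \<le> S"
    unfolding S_def by (rule integral_norm_bound_integral[OF i(1,2)]) simp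
  moreover have "S\<^sup>2 \<le> c * Q"
  proof -
    define m where "m = S / c"
    have "((\<lambda>x. (norm (g x))\<^sup>2 - 2 * m * norm (g x) + m\<^sup>2) has_integral (Q - 2 * m * S + c *\<^sub>R m\<^sup>2)) (cbox a b)"
      unfolding Q_def S_def c_def
      by (intro has_integral_add has_integral_diff has_integral_mult_right has_integral_const
          integrable_integral i)
    then have "0 \<le> Q - 2 * m * S + c *\<^sub>R m\<^sup>2"
    proof (rule has_integral_nonneg)
      fix x
      have "0 \<le> (norm (g x) - m)\<^sup>2" by simp
      then show "0 \<le> (norm (g x))\<^sup>2 - 2 * m * norm (g x) + m\<^sup>2" by (simp add: power2_diff algebra_simps)
    qed
    then show ?thesis using c by (simp add: m_def field_simps power2_eq_square)
  qed
  ultimately show ?thesis unfolding c_def[symmetric] Q_def[symmetric]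
    by (meson norm_ge_zero order_trans power_mono)
qed

lemma increment_square_bound:
  fixes F :: "real \<Rightarrow> 'b::euclidean_space"
  assumes F: "\<And>t. (F has_vector_derivative F' t) (at t within {a..b})" and c: "continuous_on {a..b} F'"
    and st: "s \<in> {a..b}" "t \<in> {a..b}"
  shows "(norm (F t - F s))\<^sup>2 \<le> (b - a) * integral (cbox a b) (\<lambda>r. (norm (F' r))\<^sup>2)"
proof -
  have *: "(norm (F t - F s))\<^sup>2 \<le> (b - a) * integral (cbox a b) (\<lambda>r. (norm (F' r))\<^sup>2)"
    if st: "a \<le> s" "s \<le> t" "t \<le> b" for s t
  proof -
    have sub: "{s..t} \<subseteq> {a..b}" using st by auto
    have "(F' has_integral F t - F s) {s..t}"
      using has_vector_derivative_within_subset[OF F sub]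
      by (intro fundamental_theorem_of_calculus) (use st in auto)
    then have "F t - F s = integral (cbox s t) F'" by (simp add: integral_unique)
    also have "(norm \<dots>)\<^sup>2 \<le> measure lborel (cbox s t) * integral (cbox s t) (\<lambda>r. (norm (F' r))\<^sup>2)"
      by (rule integral_norm_square_bound) (use continuous_on_subset[OF c sub] in simp)
    also have "\<dots> \<le> (b - a) * integral (cbox a b) (\<lambda>r. (norm (F' r))\<^sup>2)"
    proof (rule mult_mono)
      show "integral (cbox s t) (\<lambda>r. (norm (F' r))\<^sup>2) \<le> integral (cbox a b) (\<lambda>r. (norm (F' r))\<^sup>2)"
        unfolding cbox_interval
        by (intro integral_subset_le sub integrable_continuous_real continuous_intros
            continuous_on_subset[OF c]) auto
      show "0 \<le> integral (cbox s t) (\<lambda>r. (norm (F' r))\<^sup>2)"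
        by (rule integral_nonneg)
          (use continuous_on_subset[OF c sub] in \<open>auto intro!: integrable_continuous_real continuous_intros\<close>)
    qed (use st in auto)
    finally show ?thesis .
  qed
  show ?thesis
  proof (cases "s \<le> t")
    case True then show ?thesis using *[of s t] st by simp
  next
    case False then show ?thesis using *[of t s] st by (simp add: norm_minus_commute)
  qed
qed

lemma continuous_on_slices:
  fixes F :: "point \<Rightarrow> 'b::topological_space"
  assumes "continuous_on UNIV F"
  shows "continuous_on S (\<lambda>x. F (x, y))" "continuous_on S (\<lambda>y. F (x, y))"
  by (rule continuous_on_compose2[OF assms]; auto intro!: continuous_intros)+

lemma continuous_on_integral_fst:
  fixes F :: "point \<Rightarrow> 'b::banach"
  assumes "continuous_on UNIV F"
  shows "continuous_on S (\<lambda>x. integral (cbox c d) (\<lambda>y. F (x, y)))"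
proof -
  have "continuous_on (S \<times> cbox c d) (\<lambda>(x, y). F (x, y))"
    using continuous_on_subset[OF assms] by simp
  then show ?thesis by (rule integral_continuous_on_param)
qed

lemma continuous_on_integral_snd:
  fixes F :: "point \<Rightarrow> 'b::banach"
  assumes "continuous_on UNIV F"
  shows "continuous_on S (\<lambda>y. integral (cbox c d) (\<lambda>x. F (x, y)))"
proof -
  have "continuous_on (S \<times> cbox c d) (\<lambda>(y, x). F (x, y))"
    unfolding case_prod_beta
    by (rule continuous_on_compose2[OF assms]) (auto intro!: continuous_intros)
  then show ?thesis by (rule integral_continuous_on_param)
qed

definition rect_integral :: "real \<Rightarrow> real \<Rightarrow> real \<Rightarrow> real \<Rightarrow> (point \<Rightarrow> 'b::banach) \<Rightarrow> 'b" where
  "rect_integral a b c d F = integral (cbox a b) (\<lambda>x. integral (cbox c d) (\<lambda>y. F (x, y)))"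

lemma rect_integral_eq:
  "continuous_on UNIV F \<Longrightarrow> rect_integral a b c d F = integral (cbox (a, c) (b, d)) F"
  unfolding rect_integral_def
  by (rule integral_prod_continuous[symmetric]) (rule continuous_on_subset, auto)

lemma rect_integral_mono:
  fixes F G :: "point \<Rightarrow> real"
  assumes "continuous_on UNIV F" "continuous_on UNIV G"
    "\<And>x y. x \<in> {a..b} \<Longrightarrow> y \<in> {c..d} \<Longrightarrow> F (x, y) \<le> G (x, y)"
  shows "rect_integral a b c d F \<le> rect_integral a b c d G"
  unfolding assms(1,2)[THEN rect_integral_eq]
proof (rule integral_le)
  show "F integrable_on cbox (a, c) (b, d)" "G integrable_on cbox (a, c) (b, d)"
    by (intro integrable_continuous continuous_on_subset[OF assms(1)] continuous_on_subset[OF assms(2)]; simp)+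
  show "F p \<le> G p" if "p \<in> cbox (a, c) (b, d)" for p
    using that assms(3)[of "fst p" "snd p"] by (cases p) simp
qed

lemma rect_integral_of_snd:
  fixes A :: "real \<Rightarrow> real"
  assumes "a \<le> b"
  shows "rect_integral a b c d (\<lambda>p. A (snd p)) = (b - a) * integral (cbox c d) A"
  unfolding rect_integral_def using assms by simp

lemma rect_integral_of_fst:
  fixes A :: "real \<Rightarrow> real"
  assumes "c \<le> d"
  shows "rect_integral a b c d (\<lambda>p. A (fst p)) = (d - c) * integral (cbox a b) A"
  unfolding rect_integral_def using assms by simp

lemma rect_integral_swap:
  fixes F :: "point \<Rightarrow> 'b::banach"
  assumes "continuous_on UNIV F"
  shows "rect_integral a b c d F = integral (cbox c d) (\<lambda>y. integral (cbox a b) (\<lambda>x. F (x, y)))"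
  unfolding rect_integral_def
  by (rule integral_swap_continuous[where f = "\<lambda>x y. F (x, y)"])
    (use continuous_on_subset[OF assms] in simp)

lemma rect_integral_add:
  fixes F G :: "point \<Rightarrow> real"
  assumes "continuous_on UNIV F" "continuous_on UNIV G"
  shows "rect_integral a b c d (\<lambda>p. F p + G p) = rect_integral a b c d F + rect_integral a b c d G"
proof -
  have i: "F integrable_on cbox (a, c) (b, d)" "G integrable_on cbox (a, c) (b, d)"
    by (intro integrable_continuous continuous_on_subset[OF assms(1)] continuous_on_subset[OF assms(2)]; simp)+
  have c: "continuous_on UNIV (\<lambda>p. F p + G p)"
    by (intro continuous_intros assms)
  show ?thesis
    by (simp add: rect_integral_eq c assms Henstock_Kurzweil_Integration.integral_add i)
qed

lemma rect_integral_mult: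
  fixes F :: "point \<Rightarrow> real"
  shows "rect_integral a b c d (\<lambda>p. k * F p) = k * rect_integral a b c d F"
  unfolding rect_integral_def by simp

lemma rect_integral_const: "a \<le> b \<Longrightarrow> c \<le> d \<Longrightarrow> rect_integral a b c d (\<lambda>_. k) = (b - a) * (d - c) * (k::real)"
  unfolding rect_integral_def by simp

context
  fixes f :: field
  assumes f: "smooth f"
begin

abbreviation "dx2 \<equiv> \<lambda>p. (cmod (pdiff (1, 0) f p))\<^sup>2"
abbreviation "dy2 \<equiv> \<lambda>p. (cmod (pdiff (0, 1) f p))\<^sup>2"

lemma continuous_dx2: "continuous_on S dx2" and continuous_dy2: "continuous_on S dy2"
  by (intro continuous_intros smooth_continuous smooth_pdiff f; simp add: Basis_point)+

lemma increment_x: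
  assumes "x \<in> {a..b}" "x' \<in> {a..b}"
  shows "(cmod (f (x, y) - f (x', y)))\<^sup>2 \<le> (b - a) * integral (cbox a b) (\<lambda>s. dx2 (s, y))"
proof -
  have "continuous_on UNIV (pdiff (1, 0) f)"
    by (rule smooth_continuous[OF smooth_pdiff[OF f]]) (simp add: Basis_point)
  from increment_square_bound[OF smooth_vector_derivative_fst[OF f] continuous_on_slices(1)[OF this] assms(2,1)]
  show ?thesis .
qed

lemma increment_y:
  assumes "y \<in> {a..b}" "y' \<in> {a..b}"
  shows "(cmod (f (x, y) - f (x, y')))\<^sup>2 \<le> (b - a) * integral (cbox a b) (\<lambda>t. dy2 (x, t))"
proof -
  have "continuous_on UNIV (pdiff (0, 1) f)"
    by (rule smooth_continuous[OF smooth_pdiff[OF f]]) (simp add: Basis_point)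
  from increment_square_bound[OF smooth_vector_derivative_snd[OF f] continuous_on_slices(2)[OF this] assms(2,1)]
  show ?thesis .
qed

lemma square_sum_bound: "(cmod (u + v))\<^sup>2 \<le> 2 * (cmod u)\<^sup>2 + 2 * (cmod v)\<^sup>2"
proof -
  have "(cmod (u + v))\<^sup>2 \<le> (cmod u + cmod v)\<^sup>2" by (intro power_mono norm_triangle_ineq) auto
  also have "\<dots> \<le> 2 * (cmod u)\<^sup>2 + 2 * (cmod v)\<^sup>2"
    using sum_squares_bound[of "cmod u" "cmod v"] by (simp add: power2_sum)
  finally show ?thesis .
qed

text \<open>Going from \<open>q\<close> to \<open>p\<close> first horizontally at the height of \<open>p\<close> and then vertically bounds
  \<open>|f p - f q|\<^sup>2\<close> by line integrals, \<open>2 h A\<close> with \<open>A\<close> depending only on the height of \<open>p\<close> and \<open>2 h C\<close>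
  with \<open>C\<close> depending only on the abscissa of \<open>q\<close>. Integration over \<open>q\<close> compares \<open>h\<^sup>2 f p\<close> with the
  integral of \<open>f\<close>, and integration over \<open>p\<close> turns the line integrals into integrals over the cell.\<close>

lemma cell_estimate:
  assumes h: "h > 0"
  shows "rect_integral a (a + h) b (b + h) (\<lambda>p. (cmod (f p))\<^sup>2)
    \<le> 2 / h\<^sup>2 * (cmod (rect_integral a (a + h) b (b + h) f))\<^sup>2
      + 4 * h\<^sup>2 * (rect_integral a (a + h) b (b + h) dx2 + rect_integral a (a + h) b (b + h) dy2)"
proof -
  let ?R = "\<lambda>F. rect_integral a (a + h) b (b + h) F"
  define A where "A y = integral (cbox a (a + h)) (\<lambda>s. dx2 (s, y))" for y
  define C where "C x = integral (cbox b (b + h)) (\<lambda>t. dy2 (x, t))" for x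
  define g1 where "g1 = ?R dx2"
  define g2 where "g2 = ?R dy2"
  define c where "c = rect_integral a (a + h) b (b + h) f"
  have cf: "continuous_on S f" for S by (rule smooth_continuous[OF f])
  have cA: "continuous_on S A" for S
    unfolding A_def by (rule continuous_on_integral_snd[OF continuous_dx2])
  have cC: "continuous_on S C" for S
    unfolding C_def by (rule continuous_on_integral_fst[OF continuous_dy2])
  have cAs: "continuous_on S (\<lambda>p. A (snd p))" and cCf: "continuous_on S (\<lambda>p. C (fst p))" for S :: "point set"
    by (rule continuous_on_compose2[OF cA[of UNIV]] continuous_on_compose2[OF cC[of UNIV]];
        auto intro!: continuous_intros)+
  have G1: "integral (cbox b (b + h)) A = g1"
    unfolding rect_integral_swap[OF continuous_dx2] A_def g1_def ..
  have G2: "integral (cbox a (a + h)) C = g2"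
    unfolding rect_integral_def C_def g2_def ..
  have point: "h ^ 4 * (cmod (f p))\<^sup>2 \<le> 2 * (cmod c)\<^sup>2 + 2 * h\<^sup>2 * (2 * h ^ 3 * A (snd p) + 2 * h\<^sup>2 * g2)"
    if p: "fst p \<in> {a..a + h}" "snd p \<in> {b..b + h}" for p
  proof -
    let ?g = "\<lambda>q. f p - f q"
    have g: "continuous_on S ?g" for S by (intro continuous_intros cf)
    have gi: "?g integrable_on cbox (a, b) (a + h, b + h)" "f integrable_on cbox (a, b) (a + h, b + h)"
      by (intro integrable_continuous g cf)+
    have cont: "measure lborel (cbox (a, b) (a + h, b + h)) = h\<^sup>2"
      using h by (simp add: content_Pair power2_eq_square)
    have "(cmod (?R ?g))\<^sup>2 \<le> h\<^sup>2 * ?R (\<lambda>q. (cmod (?g q))\<^sup>2)"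
      using integral_norm_square_bound[OF g, of "(a, b)" "(a + h, b + h)"] cont
      by (simp add: rect_integral_eq g continuous_on_power continuous_on_norm)
    also have "?R (\<lambda>q. (cmod (?g q))\<^sup>2) \<le> ?R (\<lambda>q. 2 * h * A (snd p) + 2 * h * C (fst q))"
    proof (rule rect_integral_mono)
      fix x y assume xy: "x \<in> {a..a + h}" "y \<in> {b..b + h}"
      have "(cmod (f p - f (x, y)))\<^sup>2
          = (cmod ((f (fst p, snd p) - f (x, snd p)) + (f (x, snd p) - f (x, y))))\<^sup>2" by simp
      also have "\<dots> \<le> 2 * (cmod (f (fst p, snd p) - f (x, snd p)))\<^sup>2 + 2 * (cmod (f (x, snd p) - f (x, y)))\<^sup>2"
        by (rule square_sum_bound)
      also have "\<dots> \<le> 2 * (h * A (snd p)) + 2 * (h * C x)"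
        using increment_x[OF p(1) xy(1), of "snd p"] increment_y[OF p(2) xy(2), of x]
        by (simp add: A_def C_def)
      finally show "(cmod (f p - f (x, y)))\<^sup>2 \<le> 2 * h * A (snd p) + 2 * h * C (fst (x, y))" by simp
    qed (intro continuous_intros cf cCf)+
    also have "\<dots> = 2 * h ^ 3 * A (snd p) + 2 * h\<^sup>2 * g2"
      using h by (subst rect_integral_add)
        (simp_all add: cCf rect_integral_mult rect_integral_const rect_integral_of_fst G2[unfolded cbox_interval]
          power2_eq_square power3_eq_cube continuous_on_mult continuous_on_const)
    finally have gb: "(cmod (?R ?g))\<^sup>2 \<le> h\<^sup>2 * (2 * h ^ 3 * A (snd p) + 2 * h\<^sup>2 * g2)"
      using h by simp
    have "?R ?g = h\<^sup>2 *\<^sub>R f p - c"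
      unfolding c_def rect_integral_eq[OF g] rect_integral_eq[OF cf]
      using Henstock_Kurzweil_Integration.integral_diff[OF integrable_const gi(2), of "f p"] cont by simp
    then have "h\<^sup>2 *\<^sub>R f p = c + ?R ?g" by simp
    then have "(cmod (h\<^sup>2 *\<^sub>R f p))\<^sup>2 \<le> 2 * (cmod c)\<^sup>2 + 2 * (cmod (?R ?g))\<^sup>2"
      by (simp only: square_sum_bound)
    then show ?thesis using gb by (simp add: power_mult_distrib power_mult[symmetric])
  qed
  have "h ^ 4 * ?R (\<lambda>p. (cmod (f p))\<^sup>2) = ?R (\<lambda>p. h ^ 4 * (cmod (f p))\<^sup>2)"
    by (rule rect_integral_mult[symmetric])
  also have "\<dots> \<le> ?R (\<lambda>p. 2 * (cmod c)\<^sup>2 + 2 * h\<^sup>2 * (2 * h ^ 3 * A (snd p) + 2 * h\<^sup>2 * g2))"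
    by (intro rect_integral_mono continuous_intros cf cAs point) auto
  also have "\<dots> = 2 * (cmod c)\<^sup>2 * h\<^sup>2 + 2 * h\<^sup>2 * (2 * h ^ 3 * (h * g1) + 2 * h\<^sup>2 * (h\<^sup>2 * g2))"
  proof -
    have "?R (\<lambda>p. 2 * h\<^sup>2 * (2 * h ^ 3 * A (snd p) + 2 * h\<^sup>2 * g2))
        = 2 * h\<^sup>2 * (2 * h ^ 3 * (h * g1) + 2 * h\<^sup>2 * (h\<^sup>2 * g2))"
      using h unfolding rect_integral_mult
      by (subst rect_integral_add) (simp_all add: cAs rect_integral_mult rect_integral_const
          rect_integral_of_snd G1[unfolded cbox_interval] continuous_on_mult continuous_on_const power2_eq_square)
    then show ?thesis
      using h by (subst rect_integral_add) (simp_all add: cAs rect_integral_const power2_eq_square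
          continuous_on_mult continuous_on_const continuous_on_add)
  qed
  also have "\<dots> = h ^ 4 * (2 / h\<^sup>2 * (cmod c)\<^sup>2 + 4 * h\<^sup>2 * (g1 + g2))"
    using h by (simp add: field_simps power2_eq_square power3_eq_cube power4_eq_xxxx)
  finally show ?thesis using h by (simp add: c_def g1_def g2_def)
qed

lemma poincare_estimate:
  assumes "\<And>y. f (-1, y) = 0"
  shows "rect_integral (-1) 1 (-1) 1 (\<lambda>p. (cmod (f p))\<^sup>2) \<le> 4 * rect_integral (-1) 1 (-1) 1 dx2"
proof -
  define A where "A y = integral (cbox (-1) 1) (\<lambda>s. dx2 (s, y))" for y
  have cA: "continuous_on S A" for S
    unfolding A_def by (rule continuous_on_integral_snd[OF continuous_dx2])
  have cAs: "continuous_on S (\<lambda>p. 2 * A (snd p))" for S :: "point set"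
    by (intro continuous_intros continuous_on_compose2[OF cA[of UNIV]]; auto)
  have "rect_integral (-1) 1 (-1) 1 (\<lambda>p. (cmod (f p))\<^sup>2) \<le> rect_integral (-1) 1 (-1) 1 (\<lambda>p. 2 * A (snd p))"
  proof (rule rect_integral_mono)
    show "(cmod (f (x, y)))\<^sup>2 \<le> 2 * A (snd (x, y))" if "x \<in> {-1..1}" for x y
      using increment_x[OF that, of "-1" y] assms[of y] by (simp add: A_def)
  qed (intro continuous_intros smooth_continuous f cAs)+
  also have "\<dots> = 4 * integral (cbox (-1) 1) A"
    using rect_integral_of_snd[of "-1" 1 "-1" 1 "\<lambda>y. 2 * A y"] by simp
  also have "integral (cbox (-1) 1) A = rect_integral (-1) 1 (-1) 1 dx2"
    unfolding rect_integral_swap[OF continuous_dx2] A_def ..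
  finally show ?thesis .
qed

end

lemma integral_split_uniform:
  fixes F :: "real \<Rightarrow> real"
  assumes "continuous_on UNIV F" "h > 0"
  shows "integral (cbox a (a + real n * h)) F
     = (\<Sum>i<n. integral (cbox (a + real i * h) (a + real i * h + h)) F)"
proof (induction n)
  case 0
  then show ?case by simp
next
  case (Suc n)
  have "integral {a..a + real n * h} F + integral {a + real n * h..a + real (Suc n) * h} F
      = integral {a..a + real (Suc n) * h} F"
    using assms by (intro Henstock_Kurzweil_Integration.integral_combine integrable_continuous_real
        continuous_on_subset[OF assms(1)]) (auto simp: algebra_simps)
  then show ?case using Suc by (simp add: algebra_simps)
qed

lemma rect_integral_split_uniform:
  fixes F :: "point \<Rightarrow> real"
  assumes F: "continuous_on UNIV F" and h: "h > 0"
  shows "rect_integral a (a + real n * h) b (b + real n * h) F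
     = (\<Sum>i<n. \<Sum>j<n. rect_integral (a + real i * h) (a + real i * h + h) (b + real j * h) (b + real j * h + h) F)"
proof -
  have "rect_integral a (a + real n * h) b (b + real n * h) F
    = (\<Sum>i<n. integral (cbox (a + real i * h) (a + real i * h + h))
        (\<lambda>x. integral (cbox b (b + real n * h)) (\<lambda>y. F (x, y))))"
    unfolding rect_integral_def by (rule integral_split_uniform[OF continuous_on_integral_fst[OF F] h])
  also have "\<dots> = (\<Sum>i<n. integral (cbox (a + real i * h) (a + real i * h + h))
        (\<lambda>x. \<Sum>j<n. integral (cbox (b + real j * h) (b + real j * h + h)) (\<lambda>y. F (x, y))))"
    by (simp only: integral_split_uniform[OF continuous_on_slices(2)[OF F] h])
  also have "\<dots> = (\<Sum>i<n. \<Sum>j<n. rect_integral (a + real i * h) (a + real i * h + h) (b + real j * h) (b + real j * h + h) F)"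
    unfolding rect_integral_def
    by (intro sum.cong refl integral_sum integrable_continuous continuous_on_integral_fst F) simp
  finally show ?thesis .
qed

section \<open>The Hilbert space of functions vanishing on the boundary\<close>

lemma norm_cls_smooth:
  assumes "smooth f" "f \<in> L2"
  shows "(norm (cls f))\<^sup>2 = rect_integral (-1) 1 (-1) 1 (\<lambda>p. (cmod (f p))\<^sup>2)"
  unfolding norm_cls[OF assms(2)] rect_integral_def
  by (rule integral_leb_D_continuous) (intro continuous_intros smooth_continuous assms)

lemma norm_cls_pdiff:
  assumes "\<phi> \<in> test_functions" "e \<in> Basis"
  shows "(norm (cls (pdiff e \<phi>)))\<^sup>2 = rect_integral (-1) 1 (-1) 1 (\<lambda>p. (cmod (pdiff e \<phi> p))\<^sup>2)"
  using norm_cls_smooth[OF test_smooth[OF test_pdiff] test_L2[OF test_pdiff]] assms by blast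

lemma test_poincare:
  assumes \<phi>: "\<phi> \<in> test_functions"
  shows "(norm (cls \<phi>))\<^sup>2 \<le> 4 * (norm (cls (pdiff (1, 0) \<phi>)))\<^sup>2"
proof -
  have "\<phi> (-1, y) = 0" for y
    by (rule test_zero_outside[OF \<phi>]) (simp add: D_def)
  from poincare_estimate[OF test_smooth[OF \<phi>] this]
  show ?thesis
    by (simp add: norm_cls_smooth[OF test_smooth[OF \<phi>] test_L2[OF \<phi>]] norm_cls_pdiff[OF \<phi>] Basis_point)
qed

definition cell_indicator :: "point \<Rightarrow> point \<Rightarrow> field" where
  "cell_indicator p q x = (if x \<in> cbox p q then 1 else 0)"

lemma cell_indicator_L2: "cell_indicator p q \<in> L2"
proof (rule L2_of_bounded[of _ 1])
  show "cell_indicator p q \<in> borel_measurable leb_D"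
    unfolding cell_indicator_def[abs_def]
    by (intro measurable_restrict_space1 measurable_If_set) auto
qed (simp add: cell_indicator_def)

lemma rect_integral_cell:
  assumes \<phi>: "\<phi> \<in> test_functions"
  shows "rect_integral a b c d \<phi> = (\<integral>x. \<phi> x * cnj (cell_indicator (a, c) (b, d) x) \<partial>leb_D)"
proof -
  have cont: "continuous_on S \<phi>" for S by (rule smooth_continuous[OF test_smooth[OF \<phi>]])
  have "integrable lborel (\<lambda>x. indicator (cbox (a, c) (b, d)) x *\<^sub>R \<phi> x)"
    by (rule borel_integrable_compact[OF compact_cbox cont])
  then have si: "set_integrable lborel (cbox (a, c) (b, d)) \<phi>" by (simp add: set_integrable_def)
  have "indicator D x *\<^sub>R (\<phi> x * cnj (cell_indicator (a, c) (b, d) x))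
      = indicator (cbox (a, c) (b, d)) x *\<^sub>R \<phi> x" for x
    using test_zero_outside[OF \<phi>, of x]
    by (cases "x \<in> D"; cases "x \<in> cbox (a, c) (b, d)") (simp_all add: cell_indicator_def)
  then have "(\<integral>x. \<phi> x * cnj (cell_indicator (a, c) (b, d) x) \<partial>leb_D)
      = (\<integral>x. indicator (cbox (a, c) (b, d)) x *\<^sub>R \<phi> x \<partial>lborel)"
    by (simp only: integral_leb_D)
  also have "\<dots> = integral (cbox (a, c) (b, d)) \<phi>"
    using set_borel_integral_eq_integral(2)[OF si] by (simp add: set_lebesgue_integral_def)
  finally show ?thesis by (simp add: rect_integral_eq cont)
qed

text \<open>Different indices may carry the same vector, and a set would count it once. The factor
  \<open>card I\<close>, absorbed into the vectors, makes up for this.\<close>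

lemma sum_squares_image_bound:
  fixes l :: "'i \<Rightarrow> 'a::real_inner"
  assumes "finite I"
  shows "\<exists>L. finite L \<and> (\<forall>x. (\<Sum>i\<in>I. (inner (l i) x)\<^sup>2) \<le> (\<Sum>m\<in>L. (inner m x)\<^sup>2))"
proof (cases "I = {}")
  case True
  then show ?thesis by (intro exI[of _ "{}"]) simp
next
  case False
  define k where "k = real (card I)"
  have k: "k > 0" using assms False by (simp add: k_def card_gt_0_iff)
  define L where "L = (\<lambda>v. sqrt k *\<^sub>R v) ` (l ` I)"
  have inj: "inj_on (\<lambda>v. sqrt k *\<^sub>R v) (l ` I)" using k by (auto intro!: inj_onI)
  have "(\<Sum>i\<in>I. (inner (l i) x)\<^sup>2) \<le> (\<Sum>m\<in>L. (inner m x)\<^sup>2)" for x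
  proof -
    have "(inner (l i) x)\<^sup>2 \<le> (\<Sum>m\<in>l ` I. (inner m x)\<^sup>2)" if "i \<in> I" for i
      using member_le_sum[of "l i" "l ` I" "\<lambda>m. (inner m x)\<^sup>2"] assms that by simp
    then have "(\<Sum>i\<in>I. (inner (l i) x)\<^sup>2) \<le> k * (\<Sum>m\<in>l ` I. (inner m x)\<^sup>2)"
      unfolding k_def by (rule sum_bounded_above)
    also have "\<dots> = (\<Sum>m\<in>l ` I. (inner (sqrt k *\<^sub>R m) x)\<^sup>2)"
      using k by (simp add: sum_distrib_left power_mult_distrib)
    also have "\<dots> = (\<Sum>m\<in>L. (inner m x)\<^sup>2)" unfolding L_def by (simp add: sum.reindex[OF inj] o_def)
    finally show ?thesis .
  qed
  moreover have "finite L" using assms by (simp add: L_def)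
  ultimately show ?thesis by blast
qed

text \<open>On a grid with \<open>n\<^sup>2\<close> cells of side \<open>h = 2/n\<close> the gradient terms of the cell estimates add up to
  \<open>4 h\<^sup>2\<close> times the squared gradient norm. The integrals over the cells contribute two real functionals
  each, the real and the imaginary part (\<open>b\<close>).\<close>

lemma test_rellich:
  assumes "\<epsilon> > 0"
  shows "\<exists>L. finite L \<and> (\<forall>\<phi>\<in>test_functions.
     (norm (cls \<phi>))\<^sup>2 \<le> \<epsilon> * ((norm (cls (pdiff (1, 0) \<phi>)))\<^sup>2 + (norm (cls (pdiff (0, 1) \<phi>)))\<^sup>2)
        + (\<Sum>l\<in>L. (inner l (cls \<phi>))\<^sup>2))"
proof -
  \<comment> \<open>With \<open>n\<close> cells per side, \<open>4 h\<^sup>2 = 16 / n\<^sup>2 \<le> 16 / n\<close>.\<close>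
  obtain N where N: "16 / \<epsilon> < real N" using reals_Archimedean2 by blast
  have "0 < 16 / \<epsilon>" using assms by simp
  then have N0: "real N > 0" using N by linarith
  define n where "n = Suc N"
  define h where "h = 2 / real n"
  have n: "real n > 0" by (simp add: n_def)
  then have h: "h > 0" "real n * h = 2" by (simp_all add: h_def)
  have "4 * h\<^sup>2 \<le> \<epsilon>"
  proof -
    have "16 / \<epsilon> \<le> real n * real n"
    proof -
      have "16 / \<epsilon> \<le> real n * 1" using N by (simp add: n_def)
      also have "\<dots> \<le> real n * real n" by (intro mult_left_mono) (auto simp: n_def)
      finally show ?thesis .
    qed
    then have "16 \<le> \<epsilon> * (real n * real n)" using assms by (simp add: field_simps)
    moreover have "0 < real n * real n" by (simp add: n_def)
    ultimately have "16 / (real n * real n) \<le> \<epsilon>" by (simp only: pos_divide_le_eq)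
    then show ?thesis by (simp add: h_def power2_eq_square)
  qed
  define lo where "lo i = -1 + real i * h" for i
  define K where "K i j = cell_indicator (lo i, lo j) (lo i + h, lo j + h)" for i j
  have K: "K i j \<in> L2" for i j unfolding K_def by (rule cell_indicator_L2)
  define l where "l = (\<lambda>(i, j, b). sqrt (2 / h\<^sup>2) *\<^sub>R l2_scale (if b then \<i> else 1) (cls (K i j)))"
  define I where "I = {..<n} \<times> {..<n} \<times> (UNIV :: bool set)"
  obtain L where L: "finite L" "\<And>x. (\<Sum>i\<in>I. (inner (l i) x)\<^sup>2) \<le> (\<Sum>m\<in>L. (inner m x)\<^sup>2)"
    using sum_squares_image_bound[of I l] by (auto simp: I_def)
  have "(norm (cls \<phi>))\<^sup>2 \<le> \<epsilon> * ((norm (cls (pdiff (1, 0) \<phi>)))\<^sup>2 + (norm (cls (pdiff (0, 1) \<phi>)))\<^sup>2)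
        + (\<Sum>l\<in>L. (inner l (cls \<phi>))\<^sup>2)" if \<phi>: "\<phi> \<in> test_functions" for \<phi>
  proof -
    let ?R = "\<lambda>F i j. rect_integral (lo i) (lo i + h) (lo j) (lo j + h) F"
    have s: "smooth \<phi>" by (rule test_smooth[OF \<phi>])
    have split: "rect_integral (-1) 1 (-1) 1 F = (\<Sum>i<n. \<Sum>j<n. ?R F i j)"
      if "continuous_on UNIV F" for F :: "point \<Rightarrow> real"
      using rect_integral_split_uniform[OF that h(1), of "-1" n "-1"] by (simp add: h(2) lo_def)
    have cell: "2 / h\<^sup>2 * (cmod (rect_integral (lo i) (lo i + h) (lo j) (lo j + h) \<phi>))\<^sup>2
        = (\<Sum>b\<in>UNIV. (inner (l (i, j, b)) (cls \<phi>))\<^sup>2)" for i j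
    proof -
      define c where "c = (\<integral>x. \<phi> x * cnj (K i j x) \<partial>leb_D)"
      have "inner (cls (K i j)) (cls \<phi>) = Re c"
        using inner_cls[OF test_L2[OF \<phi>] K] by (simp add: c_def inner_commute)
      moreover have "inner (l2_scale \<i> (cls (K i j))) (cls \<phi>) = Im c"
        using inner_l2_scale_i[OF test_L2[OF \<phi>] K] by (simp add: c_def inner_commute)
      ultimately have "(\<Sum>b\<in>UNIV. (inner (l (i, j, b)) (cls \<phi>))\<^sup>2) = 2 / h\<^sup>2 * ((Re c)\<^sup>2 + (Im c)\<^sup>2)"
        using l2_scale_of_real[of 1 "cls (K i j)"]
        by (simp add: UNIV_bool l_def power_mult_distrib distrib_left)
      then show ?thesis
        by (simp add: c_def K_def rect_integral_cell[OF \<phi>] cmod_power2)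
    qed
    have "(norm (cls \<phi>))\<^sup>2 = (\<Sum>i<n. \<Sum>j<n. ?R (\<lambda>p. (cmod (\<phi> p))\<^sup>2) i j)"
      unfolding norm_cls_smooth[OF s test_L2[OF \<phi>]]
      by (intro split continuous_intros smooth_continuous s)
    also have "\<dots> \<le> (\<Sum>i<n. \<Sum>j<n. (\<Sum>b\<in>UNIV. (inner (l (i, j, b)) (cls \<phi>))\<^sup>2)
        + 4 * h\<^sup>2 * (?R (\<lambda>p. (cmod (pdiff (1, 0) \<phi> p))\<^sup>2) i j + ?R (\<lambda>p. (cmod (pdiff (0, 1) \<phi> p))\<^sup>2) i j))"
      unfolding cell[symmetric] by (intro sum_mono cell_estimate s h(1))
    also have "\<dots> = (\<Sum>i\<in>I. (inner (l i) (cls \<phi>))\<^sup>2)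
        + 4 * h\<^sup>2 * ((norm (cls (pdiff (1, 0) \<phi>)))\<^sup>2 + (norm (cls (pdiff (0, 1) \<phi>)))\<^sup>2)"
      unfolding I_def norm_cls_pdiff[OF \<phi>, of "(1, 0)", unfolded Basis_point, simplified]
        norm_cls_pdiff[OF \<phi>, of "(0, 1)", unfolded Basis_point, simplified]
      by (simp add: split continuous_dx2[OF s] continuous_dy2[OF s] sum.distrib
          sum_distrib_left[symmetric] sum.cartesian_product split_beta)
    also have "\<dots> \<le> (\<Sum>l\<in>L. (inner l (cls \<phi>))\<^sup>2)
        + \<epsilon> * ((norm (cls (pdiff (1, 0) \<phi>)))\<^sup>2 + (norm (cls (pdiff (0, 1) \<phi>)))\<^sup>2)"
      by (intro add_mono L(2) mult_right_mono \<open>4 * h\<^sup>2 \<le> \<epsilon>\<close>) simp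
    finally show ?thesis by simp
  qed
  then show ?thesis using L(1) by blast
qed

text \<open>The jets of the elements of \<^const>\<open>H10\<close>, as \<open>H10_iff\<close> and \<open>jets0_surj\<close> show.\<close>

definition jets0 :: "jet set" where
  "jets0 = closure (jet ` test_functions)"

lemma jet_test: "\<phi> \<in> test_functions \<Longrightarrow> jet \<phi> = (cls \<phi>, cls (pdiff (1, 0) \<phi>), cls (pdiff (0, 1) \<phi>))"
  by (simp add: jet_def wgrad_test Basis_point)

lemma test_zero: "(\<lambda>_. 0) \<in> test_functions"
  by (rule test_functionI[of _ "{}"]) (simp_all add: smooth_const)

lemma jet_scale_of_real: "jet_scale (complex_of_real r) x = r *\<^sub>R x"
  by (cases x) (simp add: jet_scale_def l2_scale_of_real)

lemma subspace_closure:
  fixes S :: "'a::real_normed_vector set"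
  assumes "subspace S"
  shows "subspace (closure S)"
  unfolding subspace_def
proof (intro conjI ballI allI)
  show "0 \<in> closure S" using subspace_0[OF assms] closure_subset by blast
  fix x assume "x \<in> closure S"
  then obtain f where f: "\<And>n. f n \<in> S" "f \<longlonglongrightarrow> x" unfolding closure_sequential by blast
  show "c *\<^sub>R x \<in> closure S" for c
    unfolding closure_sequential
    by (intro exI[of _ "\<lambda>n. c *\<^sub>R f n"] conjI allI subspace_scale[OF assms f(1)] tendsto_intros f(2))
  fix y assume "y \<in> closure S"
  then obtain g where g: "\<And>n. g n \<in> S" "g \<longlonglongrightarrow> y" unfolding closure_sequential by blast
  show "x + y \<in> closure S"
    unfolding closure_sequential
    by (intro exI[of _ "\<lambda>n. f n + g n"] conjI allI subspace_add[OF assms f(1) g(1)] tendsto_intros f(2) g(2))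
qed

lemma jets0_subspace: "subspace jets0"
  unfolding jets0_def
proof (rule subspace_closure)
  show "subspace (jet ` test_functions)"
    unfolding subspace_def
  proof (intro conjI ballI allI)
    have "jet (\<lambda>_. 0) = 0"
      using jet_scale[OF test_H1[OF test_zero], of 0] jet_scale_of_real[of 0 "jet (\<lambda>_. 0)"] by simp
    then show "0 \<in> jet ` test_functions" using test_zero by (metis image_eqI)
    fix x assume "x \<in> jet ` test_functions"
    then obtain \<phi> where \<phi>: "\<phi> \<in> test_functions" "x = jet \<phi>" by blast
    show "c *\<^sub>R x \<in> jet ` test_functions" for c
      using jet_scale[OF test_H1[OF \<phi>(1)], of "of_real c"] test_scale[OF \<phi>(1), of "of_real c"] \<phi>(2)
      by (metis image_eqI jet_scale_of_real)
    fix y assume "y \<in> jet ` test_functions"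
    then obtain \<psi> where \<psi>: "\<psi> \<in> test_functions" "y = jet \<psi>" by blast
    show "x + y \<in> jet ` test_functions"
      using jet_add[OF test_H1[OF \<phi>(1)] test_H1[OF \<psi>(1)]] test_add[OF \<phi>(1) \<psi>(1)] \<phi>(2) \<psi>(2)
      by (metis image_eqI)
  qed
qed

interpretation l2: complex_structure l2_scale
  by unfold_locales
    (rule l2_scale_add_left l2_scale_add_right l2_scale_assoc l2_scale_of_real norm_l2_scale)+

lemma continuous_jet_scale: "continuous_on S (jet_scale c)"
  unfolding jet_scale_def case_prod_beta
  by (intro continuous_intros bounded_linear.continuous_on[OF l2.cs.bounded_linear_right])

lemma jets0_scale: "x \<in> jets0 \<Longrightarrow> jet_scale c x \<in> jets0"
proof -
  assume "x \<in> jets0"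
  moreover have "jet_scale c ` closure (jet ` test_functions) \<subseteq> closure (jet ` test_functions)"
  proof (rule image_closure_subset[OF continuous_jet_scale closed_closure])
    show "jet_scale c ` jet ` test_functions \<subseteq> closure (jet ` test_functions)"
    proof (intro subsetI)
      fix y assume "y \<in> jet_scale c ` jet ` test_functions"
      then obtain \<phi> where \<phi>: "\<phi> \<in> test_functions" "y = jet_scale c (jet \<phi>)" by blast
      then have "y = jet (\<lambda>x. c * \<phi> x)" by (simp add: jet_scale[OF test_H1])
      then show "y \<in> closure (jet ` test_functions)"
        by (simp only: subsetD[OF closure_subset imageI[OF test_scale[OF \<phi>(1)]]])
    qed
  qed
  ultimately show ?thesis unfolding jets0_def by blast
qed

lemma jets0_induct:
  assumes "x \<in> jets0" "\<And>\<phi>. \<phi> \<in> test_functions \<Longrightarrow> P (jet \<phi>)" "closed {x. P x}"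
  shows "P x"
proof -
  have "closure (jet ` test_functions) \<subseteq> {x. P x}"
    by (rule closure_minimal) (use assms in auto)
  then show ?thesis using assms(1) unfolding jets0_def by blast
qed

text \<open>The pairs of a function and its weak derivative form a closed set.\<close>

lemma jets0_weakly_diff:
  assumes "x \<in> jets0"
  shows "weakly_diff (1, 0) (fst x) (fst (snd x)) \<and> weakly_diff (0, 1) (fst x) (snd (snd x))"
  using assms
proof (rule jets0_induct)
  fix \<phi> assume "\<phi> \<in> test_functions"
  then show "weakly_diff (1, 0) (fst (jet \<phi>)) (fst (snd (jet \<phi>))) \<and> weakly_diff (0, 1) (fst (jet \<phi>)) (snd (snd (jet \<phi>)))"
    by (simp add: jet_test test_weakly_diff Basis_point)
next
  show "closed {x. weakly_diff (1, 0) (fst x) (fst (snd x)) \<and> weakly_diff (0, 1) (fst x) (snd (snd x))}"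
    unfolding weakly_diff_def Ball_def
    by (intro closed_Collect_conj closed_Collect_all closed_Collect_imp closed_Collect_eq
        continuous_intros open_Collect_const)
qed

lemma jets0_poincare: "x \<in> jets0 \<Longrightarrow> norm (fst x) \<le> 2 * norm (snd x)"
proof (erule jets0_induct)
  fix \<phi> assume \<phi>: "\<phi> \<in> test_functions"
  have "(norm (cls \<phi>))\<^sup>2 \<le> (2 * norm (cls (pdiff (1, 0) \<phi>)))\<^sup>2"
    using test_poincare[OF \<phi>] by (simp add: power_mult_distrib)
  then have "norm (cls \<phi>) \<le> 2 * norm (cls (pdiff (1, 0) \<phi>))" by (rule power2_le_imp_le) simp
  also have "\<dots> \<le> 2 * norm (snd (jet \<phi>))"
    using norm_fst_le[of "cls (pdiff (1, 0) \<phi>)" "cls (pdiff (0, 1) \<phi>)"] by (simp add: jet_test[OF \<phi>])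
  finally show "norm (fst (jet \<phi>)) \<le> 2 * norm (snd (jet \<phi>))" by (simp add: jet_test[OF \<phi>])
qed (intro closed_Collect_le continuous_intros)

lemma jets0_rellich:
  assumes "\<epsilon> > 0"
  shows "\<exists>L. finite L \<and> (\<forall>x\<in>jets0. (norm (fst x))\<^sup>2 \<le> \<epsilon> * (norm (snd x))\<^sup>2 + (\<Sum>l\<in>L. (inner l (fst x))\<^sup>2))"
proof -
  obtain L where L: "finite L" "\<And>\<phi>. \<phi> \<in> test_functions \<Longrightarrow>
     (norm (cls \<phi>))\<^sup>2 \<le> \<epsilon> * ((norm (cls (pdiff (1, 0) \<phi>)))\<^sup>2 + (norm (cls (pdiff (0, 1) \<phi>)))\<^sup>2)
        + (\<Sum>l\<in>L. (inner l (cls \<phi>))\<^sup>2)"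
    using test_rellich[OF assms] by blast
  have "(norm (fst x))\<^sup>2 \<le> \<epsilon> * (norm (snd x))\<^sup>2 + (\<Sum>l\<in>L. (inner l (fst x))\<^sup>2)" if "x \<in> jets0" for x
    using that
  proof (rule jets0_induct)
    fix \<phi> assume \<phi>: "\<phi> \<in> test_functions"
    show "(norm (fst (jet \<phi>)))\<^sup>2 \<le> \<epsilon> * (norm (snd (jet \<phi>)))\<^sup>2 + (\<Sum>l\<in>L. (inner l (fst (jet \<phi>)))\<^sup>2)"
      using L(2)[OF \<phi>] by (simp add: jet_test[OF \<phi>] norm_Pair)
  qed (intro closed_Collect_le continuous_intros)
  then show ?thesis using L(1) by blast
qed

lemma H10_iff: "u \<in> H10 \<longleftrightarrow> u \<in> H1 \<and> jet u \<in> jets0"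
proof -
  have dist: "h1_norm (\<lambda>x. \<phi> x - u x) = dist (jet \<phi>) (jet u)"
    if "u \<in> H1" "\<phi> \<in> test_functions" for \<phi>
  proof -
    have neg: "(\<lambda>x. - u x) \<in> H1" "jet (\<lambda>x. - u x) = - jet u"
      using H1_scale(1)[OF that(1), of "-1"] jet_scale[OF that(1), of "-1"]
        jet_scale_of_real[of "-1" "jet u"] by simp_all
    have "(\<lambda>x. \<phi> x - u x) \<in> H1" "jet (\<lambda>x. \<phi> x - u x) = jet \<phi> - jet u"
      using H1_add(1)[OF test_H1[OF that(2)] neg(1)] jet_add[OF test_H1[OF that(2)] neg(1)] neg(2)
      by simp_all
    then show ?thesis by (simp add: h1_norm_jet dist_norm)
  qed
  show ?thesis
  proof
    assume "u \<in> H10"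
    then obtain \<phi> where u: "u \<in> H1" and \<phi>: "\<And>n. \<phi> n \<in> test_functions"
      and lim: "(\<lambda>n. h1_norm (\<lambda>x. \<phi> n x - u x)) \<longlonglongrightarrow> 0"
      unfolding H10_def by blast
    have "(\<lambda>n. jet (\<phi> n)) \<longlonglongrightarrow> jet u"
      using lim unfolding dist[OF u \<phi>] by (rule tendsto_dist_iff[THEN iffD2])
    then have "jet u \<in> jets0"
      unfolding jets0_def closure_sequential
      by (intro exI[of _ "\<lambda>n. jet (\<phi> n)"] conjI allI imageI \<phi>)
    then show "u \<in> H1 \<and> jet u \<in> jets0" using u by blast
  next
    assume u: "u \<in> H1 \<and> jet u \<in> jets0"
    then obtain x where x: "\<And>n. x n \<in> jet ` test_functions" "x \<longlonglongrightarrow> jet u"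
      unfolding jets0_def closure_sequential by blast
    have "\<forall>n. \<exists>\<phi>. \<phi> \<in> test_functions \<and> x n = jet \<phi>" using x(1) by blast
    from choice[OF this] obtain \<phi>
      where "\<forall>n. \<phi> n \<in> test_functions \<and> x n = jet (\<phi> n)" by (rule exE)
    then have \<phi>: "\<And>n. \<phi> n \<in> test_functions" "\<And>n. x n = jet (\<phi> n)" by simp_all
    have "(\<lambda>n. dist (jet (\<phi> n)) (jet u)) \<longlonglongrightarrow> 0"
      using x(2)[THEN tendsto_dist_iff[THEN iffD1]] unfolding \<phi>(2) .
    then have "(\<lambda>n. h1_norm (\<lambda>x. \<phi> n x - u x)) \<longlonglongrightarrow> 0"
      using u \<phi>(1) by (simp add: dist)
    then show "u \<in> H10" unfolding H10_def using u \<phi>(1) by blast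
  qed
qed

lemma jets0_surj:
  assumes "x \<in> jets0"
  shows "\<exists>u\<in>H10. jet u = x"
proof -
  obtain u where u: "u \<in> L2" "fst x = cls u" using cls_surj by blast
  note w = jets0_weakly_diff[OF assms, unfolded u(2)]
  have "u \<in> H1"
    by (rule H1I[OF u(1), of "\<lambda>e. if e = (1, 0) then fst (snd x) else snd (snd x)"])
      (use w in \<open>auto simp: Basis_point\<close>)
  moreover have "jet u = x"
    using wgrad_eqI[OF \<open>u \<in> H1\<close>, of "(1, 0)" "fst (snd x)"] wgrad_eqI[OF \<open>u \<in> H1\<close>, of "(0, 1)" "snd (snd x)"]
      w u(2) by (simp add: jet_def Basis_point prod_eq_iff)
  ultimately show ?thesis using assms H10_iff by blast
qed

text \<open>The elements are the jets, but the inner product sees the gradient only. By the Poincare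
  inequality it is definite, and its norm is equivalent to the norm of the jet.\<close>

typedef h10 = jets0
  using jets0_subspace subspace_0 by blast

setup_lifting type_definition_h10

instantiation h10 :: real_vector
begin

lift_definition zero_h10 :: h10 is 0 by (rule subspace_0[OF jets0_subspace])
lift_definition plus_h10 :: "h10 \<Rightarrow> h10 \<Rightarrow> h10" is "(+)" by (rule subspace_add[OF jets0_subspace])
lift_definition minus_h10 :: "h10 \<Rightarrow> h10 \<Rightarrow> h10" is "(-)" by (rule subspace_diff[OF jets0_subspace])
lift_definition uminus_h10 :: "h10 \<Rightarrow> h10" is "uminus" by (rule subspace_neg[OF jets0_subspace])
lift_definition scaleR_h10 :: "real \<Rightarrow> h10 \<Rightarrow> h10" is "(*\<^sub>R)" by (rule subspace_scale[OF jets0_subspace])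

instance
  by standard (transfer; simp add: algebra_simps)+

end

instantiation h10 :: real_inner
begin

lift_definition inner_h10 :: "h10 \<Rightarrow> h10 \<Rightarrow> real" is "\<lambda>x y. inner (snd x) (snd y)" .

definition norm_h10 :: "h10 \<Rightarrow> real" where "norm_h10 x = sqrt (inner x x)"
definition dist_h10 :: "h10 \<Rightarrow> h10 \<Rightarrow> real" where "dist_h10 x y = norm (x - y)"
definition sgn_h10 :: "h10 \<Rightarrow> h10" where "sgn_h10 x = x /\<^sub>R norm x"
definition uniformity_h10 :: "(h10 \<times> h10) filter" where
  "uniformity_h10 = (INF e\<in>{0<..}. principal {(x, y). dist x y < e})"
definition open_h10 :: "h10 set \<Rightarrow> bool" where
  "open_h10 U \<longleftrightarrow> (\<forall>x\<in>U. \<forall>\<^sub>F (x', y) in uniformity. x' = x \<longrightarrow> y \<in> U)"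

instance
proof
  fix x y z :: h10 and a b :: real and U :: "h10 set"
  show "inner x y = inner y x" by transfer (rule inner_commute)
  show "inner (x + y) z = inner x z + inner y z" by transfer (simp add: inner_add_left)
  show "inner (a *\<^sub>R x) y = a * inner x y" by transfer simp
  show "0 \<le> inner x x" by transfer simp
  show "inner x x = 0 \<longleftrightarrow> x = 0"
  proof transfer
    fix x assume "x \<in> jets0"
    then have "norm (fst x) \<le> 2 * norm (snd x)" by (rule jets0_poincare)
    then have "snd x = 0 \<Longrightarrow> fst x = 0" by simp
    then show "inner (snd x) (snd x) = 0 \<longleftrightarrow> x = 0"
      unfolding inner_eq_zero_iff using prod_eqI[of x 0] by auto
  qed
  show "norm x = sqrt (inner x x)" by (rule norm_h10_def)
  show "dist x y = norm (x - y)" by (rule dist_h10_def)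
  show "sgn x = x /\<^sub>R norm x" by (rule sgn_h10_def)
  show "(uniformity :: (h10 \<times> h10) filter) = (INF e\<in>{0<..}. principal {(x, y). dist x y < e})"
    by (rule uniformity_h10_def)
  show "open U \<longleftrightarrow> (\<forall>x\<in>U. \<forall>\<^sub>F (x', y) in uniformity. x' = x \<longrightarrow> y \<in> U)"
    by (rule open_h10_def)
qed

end

lemma norm_h10: "norm x = norm (snd (Rep_h10 x))"
  unfolding norm_h10_def norm_eq_sqrt_inner by (simp add: inner_h10.rep_eq)

lemma norm_Rep_h10: "norm (Rep_h10 x) \<le> 3 * norm x"
proof -
  have "norm (Rep_h10 x) \<le> norm (fst (Rep_h10 x)) + norm (snd (Rep_h10 x))"
    using norm_Pair_le[of "fst (Rep_h10 x)" "snd (Rep_h10 x)"] by simp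
  also have "\<dots> \<le> 3 * norm x"
    using jets0_poincare[OF Rep_h10[of x]] by (simp add: norm_h10)
  finally show ?thesis .
qed

instance h10 :: banach
proof
  fix X :: "nat \<Rightarrow> h10" assume X: "Cauchy X"
  have "Cauchy (\<lambda>n. Rep_h10 (X n))"
  proof (rule metric_CauchyI)
    fix e :: real assume "e > 0"
    then obtain M where M: "\<And>m n. m \<ge> M \<Longrightarrow> n \<ge> M \<Longrightarrow> dist (X m) (X n) < e / 3"
      using metric_CauchyD[OF X, of "e / 3"] by auto
    have "dist (Rep_h10 (X m)) (Rep_h10 (X n)) < e" if "m \<ge> M" "n \<ge> M" for m n
      using norm_Rep_h10[of "X m - X n"] M[OF that] by (simp add: dist_norm minus_h10.rep_eq)
    then show "\<exists>M. \<forall>m\<ge>M. \<forall>n\<ge>M. dist (Rep_h10 (X m)) (Rep_h10 (X n)) < e" by blast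
  qed
  then obtain y where y: "(\<lambda>n. Rep_h10 (X n)) \<longlonglongrightarrow> y"
    using Cauchy_convergent_iff convergent_def by blast
  have "closed jets0" by (simp add: jets0_def)
  then have "y \<in> jets0" using closed_sequentially[OF _ Rep_h10 y] by blast
  have snd_le: "norm (snd z) \<le> norm z" for z :: jet
    using norm_snd_le[of "snd z" "fst z"] by simp
  have "norm (X n - Abs_h10 y) \<le> norm (Rep_h10 (X n) - y)" for n
    unfolding norm_h10 minus_h10.rep_eq Abs_h10_inverse[OF \<open>y \<in> jets0\<close>] by (rule snd_le)
  then have "\<forall>\<^sub>F n in sequentially. norm (X n - Abs_h10 y) \<le> norm (Rep_h10 (X n) - y)"
    by (rule always_eventually[OF allI])
  moreover have "(\<lambda>n. norm (Rep_h10 (X n) - y)) \<longlonglongrightarrow> 0"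
    using y by (simp add: LIM_zero_iff tendsto_norm_zero_iff)
  ultimately have "(\<lambda>n. X n - Abs_h10 y) \<longlonglongrightarrow> 0" by (rule Lim_null_comparison)
  then show "convergent X" by (auto simp: LIM_zero_iff convergent_def)
qed

lift_definition h10_scale :: "complex \<Rightarrow> h10 \<Rightarrow> h10" is jet_scale by (rule jets0_scale)

lemma jet_scale_simps:
  "jet_scale (z + w) x = jet_scale z x + jet_scale w x"
  "jet_scale z (x + y) = jet_scale z x + jet_scale z y"
  "jet_scale z (jet_scale w x) = jet_scale (z * w) x"
  by (cases x; cases y; simp add: jet_scale_def l2_scale_add_left l2_scale_add_right l2_scale_assoc)+

lemma norm_snd_jet_scale: "norm (snd (jet_scale z x)) = cmod z * norm (snd x)"
proof (cases x)
  case (fields u p q)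
  have "(norm (snd (jet_scale z x)))\<^sup>2 = (cmod z * norm (snd x))\<^sup>2"
    unfolding fields jet_scale_def
    by (simp add: norm_Pair norm_l2_scale power_mult_distrib distrib_left)
  then show ?thesis by (rule power2_eq_imp_eq) auto
qed

interpretation h10: complex_structure h10_scale
proof
  show "h10_scale (z + w) x = h10_scale z x + h10_scale w x" for z w x
    by transfer (rule jet_scale_simps)
  show "h10_scale z (x + y) = h10_scale z x + h10_scale z y" for z x y
    by transfer (rule jet_scale_simps)
  show "h10_scale z (h10_scale w x) = h10_scale (z * w) x" for z w x
    by transfer (rule jet_scale_simps)
  show "h10_scale (complex_of_real r) x = r *\<^sub>R x" for r x
    by transfer (rule jet_scale_of_real)
  show "norm (h10_scale z x) = cmod z * norm x" for z x
    by (simp add: norm_h10 h10_scale.rep_eq norm_snd_jet_scale)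
qed

section \<open>The transmission problem as an operator equation\<close>

lemma integral_mult_cnj_eq_cinner:
  assumes "u \<in> L2" "v \<in> L2"
  shows "(\<integral>x. u x * cnj (v x) \<partial>leb_D) = l2.cinner (cls u) (cls v)"
  using assms by (simp add: l2.cinner_def complex_eq_iff inner_cls inner_l2_scale_i)

lemma eps_weight_measurable: "(\<lambda>x. complex_of_real ((eps_r n1 n2 x)\<^sup>2)) \<in> borel_measurable leb_D"
proof -
  have "open {x :: point. snd x < 0}" by (intro open_Collect_less continuous_intros)
  then have "(\<lambda>x :: point. if x \<in> {x. snd x < 0} then n1 else n2) \<in> borel_measurable lborel"
    by (intro measurable_If_set) auto
  then have "eps_r n1 n2 \<in> borel_measurable lborel" by (simp add: eps_r_def[abs_def])
  then have "eps_r n1 n2 \<in> borel_measurable leb_D" by (rule measurable_restrict_space1)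
  then show ?thesis by measurable
qed

lemma eps_weight_L2: "u \<in> L2 \<Longrightarrow> (\<lambda>x. complex_of_real ((eps_r n1 n2 x)\<^sup>2) * u x) \<in> L2"
  by (rule L2_mult_bounded[OF _ eps_weight_measurable, where K = "n1\<^sup>2 + n2\<^sup>2"])
    (auto simp: eps_r_def norm_power)

lift_definition mul_eps :: "real \<Rightarrow> real \<Rightarrow> l2 \<Rightarrow> l2"
  is "\<lambda>n1 n2 u x. complex_of_real ((eps_r n1 n2 x)\<^sup>2) * u x"
proof -
  fix n1 n2 u v assume uv: "l2_rel u v"
  then have "ae_eq (\<lambda>x. complex_of_real ((eps_r n1 n2 x)\<^sup>2) * u x) (\<lambda>x. complex_of_real ((eps_r n1 n2 x)\<^sup>2) * v x)"
    unfolding l2_rel_def ae_eq_def by (auto elim: eventually_mono)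
  then show "l2_rel (\<lambda>x. complex_of_real ((eps_r n1 n2 x)\<^sup>2) * u x) (\<lambda>x. complex_of_real ((eps_r n1 n2 x)\<^sup>2) * v x)"
    using uv eps_weight_L2 by (simp add: l2_rel_def)
qed

lemma mul_eps_cls: "u \<in> L2 \<Longrightarrow> mul_eps n1 n2 (cls u) = cls (\<lambda>x. complex_of_real ((eps_r n1 n2 x)\<^sup>2) * u x)"
  by (simp add: mul_eps.abs_eq l2_rel_def)

lemma mul_eps_add: "mul_eps n1 n2 (x + y) = mul_eps n1 n2 x + mul_eps n1 n2 y"
proof -
  obtain u where u: "u \<in> L2" "x = cls u" using cls_surj by blast
  obtain v where v: "v \<in> L2" "y = cls v" using cls_surj by blast
  show ?thesis
    unfolding u(2) v(2) cls_add[OF u(1) v(1), symmetric] mul_eps_cls[OF L2_add[OF u(1) v(1)]]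
      mul_eps_cls[OF u(1)] mul_eps_cls[OF v(1)] distrib_left
    by (rule cls_add[OF eps_weight_L2[OF u(1)] eps_weight_L2[OF v(1)]])
qed

lemma mul_eps_scale: "mul_eps n1 n2 (l2_scale c x) = l2_scale c (mul_eps n1 n2 x)"
proof -
  obtain u where u: "u \<in> L2" "x = cls u" using cls_surj by blast
  show ?thesis
    unfolding u(2) l2_scale_cls[OF u(1)] mul_eps_cls[OF L2_scale[OF u(1)]] mul_eps_cls[OF u(1)]
      l2_scale_cls[OF eps_weight_L2[OF u(1)]]
    by (simp only: mult.left_commute)
qed

lemma eps_form_eq_cinner:
  assumes "u \<in> L2" "v \<in> L2"
  shows "eps_form n1 n2 u v = l2.cinner (mul_eps n1 n2 (cls u)) (cls v)"
  unfolding eps_form_def mul_eps_cls[OF assms(1)]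
  by (rule integral_mult_cnj_eq_cinner[OF eps_weight_L2[OF assms(1)] assms(2)])

lemma inner_mul_eps_sym: "inner (mul_eps n1 n2 x) y = inner x (mul_eps n1 n2 y)"
proof -
  obtain u where u: "u \<in> L2" "x = cls u" using cls_surj by blast
  obtain v where v: "v \<in> L2" "y = cls v" using cls_surj by blast
  show ?thesis
    using inner_cls[OF eps_weight_L2[OF u(1)] v(1), of n1 n2] inner_cls[OF u(1) eps_weight_L2[OF v(1), of n1 n2]]
    by (simp add: u v mul_eps_cls ac_simps)
qed

lemma inner_mul_eps_self:
  assumes "u \<in> L2"
  shows "inner (mul_eps n1 n2 (cls u)) (cls u) = (\<integral>x. (eps_r n1 n2 x)\<^sup>2 * (cmod (u x))\<^sup>2 \<partial>leb_D)"
    and "integrable leb_D (\<lambda>x. (eps_r n1 n2 x)\<^sup>2 * (cmod (u x))\<^sup>2)"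
proof -
  have eq: "complex_of_real ((eps_r n1 n2 x)\<^sup>2) * u x * cnj (u x)
      = complex_of_real ((eps_r n1 n2 x)\<^sup>2 * (cmod (u x))\<^sup>2)" for x
    by (simp only: mult.assoc complex_norm_square[symmetric] of_real_mult)
  show "inner (mul_eps n1 n2 (cls u)) (cls u) = (\<integral>x. (eps_r n1 n2 x)\<^sup>2 * (cmod (u x))\<^sup>2 \<partial>leb_D)"
    unfolding mul_eps_cls[OF assms] inner_cls[OF eps_weight_L2[OF assms] assms]
    by (simp only: eq integral_complex_of_real Re_complex_of_real)
  have "integrable leb_D (\<lambda>x. complex_of_real ((eps_r n1 n2 x)\<^sup>2) * u x * cnj (u x))"
    by (rule L2_mult_integrable[OF eps_weight_L2[OF assms] L2_cnj[OF assms]])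
  then show "integrable leb_D (\<lambda>x. (eps_r n1 n2 x)\<^sup>2 * (cmod (u x))\<^sup>2)"
    by (simp only: eq complex_of_real_integrable_eq)
qed

lemma inner_mul_eps_bounds:
  assumes "0 < n2" "n2 < n1"
  shows "n2\<^sup>2 * (norm x)\<^sup>2 \<le> inner (mul_eps n1 n2 x) x" "inner (mul_eps n1 n2 x) x \<le> n1\<^sup>2 * (norm x)\<^sup>2"
proof -
  obtain u where u: "u \<in> L2" "x = cls u" using cls_surj by blast
  have e: "n2\<^sup>2 \<le> (eps_r n1 n2 y)\<^sup>2" "(eps_r n1 n2 y)\<^sup>2 \<le> n1\<^sup>2" for y
    using assms by (auto simp: eps_r_def intro!: power_mono)
  have i: "integrable leb_D (\<lambda>y. k * (cmod (u y))\<^sup>2)" for k using L2D(2)[OF u(1)] by simp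
  have "(\<integral>y. n2\<^sup>2 * (cmod (u y))\<^sup>2 \<partial>leb_D) \<le> (\<integral>y. (eps_r n1 n2 y)\<^sup>2 * (cmod (u y))\<^sup>2 \<partial>leb_D)"
    by (intro integral_mono i inner_mul_eps_self(2) u mult_right_mono e) simp
  then show "n2\<^sup>2 * (norm x)\<^sup>2 \<le> inner (mul_eps n1 n2 x) x"
    by (simp add: u inner_mul_eps_self(1) norm_cls)
  have "(\<integral>y. (eps_r n1 n2 y)\<^sup>2 * (cmod (u y))\<^sup>2 \<partial>leb_D) \<le> (\<integral>y. n1\<^sup>2 * (cmod (u y))\<^sup>2 \<partial>leb_D)"
    by (intro integral_mono i inner_mul_eps_self(2) u mult_right_mono e) simp
  then show "inner (mul_eps n1 n2 x) x \<le> n1\<^sup>2 * (norm x)\<^sup>2"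
    by (simp add: u inner_mul_eps_self(1) norm_cls)
qed

lemma norm_mul_eps_le: "norm (mul_eps n1 n2 x) \<le> (n1\<^sup>2 + n2\<^sup>2) * norm x"
proof -
  obtain u where u: "u \<in> L2" "x = cls u" using cls_surj by blast
  have i: "integrable leb_D (\<lambda>y. (n1\<^sup>2 + n2\<^sup>2)\<^sup>2 * (cmod (u y))\<^sup>2)" using L2D(2)[OF u(1)] by simp
  have "(norm (mul_eps n1 n2 x))\<^sup>2
      = (\<integral>y. (cmod (complex_of_real ((eps_r n1 n2 y)\<^sup>2) * u y))\<^sup>2 \<partial>leb_D)"
    unfolding u(2) mul_eps_cls[OF u(1)] by (rule norm_cls[OF eps_weight_L2[OF u(1)]])
  also have "\<dots> \<le> (\<integral>y. (n1\<^sup>2 + n2\<^sup>2)\<^sup>2 * (cmod (u y))\<^sup>2 \<partial>leb_D)"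
  proof (rule integral_mono[OF L2D(2)[OF eps_weight_L2[OF u(1)]] i])
    fix y
    have "(eps_r n1 n2 y)\<^sup>2 \<le> n1\<^sup>2 + n2\<^sup>2" by (simp add: eps_r_def)
    then have "((eps_r n1 n2 y)\<^sup>2)\<^sup>2 \<le> (n1\<^sup>2 + n2\<^sup>2)\<^sup>2" by (intro power_mono) auto
    then show "(cmod (complex_of_real ((eps_r n1 n2 y)\<^sup>2) * u y))\<^sup>2 \<le> (n1\<^sup>2 + n2\<^sup>2)\<^sup>2 * (cmod (u y))\<^sup>2"
      by (simp only: norm_mult norm_of_real abs_power2 power_mult_distrib mult_right_mono zero_le_power2)
  qed
  also have "\<dots> = ((n1\<^sup>2 + n2\<^sup>2) * norm x)\<^sup>2"
    by (simp add: u norm_cls power_mult_distrib)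
  finally show ?thesis by (rule power2_le_imp_le) simp
qed

definition emb :: "h10 \<Rightarrow> l2" where
  "emb x = fst (Rep_h10 x)"

lemma emb_bounded_linear: "bounded_linear emb"
proof
  show "\<exists>K. \<forall>x. norm (emb x) \<le> norm x * K"
    using jets0_poincare[OF Rep_h10] by (intro exI[of _ 2]) (simp add: emb_def norm_h10 mult.commute)
qed (simp_all add: emb_def plus_h10.rep_eq scaleR_h10.rep_eq)

lemma emb_scale: "emb (h10_scale c x) = l2_scale c (emb x)"
  by (simp add: emb_def h10_scale.rep_eq jet_scale_def case_prod_beta)

text \<open>A jet over the zero function has zero gradient, since weak derivatives are unique.\<close>

lemma emb_eq_0: "emb x = 0 \<Longrightarrow> x = 0"
proof -
  assume "emb x = 0"
  then have z: "fst (Rep_h10 x) = 0" by (simp add: emb_def)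
  have "weakly_diff e 0 0" for e by (simp add: weakly_diff_def)
  then have "snd (Rep_h10 x) = 0"
    using jets0_weakly_diff[OF Rep_h10[of x]] z weakly_diff_unique
    by (metis prod_eqI fst_zero snd_zero)
  then show "x = 0" using z by (simp add: Rep_h10_inject[symmetric] zero_h10.rep_eq prod_eq_iff)
qed

text \<open>The Riesz representative of \<open>x \<mapsto> \<langle>f, emb x\<rangle>\<close>, so the weak solution \<open>u\<close> of \<open>-\<Delta> u = f\<close> with zero
  boundary values.\<close>

definition emb_adj :: "l2 \<Rightarrow> h10" where
  "emb_adj f = (SOME g. \<forall>x. inner f (emb x) = inner g x)"

lemma inner_emb_adj: "inner (emb_adj f) x = inner f (emb x)"
proof -
  have "bounded_linear (\<lambda>x. inner f (emb x))"
    by (rule bounded_linear_compose[OF bounded_linear_inner_right emb_bounded_linear])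
  from riesz_representation[OF this] have "\<forall>x. inner f (emb x) = inner (emb_adj f) x"
    unfolding emb_adj_def by (rule someI_ex)
  then show ?thesis by simp
qed

lemma emb_adj_eqI: "(\<And>x. inner g x = inner f (emb x)) \<Longrightarrow> emb_adj f = g"
  using vector_eq_ldot[of "emb_adj f" g] by (simp add: inner_emb_adj inner_commute[of _ "emb_adj f"] inner_commute[of _ g])

lemma emb_adj_bounded_linear: "bounded_linear emb_adj"
proof
  show "emb_adj (f + g) = emb_adj f + emb_adj g" for f g
    by (rule emb_adj_eqI) (simp add: inner_add_left inner_emb_adj)
  show "emb_adj (r *\<^sub>R f) = r *\<^sub>R emb_adj f" for r f
    by (rule emb_adj_eqI) (simp add: inner_emb_adj)
  obtain K where K: "0 \<le> K" "\<And>x. norm (emb x) \<le> norm x * K"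
    using bounded_linear.nonneg_bounded[OF emb_bounded_linear] by blast
  have "norm (emb_adj f) \<le> norm f * K" for f
  proof (cases "emb_adj f = 0")
    case True
    then show ?thesis using K(1) by simp
  next
    case False
    have "norm (emb_adj f) * norm (emb_adj f) = inner f (emb (emb_adj f))"
      by (simp add: inner_emb_adj[symmetric] power2_norm_eq_inner[symmetric] power2_eq_square)
    also have "\<dots> \<le> norm f * (norm (emb_adj f) * K)"
      using norm_cauchy_schwarz[of f "emb (emb_adj f)"] mult_left_mono[OF K(2)[of "emb_adj f"], of "norm f"]
      by simp
    finally show ?thesis using False by (simp add: mult.left_commute)
  qed
  then show "\<exists>K. \<forall>f. norm (emb_adj f) \<le> norm f * K" by blast
qed

lemma emb_adj_scale: "emb_adj (l2_scale c f) = h10_scale c (emb_adj f)"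
  by (rule emb_adj_eqI) (simp add: h10.inner_cs l2.inner_cs inner_emb_adj emb_scale)

lemma cinner_emb_adj: "h10.cinner (emb_adj f) x = l2.cinner f (emb x)"
  by (simp add: h10.cinner_def l2.cinner_def inner_emb_adj emb_scale)

locale transmission =
  fixes n1 n2 :: real
  assumes n2_pos: "0 < n2" and n2_less: "n2 < n1"
begin

text \<open>The weak solution of \<open>-\<Delta> u = \<epsilon>\<^sub>r\<^sup>2 f\<close> with zero boundary values.\<close>

definition source :: "l2 \<Rightarrow> h10" where
  "source f = emb_adj (mul_eps n1 n2 f)"

definition B :: "h10 \<Rightarrow> h10" where
  "B x = source (emb x)"

lemma inner_B: "inner (B x) y = inner (mul_eps n1 n2 (emb x)) (emb y)"
  by (simp add: B_def source_def inner_emb_adj)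

text \<open>The form of \<open>B\<close> lies between \<open>n2\<^sup>2\<close> and \<open>n1\<^sup>2\<close> times the squared \<open>L\<^sup>2\<close> norm: the lower bound makes it
  definite, the upper one transfers the compactness inequality from \<^const>\<open>jets0\<close>.\<close>

sublocale complex_compact_positive_operator h10_scale B
proof (intro complex_compact_positive_operator.intro compact_positive_operator.intro
    complex_compact_positive_operator_axioms.intro)
  show "complex_structure h10_scale" by (rule h10.complex_structure_axioms)
  have "bounded_linear (mul_eps n1 n2)"
  proof
    show "mul_eps n1 n2 (r *\<^sub>R x) = r *\<^sub>R mul_eps n1 n2 x" for r x
      using mul_eps_scale[of n1 n2 "of_real r" x] by (simp add: l2_scale_of_real)
    show "\<exists>K. \<forall>x. norm (mul_eps n1 n2 x) \<le> norm x * K"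
      using norm_mul_eps_le[of n1 n2]
      by (intro exI[of _ "n1\<^sup>2 + n2\<^sup>2"] allI) (simp only: mult.commute)
  qed (rule mul_eps_add)
  then show "bounded_linear B"
    unfolding B_def[abs_def] source_def
    by (intro bounded_linear_compose[OF emb_adj_bounded_linear]
        bounded_linear_compose[OF _ emb_bounded_linear])
  show "inner (B x) y = inner x (B y)" for x y
    unfolding inner_B inner_mul_eps_sym[of n1 n2 "emb x"]
    using inner_B[of y x] by (simp add: inner_commute)
  show "0 < inner (B x) x" if "x \<noteq> 0" for x
  proof -
    have "emb x \<noteq> 0" using emb_eq_0 that by blast
    then have "0 < n2\<^sup>2 * (norm (emb x))\<^sup>2" using n2_pos by simp
    then show ?thesis unfolding inner_B
      using inner_mul_eps_bounds(1)[OF n2_pos n2_less, of "emb x"] by linarith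
  qed
  show "B (h10_scale z x) = h10_scale z (B x)" for z x
    by (simp add: B_def source_def emb_scale mul_eps_scale emb_adj_scale)
  fix \<epsilon> :: real assume "\<epsilon> > 0"
  have n1: "n1 > 0" using n2_pos n2_less by simp
  obtain L where L: "finite L" "\<And>x. x \<in> jets0 \<Longrightarrow>
      (norm (fst x))\<^sup>2 \<le> (\<epsilon> / n1\<^sup>2) * (norm (snd x))\<^sup>2 + (\<Sum>l\<in>L. (inner l (fst x))\<^sup>2)"
    using jets0_rellich[of "\<epsilon> / n1\<^sup>2"] \<open>\<epsilon> > 0\<close> n1 by auto
  obtain M where M: "finite M"
    "\<And>x. (\<Sum>l\<in>L. (inner (n1 *\<^sub>R emb_adj l) x)\<^sup>2) \<le> (\<Sum>m\<in>M. (inner m x)\<^sup>2)"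
    using sum_squares_image_bound[OF L(1), of "\<lambda>l. n1 *\<^sub>R emb_adj l"] by blast
  have "inner (B x) x \<le> \<epsilon> * (norm x)\<^sup>2 + (\<Sum>m\<in>M. (inner m x)\<^sup>2)" for x
  proof -
    have "inner (B x) x \<le> n1\<^sup>2 * (norm (emb x))\<^sup>2"
      unfolding inner_B by (rule inner_mul_eps_bounds(2)[OF n2_pos n2_less])
    also have "\<dots> \<le> n1\<^sup>2 * ((\<epsilon> / n1\<^sup>2) * (norm x)\<^sup>2 + (\<Sum>l\<in>L. (inner l (emb x))\<^sup>2))"
      using L(2)[OF Rep_h10[of x]] by (intro mult_left_mono) (simp_all add: emb_def norm_h10)
    also have "\<dots> = \<epsilon> * (norm x)\<^sup>2 + (\<Sum>l\<in>L. (inner (n1 *\<^sub>R emb_adj l) x)\<^sup>2)"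
      using n1 by (simp add: distrib_left sum_distrib_left inner_emb_adj power_mult_distrib)
    also have "\<dots> \<le> \<epsilon> * (norm x)\<^sup>2 + (\<Sum>m\<in>M. (inner m x)\<^sup>2)"
      using M(2) by simp
    finally show ?thesis .
  qed
  then show "\<exists>M. finite M \<and> (\<forall>x. inner (B x) x \<le> \<epsilon> * (norm x)\<^sup>2 + (\<Sum>m\<in>M. (inner m x)\<^sup>2))"
    using M(1) by blast
qed

definition h10_of :: "field \<Rightarrow> h10" where
  "h10_of u = Abs_h10 (jet u)"

lemma Rep_h10_of: "u \<in> H10 \<Longrightarrow> Rep_h10 (h10_of u) = jet u"
  unfolding h10_of_def by (rule Abs_h10_inverse) (simp add: H10_iff)

lemma H10_H1: "u \<in> H10 \<Longrightarrow> u \<in> H1"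
  by (simp add: H10_iff)

lemma h10_of_surj: "\<exists>u\<in>H10. h10_of u = x"
proof -
  obtain u where u: "u \<in> H10" "jet u = Rep_h10 x" using jets0_surj[OF Rep_h10] by blast
  have "h10_of u = x" by (simp add: h10_of_def u(2) Rep_h10_inverse)
  then show ?thesis using u(1) by blast
qed

lemma emb_h10_of: "u \<in> H10 \<Longrightarrow> emb (h10_of u) = cls u"
  by (simp add: emb_def Rep_h10_of jet_def)

lemma ae_eq_0_iff: "u \<in> H10 \<Longrightarrow> ae_eq u (\<lambda>_. 0) \<longleftrightarrow> h10_of u = 0"
  using cls_eq_iff[OF H1_L2[OF H10_H1] L2_zero, of u] emb_h10_of[of u] emb_eq_0[of "h10_of u"]
    linear_0[OF bounded_linear.linear[OF emb_bounded_linear]] by (auto simp: cls_zero)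

lemma grad_form_eq_cinner:
  assumes "u \<in> H10" "v \<in> H10"
  shows "grad_form u v = h10.cinner (h10_of u) (h10_of v)"
proof -
  have i: "integrable leb_D (\<lambda>x. weak_pdiff e u x * cnj (weak_pdiff e v x))"
    "(\<integral>x. weak_pdiff e u x * cnj (weak_pdiff e v x) \<partial>leb_D) = l2.cinner (wgrad e u) (wgrad e v)"
    if "e \<in> Basis" for e
    using integral_mult_cnj_eq_cinner weak_pdiff_works(2)[OF H10_H1[OF assms(1)] that]
      weak_pdiff_works(2)[OF H10_H1[OF assms(2)] that]
    by (auto simp: wgrad_def intro: L2_mult_integrable L2_cnj)
  have "grad_form u v = (\<Sum>e\<in>Basis. \<integral>x. weak_pdiff e u x * cnj (weak_pdiff e v x) \<partial>leb_D)"
    unfolding grad_form_def by (rule Bochner_Integration.integral_sum) (rule i(1))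
  also have "\<dots> = (\<Sum>e\<in>Basis. l2.cinner (wgrad e u) (wgrad e v))"
    by (intro sum.cong refl i(2))
  also have "\<dots> = h10.cinner (h10_of u) (h10_of v)"
    by (simp add: Basis_point l2.cinner_def h10.cinner_def complex_eq_iff inner_h10.rep_eq
        h10_scale.rep_eq Rep_h10_of assms jet_def jet_scale_def)
  finally show ?thesis .
qed

lemma eps_form_eq_cinner_source:
  assumes "u \<in> L2" "v \<in> H10"
  shows "eps_form n1 n2 u v = h10.cinner (source (cls u)) (h10_of v)"
  unfolding eps_form_eq_cinner[OF assms(1) H1_L2[OF H10_H1[OF assms(2)]]]
  by (simp add: source_def cinner_emb_adj emb_h10_of assms)

lemma eps_form_H10:
  assumes "u \<in> H10" "v \<in> H10"
  shows "eps_form n1 n2 u v = h10.cinner (B (h10_of u)) (h10_of v)"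
  using eps_form_eq_cinner_source[OF H1_L2[OF H10_H1[OF assms(1)]] assms(2)]
  by (simp add: B_def emb_h10_of assms)

text \<open>The test functions \<open>v\<close> of the weak formulation reach every element of \<^typ>\<open>h10\<close>.\<close>

lemma all_cinner_eq_0_iff: "(\<forall>v\<in>H10. h10.cinner x (h10_of v) = 0) \<longleftrightarrow> x = 0"
proof
  assume "\<forall>v\<in>H10. h10.cinner x (h10_of v) = 0"
  then have "h10.cinner x y = 0" for y using h10_of_surj[of y] by auto
  then show "x = 0" by (rule h10.cinner_eq_0_imp)
qed (simp add: h10.cinner_def complex_eq_iff)

lemma weak_solution_iff:
  assumes "w \<in> H1" "u \<in> H10"
  shows "weak_solution n1 n2 w z u \<longleftrightarrow> solves (source (cls w)) z (h10_of u)"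
proof -
  let ?x = "h10_of u"
  have "grad_form u v - z * eps_form n1 n2 u v = z * eps_form n1 n2 w v
      \<longleftrightarrow> h10.cinner (?x - h10_scale z (B ?x) - h10_scale z (source (cls w))) (h10_of v) = 0"
    if "v \<in> H10" for v
    by (simp add: grad_form_eq_cinner eps_form_H10 eps_form_eq_cinner_source H1_L2 assms that
        h10.cinner_diff_left h10.cinner_cs_left)
  then have "weak_solution n1 n2 w z u
      \<longleftrightarrow> ?x - h10_scale z (B ?x) - h10_scale z (source (cls w)) = 0"
    using all_cinner_eq_0_iff assms(2) by (auto simp: weak_solution_def)
  also have "\<dots> \<longleftrightarrow> solves (source (cls w)) z ?x"
    unfolding solves_def diff_diff_eq right_minus_eq ..
  finally show ?thesis .
qed

lemma eigenfunction_iff: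
  assumes "\<phi> \<in> H10"
  shows "eigenfunction n1 n2 lam \<phi> \<longleftrightarrow> h10_of \<phi> \<noteq> 0 \<and> h10_of \<phi> = h10_scale lam (B (h10_of \<phi>))"
proof -
  let ?x = "h10_of \<phi>"
  have "grad_form \<phi> v = lam * eps_form n1 n2 \<phi> v \<longleftrightarrow> h10.cinner (?x - h10_scale lam (B ?x)) (h10_of v) = 0"
    if "v \<in> H10" for v
    by (simp add: grad_form_eq_cinner eps_form_H10 assms that h10.cinner_diff_left h10.cinner_cs_left)
  then have "(\<forall>v\<in>H10. grad_form \<phi> v = lam * eps_form n1 n2 \<phi> v) \<longleftrightarrow> ?x - h10_scale lam (B ?x) = 0"
    using all_cinner_eq_0_iff by auto
  then show ?thesis using assms by (simp add: eigenfunction_def ae_eq_0_iff)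
qed

lemma eigenvalues_eq_eigs: "eigenvalues n1 n2 = eigs"
proof (intro set_eqI iffI)
  fix lam assume "lam \<in> eigenvalues n1 n2"
  then obtain \<phi> where "\<phi> \<in> H10" "eigenfunction n1 n2 lam \<phi>"
    by (auto simp: eigenvalues_def eigenfunction_def)
  then show "lam \<in> eigs" using eigenfunction_iff by (auto simp: eigs_def)
next
  fix lam assume "lam \<in> eigs"
  then obtain x where x: "x \<noteq> 0" "x = h10_scale lam (B x)" by (auto simp: eigs_def)
  obtain \<phi> where \<phi>: "\<phi> \<in> H10" "h10_of \<phi> = x" using h10_of_surj by blast
  have "eigenfunction n1 n2 lam \<phi>" unfolding eigenfunction_iff[OF \<phi>(1)] \<phi>(2) using x by blast
  then show "lam \<in> eigenvalues n1 n2" by (auto simp: eigenvalues_def)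
qed

text \<open>The real and the imaginary part of the Hermitian product with \<open>x\<close> are the inner products with
  \<open>x\<close> and with \<open>\<i> x\<close>, and both vectors lie in the eigenspace.\<close>

lemma coupled_eigenfunction_iff:
  assumes "w \<in> H1"
  shows "(\<exists>\<phi>. eigenfunction n1 n2 lam \<phi> \<and> eps_form n1 n2 w \<phi> \<noteq> 0)
     \<longleftrightarrow> (\<exists>x. x = h10_scale lam (B x) \<and> inner (source (cls w)) x \<noteq> 0)"
proof
  assume "\<exists>\<phi>. eigenfunction n1 n2 lam \<phi> \<and> eps_form n1 n2 w \<phi> \<noteq> 0"
  then obtain \<phi> where \<phi>: "\<phi> \<in> H10" "eigenfunction n1 n2 lam \<phi>" "eps_form n1 n2 w \<phi> \<noteq> 0"
    by (auto simp: eigenfunction_def)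
  define x where "x = h10_of \<phi>"
  have x: "x = h10_scale lam (B x)" using \<phi> eigenfunction_iff by (simp add: x_def)
  have ix: "h10_scale \<i> x = h10_scale lam (B (h10_scale \<i> x))"
    by (subst x) (simp add: B_cs h10.cs_cs mult.commute)
  have "h10.cinner (source (cls w)) x \<noteq> 0"
    using \<phi> eps_form_eq_cinner_source[OF H1_L2[OF assms]] by (simp add: x_def)
  then have "inner (source (cls w)) x \<noteq> 0 \<or> inner (source (cls w)) (h10_scale \<i> x) \<noteq> 0"
    by (simp add: h10.cinner_def complex_eq_iff)
  then show "\<exists>x. x = h10_scale lam (B x) \<and> inner (source (cls w)) x \<noteq> 0" using x ix by blast
next
  assume "\<exists>x. x = h10_scale lam (B x) \<and> inner (source (cls w)) x \<noteq> 0"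
  then obtain x where x: "x = h10_scale lam (B x)" "inner (source (cls w)) x \<noteq> 0" by blast
  then have "x \<noteq> 0" by auto
  obtain \<phi> where \<phi>: "\<phi> \<in> H10" "h10_of \<phi> = x" using h10_of_surj by blast
  have "eigenfunction n1 n2 lam \<phi>"
    unfolding eigenfunction_iff[OF \<phi>(1)] \<phi>(2) using x \<open>x \<noteq> 0\<close> by blast
  moreover have "eps_form n1 n2 w \<phi> \<noteq> 0"
    unfolding eps_form_eq_cinner_source[OF H1_L2[OF assms] \<phi>(1)] \<phi>(2)
    using x(2) by (simp add: h10.cinner_def complex_eq_iff)
  ultimately show "\<exists>\<phi>. eigenfunction n1 n2 lam \<phi> \<and> eps_form n1 n2 w \<phi> \<noteq> 0" by blast
qed

lemma H1_diff:
  assumes "u \<in> H1" "v \<in> H1"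
  shows "(\<lambda>x. u x - v x) \<in> H1" "jet (\<lambda>x. u x - v x) = jet u - jet v"
  using H1_add(1)[OF assms(1) H1_scale(1)[OF assms(2), of "-1"]]
    jet_add[OF assms(1) H1_scale(1)[OF assms(2), of "-1"]]
    jet_scale[OF assms(2), of "-1"] jet_scale_of_real[of "-1" "jet v"] by simp_all

lemma H1_divide:
  assumes "u \<in> H1"
  shows "(\<lambda>x. u x / c) \<in> H1" "jet (\<lambda>x. u x / c) = jet_scale (1 / c) (jet u)"
  using H1_scale(1)[OF assms, of "1 / c"] jet_scale[OF assms, of "1 / c"] by simp_all

lemma norm_jet_scale: "norm (jet_scale z x) = cmod z * norm x"
proof (cases x)
  case (fields u p q)
  have "(norm (jet_scale z x))\<^sup>2 = (cmod z * norm x)\<^sup>2"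
    unfolding fields jet_scale_def
    by (simp add: norm_Pair norm_l2_scale power_mult_distrib distrib_left)
  then show ?thesis by (rule power2_eq_imp_eq) auto
qed

lemma jet_eq_imp_ae_eq: "u \<in> H1 \<Longrightarrow> v \<in> H1 \<Longrightarrow> jet u = jet v \<Longrightarrow> ae_eq u v"
  using cls_eq_iff[OF H1_L2 H1_L2, of u v] by (simp add: jet_def)

text \<open>The jet of the difference quotient splits into a part in \<^typ>\<open>h10\<close>, whose jet norm is at most
  three times its gradient norm, and a scalar multiple of the fixed jet of \<open>w\<close>.\<close>

lemma h1_holomorphic_onI:
  assumes w: "w \<in> H1"
    and F: "\<And>z. z \<in> A \<Longrightarrow> F z \<in> H1" "\<And>z. z \<in> A \<Longrightarrow> jet (F z) = Rep_h10 (f z) + jet_scale (p z) (jet w)"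
    and f: "\<And>z. z \<in> A \<Longrightarrow> h10.holo_at f z"
    and p: "\<And>z. z \<in> A \<Longrightarrow> (p has_field_derivative p' z) (at z)"
  shows "h1_holomorphic_on F A"
  unfolding h1_holomorphic_on_def
proof (intro conjI ballI)
  fix z assume z: "z \<in> A"
  obtain d where d: "(f has_derivative (\<lambda>k. h10_scale k d)) (at z)"
    using f[OF z] by (auto simp: h10.holo_at_def)
  obtain v where v: "v \<in> H10" "h10_of v = d" using h10_of_surj by blast
  have vH: "v \<in> H1" "jet v = Rep_h10 d" using H10_H1[OF v(1)] Rep_h10_of[OF v(1)] v(2) by auto
  define F' where "F' x = v x + p' z * w x" for x
  have F': "F' \<in> H1" "jet F' = Rep_h10 d + jet_scale (p' z) (jet w)"
    using H1_add(1)[OF vH(1) H1_scale(1)[OF w]] jet_add[OF vH(1) H1_scale(1)[OF w]]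
    by (simp_all add: F'_def[abs_def] vH(2) jet_scale[OF w])
  define q where "q y = h10_scale (1 / (y - z)) (f y - f z) - d" for y
  define k where "k y = (p y - p z) / (y - z) - p' z" for y
  have bound: "norm (h1_norm (\<lambda>x. (F y x - F z x) / (y - z) - F' x)) \<le> 3 * norm (q y) + cmod (k y) * norm (jet w)"
    if y: "y \<in> A" "y \<noteq> z" for y
  proof -
    note D = H1_diff[OF F(1)[OF y(1)] F(1)[OF z]]
    note Q = H1_divide[OF D(1), of "y - z"]
    note T = H1_diff[OF Q(1) F'(1)]
    have "jet (\<lambda>x. (F y x - F z x) / (y - z) - F' x)
        = jet_scale (1 / (y - z)) ((Rep_h10 (f y) - Rep_h10 (f z)) + jet_scale (p y - p z) (jet w))
          - (Rep_h10 d + jet_scale (p' z) (jet w))"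
      unfolding T(2) Q(2) D(2) F(2)[OF y(1)] F(2)[OF z] F'(2)
      using jet_scale_simps(1)[of "p y - p z" "p z" "jet w"] by (simp add: algebra_simps)
    also have "\<dots> = Rep_h10 (q y) + jet_scale (k y) (jet w)"
      using jet_scale_simps(1)[of "k y" "p' z" "jet w"]
      by (simp add: q_def k_def minus_h10.rep_eq h10_scale.rep_eq jet_scale_simps)
    finally have "h1_norm (\<lambda>x. (F y x - F z x) / (y - z) - F' x) = norm (Rep_h10 (q y) + jet_scale (k y) (jet w))"
      by (simp add: h1_norm_jet[OF T(1)])
    also have "\<dots> \<le> 3 * norm (q y) + cmod (k y) * norm (jet w)"
      using norm_triangle_ineq[of "Rep_h10 (q y)" "jet_scale (k y) (jet w)"] norm_Rep_h10[of "q y"]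
      by (simp add: norm_jet_scale)
    finally show ?thesis using h1_norm_jet[OF T(1)] by simp
  qed
  have "((\<lambda>y. norm (q y)) \<longlongrightarrow> 0) (at z within A)"
    unfolding q_def by (rule tendsto_within_subset[OF h10.holo_at_difference_quotient[OF d]]) simp
  moreover have "((\<lambda>y. cmod (k y)) \<longlongrightarrow> 0) (at z within A)"
  proof -
    have "((\<lambda>y. (p y - p z) / (y - z)) \<longlongrightarrow> p' z) (at z)"
      using p[OF z] by (simp add: has_field_derivative_iff)
    then have "((\<lambda>y. k y) \<longlongrightarrow> 0) (at z)" unfolding k_def by (simp add: LIM_zero_iff)
    then have "((\<lambda>y. cmod (k y)) \<longlongrightarrow> 0) (at z)" by (rule tendsto_norm_zero)
    then show ?thesis by (rule tendsto_within_subset) simp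
  qed
  ultimately have "((\<lambda>y. 3 * norm (q y) + cmod (k y) * norm (jet w)) \<longlongrightarrow> 3 * 0 + 0 * norm (jet w)) (at z within A)"
    by (intro tendsto_intros)
  then have lim: "((\<lambda>y. 3 * norm (q y) + cmod (k y) * norm (jet w)) \<longlongrightarrow> 0) (at z within A)" by simp
  have "((\<lambda>y. h1_norm (\<lambda>x. (F y x - F z x) / (y - z) - F' x)) \<longlongrightarrow> 0) (at z within A)"
    by (rule Lim_null_comparison[OF _ lim]) (use bound in \<open>simp add: eventually_at_filter\<close>)
  then show "\<exists>F'\<in>H1. ((\<lambda>y. h1_norm (\<lambda>x. (F y x - F z x) / (y - z) - F' x)) \<longlongrightarrow> 0) (at z within A)"
    using F'(1) by blast
qed (rule F(1))

lemma h1_holomorphic_on_continuous: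
  assumes G: "h1_holomorphic_on G A" and A: "open A" "z \<in> A"
  shows "((\<lambda>y. jet (G y)) \<longlongrightarrow> jet (G z)) (at z)"
proof -
  have GH: "\<And>y. y \<in> A \<Longrightarrow> G y \<in> H1" using G by (simp add: h1_holomorphic_on_def)
  obtain G' where G': "G' \<in> H1"
    "((\<lambda>y. h1_norm (\<lambda>x. (G y x - G z x) / (y - z) - G' x)) \<longlongrightarrow> 0) (at z within A)"
    using G A(2) unfolding h1_holomorphic_on_def by blast
  have lim: "((\<lambda>y. h1_norm (\<lambda>x. (G y x - G z x) / (y - z) - G' x)) \<longlongrightarrow> 0) (at z)"
    using G'(2) unfolding at_within_open[OF A(2,1)] .
  have lim2: "((\<lambda>y. cmod (y - z) * (h1_norm (\<lambda>x. (G y x - G z x) / (y - z) - G' x) + norm (jet G'))) \<longlongrightarrow> 0) (at z)"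
  proof -
    have "((\<lambda>y. cmod (y - z)) \<longlongrightarrow> cmod (z - z)) (at z)" by (intro tendsto_intros)
    from tendsto_mult[OF this tendsto_add[OF lim tendsto_const[of "norm (jet G')"]]] show ?thesis by simp
  qed
  have "norm (jet (G y) - jet (G z))
      \<le> cmod (y - z) * (h1_norm (\<lambda>x. (G y x - G z x) / (y - z) - G' x) + norm (jet G'))"
    if y: "y \<in> A" "y \<noteq> z" for y
  proof -
    note D = H1_diff[OF GH[OF y(1)] GH[OF A(2)]]
    note Q = H1_divide[OF D(1), of "y - z"]
    note T = H1_diff[OF Q(1) G'(1)]
    let ?t = "\<lambda>x. (G y x - G z x) / (y - z) - G' x"
    have "jet (G y) - jet (G z) = jet_scale (y - z) (jet ?t + jet G')"
      unfolding T(2) Q(2) D(2) using y(2) jet_scale_of_real[of 1 "jet (G y) - jet (G z)"]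
      by (simp add: jet_scale_simps)
    then have "norm (jet (G y) - jet (G z)) = cmod (y - z) * norm (jet ?t + jet G')"
      by (simp only: norm_jet_scale)
    also have "\<dots> \<le> cmod (y - z) * (h1_norm ?t + norm (jet G'))"
      unfolding h1_norm_jet[OF T(1)] by (intro mult_left_mono norm_triangle_ineq) simp
    finally show ?thesis .
  qed
  then have "\<forall>\<^sub>F y in at z. norm (jet (G y) - jet (G z))
      \<le> cmod (y - z) * (h1_norm (\<lambda>x. (G y x - G z x) / (y - z) - G' x) + norm (jet G'))"
    using eventually_at_topological A by blast
  from Lim_null_comparison[OF this lim2] show ?thesis by (simp add: LIM_zero_iff)
qed

text \<open>Any choice of a weak solution has the jet of the unique solution of the operator equation.\<close>

lemma frequency_response_jet:
  assumes w: "w \<in> H1" and z: "z \<notin> eigs"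
  shows "frequency_response n1 n2 w z \<in> H1"
    "jet (frequency_response n1 n2 w z) = Rep_h10 (sol (source (cls w)) z) + jet w"
proof -
  define g where "g = source (cls w)"
  obtain u0 where u0: "u0 \<in> H10" "h10_of u0 = sol g z" using h10_of_surj by blast
  have "weak_solution n1 n2 w z u0"
    using weak_solution_iff[OF w u0(1)] sol_off_eigs(1)[OF z, of g] u0(2) by (simp add: g_def)
  define u where "u = (SOME u. weak_solution n1 n2 w z u)"
  have ws: "weak_solution n1 n2 w z u"
    unfolding u_def using someI[of "weak_solution n1 n2 w z", OF \<open>weak_solution n1 n2 w z u0\<close>] by simp
  then have u: "u \<in> H10" by (simp add: weak_solution_def)
  then have "h10_of u = sol g z"
    using weak_solution_iff[OF w u] ws sol_eqI[OF z] by (simp add: g_def)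
  then have "jet u = Rep_h10 (sol g z)" using Rep_h10_of[OF u] by simp
  then show "frequency_response n1 n2 w z \<in> H1"
    "jet (frequency_response n1 n2 w z) = Rep_h10 (sol (source (cls w)) z) + jet w"
    using H1_add(1)[OF H10_H1[OF u] w] jet_add[OF H10_H1[OF u] w]
    by (simp_all add: frequency_response_def u_def[symmetric] g_def)
qed

lemma jet_scale_1: "jet_scale 1 x = x" and jet_scale_0: "jet_scale 0 x = 0"
  using jet_scale_of_real[of 1 x] jet_scale_of_real[of 0 x] by simp_all

lemma frequency_response_holomorphic:
  assumes "w \<in> H1"
  shows "h1_holomorphic_on (frequency_response n1 n2 w) (- eigs)"
  by (rule h1_holomorphic_onI[OF assms, of _ _ "sol (source (cls w))" "\<lambda>_. 1" "\<lambda>_. 0"])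
    (simp_all add: frequency_response_jet[OF assms] sol_off_eigs(2) jet_scale_1)

text \<open>If \<open>(z - \<lambda>) u(z)\<close> extends to \<open>H\<close>, then \<open>(z - \<lambda>) (u(z) + w)\<close> extends to \<open>H z + (z - \<lambda>) w\<close>, which
  has the same value at \<open>\<lambda>\<close>.\<close>

lemma frequency_response_pole:
  assumes w: "w \<in> H1" and lam: "lam \<in> eigs"
  shows "\<exists>r>0. \<exists>G. h1_holomorphic_on G (ball lam r) \<and>
     (\<forall>z\<in>ball lam r - {lam}. ae_eq (frequency_response n1 n2 w z) (\<lambda>x. G z x / (z - lam) ^ 1)) \<and>
     (\<not> ae_eq (G lam) (\<lambda>x. 0)
        \<longleftrightarrow> (\<exists>\<phi>. eigenfunction n1 n2 lam \<phi> \<and> eps_form n1 n2 w \<phi> \<noteq> 0))"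
proof -
  define g where "g = source (cls w)"
  from sol_pole[OF lam, of g] obtain r where r_ex: "r > 0 \<and> (\<exists>H. (\<forall>z\<in>ball lam r. h10.holo_at H z) \<and> ball lam r \<inter> eigs = {lam} \<and>
     (\<forall>z\<in>ball lam r - {lam}. sol g z = h10_scale (1 / (z - lam)) (H z)) \<and>
     (H lam \<noteq> 0 \<longleftrightarrow> (\<exists>x. x = h10_scale lam (B x) \<and> inner g x \<noteq> 0)))"
    by (rule exE)
  from conjunct2[OF r_ex] obtain H where "(\<forall>z\<in>ball lam r. h10.holo_at H z) \<and> ball lam r \<inter> eigs = {lam} \<and>
     (\<forall>z\<in>ball lam r - {lam}. sol g z = h10_scale (1 / (z - lam)) (H z)) \<and>
     (H lam \<noteq> 0 \<longleftrightarrow> (\<exists>x. x = h10_scale lam (B x) \<and> inner g x \<noteq> 0))"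
    by (rule exE)
  then have H: "\<And>z. z \<in> ball lam r \<Longrightarrow> h10.holo_at H z"
    and int: "ball lam r \<inter> eigs = {lam}"
    and sol: "\<And>z. z \<in> ball lam r - {lam} \<Longrightarrow> sol g z = h10_scale (1 / (z - lam)) (H z)"
    and nz: "H lam \<noteq> 0 \<longleftrightarrow> (\<exists>x. x = h10_scale lam (B x) \<and> inner g x \<noteq> 0)"
    by (elim conjE, simp only:)+
  have r: "r > 0" using r_ex by (rule conjunct1)
  have "\<forall>z. \<exists>v. v \<in> H10 \<and> h10_of v = H z" using h10_of_surj by blast
  from choice[OF this] obtain V where V: "\<forall>z. V z \<in> H10 \<and> h10_of (V z) = H z" by (rule exE)
  have VH: "V z \<in> H10" "V z \<in> H1" "jet (V z) = Rep_h10 (H z)" for z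
    using spec[OF V, of z] H10_H1[of "V z"] Rep_h10_of[of "V z"] by simp_all
  define G where "G z x = V z x + (z - lam) * w x" for z x
  have G: "G z \<in> H1" "jet (G z) = Rep_h10 (H z) + jet_scale (z - lam) (jet w)" for z
    using H1_add(1)[OF VH(2) H1_scale(1)[OF w]] jet_add[OF VH(2) H1_scale(1)[OF w]]
    by (simp_all add: G_def[abs_def] VH(3) jet_scale[OF w])
  have "h1_holomorphic_on G (ball lam r)"
    by (rule h1_holomorphic_onI[OF w, of _ _ H "\<lambda>z. z - lam" "\<lambda>_. 1"])
      (auto intro!: G H derivative_eq_intros)
  moreover have "ae_eq (frequency_response n1 n2 w z) (\<lambda>x. G z x / (z - lam) ^ 1)"
    if z: "z \<in> ball lam r - {lam}" for z
  proof -
    have ze: "z \<notin> eigs" using z int by blast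
    have "z \<noteq> lam" using z by blast
    note FR = frequency_response_jet[OF w ze]
    note Q = H1_divide[OF G(1)[of z], of "z - lam"]
    have "jet (\<lambda>x. G z x / (z - lam)) = jet (frequency_response n1 n2 w z)"
      unfolding Q(2) FR(2) G(2) g_def[symmetric] sol[OF z] h10_scale.rep_eq
      using \<open>z \<noteq> lam\<close> by (simp add: jet_scale_simps jet_scale_1)
    then have "ae_eq (frequency_response n1 n2 w z) (\<lambda>x. G z x / (z - lam))"
      by (intro jet_eq_imp_ae_eq FR(1) Q(1)) simp
    then show ?thesis by (simp only: power_one_right)
  qed
  moreover have "\<not> ae_eq (G lam) (\<lambda>x. 0)
        \<longleftrightarrow> (\<exists>\<phi>. eigenfunction n1 n2 lam \<phi> \<and> eps_form n1 n2 w \<phi> \<noteq> 0)"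
  proof -
    have "G lam = V lam" by (simp add: G_def fun_eq_iff)
    then have "\<not> ae_eq (G lam) (\<lambda>x. 0) \<longleftrightarrow> H lam \<noteq> 0"
      using ae_eq_0_iff[OF VH(1)] V by simp
    then show ?thesis unfolding nz coupled_eigenfunction_iff[OF w] g_def .
  qed
  ultimately show ?thesis using r by blast
qed

text \<open>Two numerators agree on a punctured disc, and both are continuous at its centre.\<close>

lemma pole_representation_unique:
  assumes w: "w \<in> H1" and lam: "lam \<in> eigs"
    and G: "r > 0" "h1_holomorphic_on G (ball lam r)"
      "\<forall>z\<in>ball lam r - {lam}. ae_eq (frequency_response n1 n2 w z) (\<lambda>x. G z x / (z - lam) ^ 1)"
    and G': "r' > 0" "h1_holomorphic_on G' (ball lam r')"
      "\<forall>z\<in>ball lam r' - {lam}. ae_eq (frequency_response n1 n2 w z) (\<lambda>x. G' z x / (z - lam) ^ 1)"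
  shows "ae_eq (G lam) (G' lam)"
proof -
  define s where "s = min r r'"
  have s: "s > 0" using G(1) G'(1) by (simp add: s_def)
  have H: "G z \<in> H1" "G' z \<in> H1" if "z \<in> ball lam s" for z
    using that G(2) G'(2) by (auto simp: h1_holomorphic_on_def s_def)
  have lim: "((\<lambda>z. fst (jet (G z))) \<longlongrightarrow> fst (jet (G lam))) (at lam)"
    by (intro tendsto_fst h1_holomorphic_on_continuous[OF G(2)]) (use G(1) in auto)
  have lim': "((\<lambda>z. fst (jet (G' z))) \<longlongrightarrow> fst (jet (G' lam))) (at lam)"
    by (intro tendsto_fst h1_holomorphic_on_continuous[OF G'(2)]) (use G'(1) in auto)
  have ev: "\<forall>\<^sub>F z in at lam. fst (jet (G z)) = fst (jet (G' z))"
    unfolding eventually_at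
  proof (intro exI[of _ s] conjI s ballI impI)
    fix z assume "z \<noteq> lam \<and> dist z lam < s"
    then have z: "z \<noteq> lam" "z \<in> ball lam s" "z \<in> ball lam r - {lam}" "z \<in> ball lam r' - {lam}"
      by (auto simp: dist_commute s_def)
    have "ae_eq (\<lambda>x. G z x / (z - lam) ^ 1) (\<lambda>x. G' z x / (z - lam) ^ 1)"
      using G(3) G'(3) z(3,4) ae_eq_sym ae_eq_trans by blast
    then have "ae_eq (G z) (G' z)" using z(1) by (simp add: ae_eq_def)
    then show "fst (jet (G z)) = fst (jet (G' z))"
      using cls_eq_iff[OF H1_L2 H1_L2] H[OF z(2)] by (simp add: jet_def)
  qed
  have "fst (jet (G lam)) = fst (jet (G' lam))"
    by (rule tendsto_unique[OF trivial_limit_at iffD1[OF tendsto_cong[OF ev] lim] lim'])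
  moreover have "lam \<in> ball lam s" using s by simp
  ultimately show ?thesis
    using cls_eq_iff[OF H1_L2 H1_L2, OF H] by (simp add: jet_def)
qed

end

theorem proposition4p2:
  fixes n1 n2 \<theta> :: real and w_g :: "real \<times> real \<Rightarrow> complex"
  assumes "n1 > n2" and "n2 > 0"
    and "\<theta> = 29 * pi / 180 \<or> \<theta> = 69 * pi / 180"
    and "harmonic_extension (u_ex n1 n2 11 \<theta>) w_g"
  shows "h1_meromorphic (frequency_response n1 n2 w_g) (eigenvalues n1 n2) \<and>
    (\<forall>lam\<in>eigenvalues n1 n2.
       h1_pole_order_le (frequency_response n1 n2 w_g) lam 1 \<and>
       (h1_pole_of_order (frequency_response n1 n2 w_g) lam 1 \<longleftrightarrow>
          (\<exists>\<phi>. eigenfunction n1 n2 lam \<phi> \<and> eps_form n1 n2 w_g \<phi> \<noteq> 0)))"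
proof -
  interpret transmission n1 n2 by unfold_locales (use assms in auto)
  have w: "w_g \<in> H1" using assms(4) by (simp add: harmonic_extension_def)
  let ?F = "frequency_response n1 n2 w_g"
  have pole_le: "h1_pole_order_le ?F lam 1" if "lam \<in> eigs" for lam
    using frequency_response_pole[OF w that] unfolding h1_pole_order_le_def by blast
  have pole: "h1_pole_of_order ?F lam 1 \<longleftrightarrow>
      (\<exists>\<phi>. eigenfunction n1 n2 lam \<phi> \<and> eps_form n1 n2 w_g \<phi> \<noteq> 0)" if lam: "lam \<in> eigs" for lam
  proof -
    obtain r G where G: "r > 0" "h1_holomorphic_on G (ball lam r)"
      "\<forall>z\<in>ball lam r - {lam}. ae_eq (?F z) (\<lambda>x. G z x / (z - lam) ^ 1)"
      "\<not> ae_eq (G lam) (\<lambda>x. 0) \<longleftrightarrow> (\<exists>\<phi>. eigenfunction n1 n2 lam \<phi> \<and> eps_form n1 n2 w_g \<phi> \<noteq> 0)"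
      using frequency_response_pole[OF w lam] by blast
    have "h1_pole_of_order ?F lam 1 \<longleftrightarrow> \<not> ae_eq (G lam) (\<lambda>x. 0)"
    proof
      assume "h1_pole_of_order ?F lam 1"
      then obtain r' G' where G': "r' > 0" "h1_holomorphic_on G' (ball lam r')"
        "\<forall>z\<in>ball lam r' - {lam}. ae_eq (?F z) (\<lambda>x. G' z x / (z - lam) ^ 1)" "\<not> ae_eq (G' lam) (\<lambda>x. 0)"
        unfolding h1_pole_of_order_def by blast
      have "ae_eq (G' lam) (G lam)" by (rule pole_representation_unique[OF w lam G'(1-3) G(1-3)])
      then show "\<not> ae_eq (G lam) (\<lambda>x. 0)" using G'(4) ae_eq_trans by blast
    next
      assume "\<not> ae_eq (G lam) (\<lambda>x. 0)"
      then show "h1_pole_of_order ?F lam 1"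
        unfolding h1_pole_of_order_def using G(1-3) zero_less_one by blast
    qed
    then show ?thesis using G(4) by blast
  qed
  show ?thesis
    unfolding eigenvalues_eq_eigs h1_meromorphic_def
    using eigs_no_limpt frequency_response_holomorphic[OF w] pole_le pole by blast
qed

end
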